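(* Let $0<p<\infty$, $\alpha>-1$, and let $\mu$ be a positive Borel measure on $[0,1)$ satisfying condition $(W_{p,\alpha})$. (i) If $q\ge p$ and $q>1$, then $\mathcal{H}_{\mu,\alpha+2}$ is a compact operator from $A^p_\alpha$ into $A^q_\alpha$ if and only if $\mu$ is a vanishing $\left(\frac{\alpha+2}{p}+\frac{\alpha+2}{q'}\right)$-Carleson measure. (ii) If $q\ge p$ and $q=1$, then $\mathcal{H}_{\mu,\alpha+2}$ is a compact operator from $A^p_\alpha$ into $A^1_\alpha$ if and only if $\mu$ is a vanishing $1$-logarithmic $\frac{\alpha+2}{p}$-Carleson measure.
   Context: $\mathbb{D}$ is the open unit disc, $dA=\frac1\pi dx\,dy$. For $0<p<\infty$, $\alpha>-1$, $A^p_\alpha$ is the space of analytic $f$ on $\mathbb{D}$ with $\|f\|_{A^p_\alpha}=\left((\alpha+1)\int_{\mathbb{D}}|f|^p(1-|z|^2)^\alpha dA\right)^{1/p}<\infty$. $1/q+1/q'=1$. For a positive Borel measure $\mu$ on $[0,1)$ and $\beta>0$, $\mu_{n,k,\beta}=\frac{\Gamma(n+\beta)}{n!\Gamma(\beta)}\int_{[0,1)}t^{n+k}d\mu(t)$ and for $f(z)=\sum_k a_kz^k$ analytic, $\mathcal{H}_{\mu,\beta}(f)(z)=\sum_n\left(\sum_k\mu_{n,k,\beta}a_k\right)z^n$. Compactness from $X$ into $Y$ means $\mathcal{H}_{\mu,\beta}$ maps $X$ into $Y$ and takes bounded sets to relatively compact sets. A measure $\mu$ on $[0,1)$ is regarded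 as a measure on $\mathbb{D}$ via $\mu(E)=\mu(E\cap[0,1))$. For an arc $I\subset\partial\mathbb{D}$, $S(I)=\{re^{i\theta}:e^{i\theta}\in I,\ 1-\frac{|I|}{2\pi}\le r\le1\}$. For $s>0$, $\mu$ is an $s$-Carleson measure if $\mu([t,1))\le C(1-t)^s$ for $0\le t<1$; a vanishing $s$-Carleson measure if $\mu(S(I))/|I|^s\to0$ as $|I|\to0$ (equivalently $\mu([t,1))=o((1-t)^s)$ as $t\to1^-$); a vanishing $\gamma$-logarithmic $s$-Carleson measure ($\gamma\ge0$) if $\mu(S(I))\left(\log\frac{2\pi}{|I|}\right)^\gamma=o(|I|^s)$ as $|I|\to0$. Condition $(W_{p,\alpha})$: if $0<p\le1$, $\mu$ is a $\frac{\alpha+2}{p}$-Carleson measure; if $1\le p\le 2$, $\mu$ is a $\frac{\alpha+2-(p-1)^2}{p}$-Carleson measure; if $2\le p<\infty$, $\mu$ is a $\frac{\alpha+1}{p}$-Carleson measure. *)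

theory Defs
  imports "HOL-Analysis.Analysis"
begin

definition bergman_integral :: "real \<Rightarrow> real \<Rightarrow> (complex \<Rightarrow> complex) \<Rightarrow> ennreal" where
  "bergman_integral p \<alpha> f =
     (\<integral>\<^sup>+ z \<in> ball 0 1. ennreal (norm (f z) powr p * (1 - (norm z)\<^sup>2) powr \<alpha>) \<partial>lborel)"

definition bergman_space :: "real \<Rightarrow> real \<Rightarrow> (complex \<Rightarrow> complex) set" where
  "bergman_space p \<alpha> = {f. f holomorphic_on ball 0 1 \<and> bergman_integral p \<alpha> f < \<infinity>}"

text \<open>||f||_{A^p_alpha} = ((alpha+1) * integral |f|^p (1-|z|^2)^alpha dA)^(1/p), dA = dx dy / pi.\<close>
definition bergman_norm :: "real \<Rightarrow> real \<Rightarrow> (complex \<Rightarrow> complex) \<Rightarrow> real" where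
  "bergman_norm p \<alpha> f = ((\<alpha> + 1) / pi * enn2real (bergman_integral p \<alpha> f)) powr (1 / p)"

definition taylor_coeff :: "(complex \<Rightarrow> complex) \<Rightarrow> nat \<Rightarrow> complex" where
  "taylor_coeff f k = (deriv ^^ k) f 0 / of_nat (fact k)"

definition mu_coeff :: "real measure \<Rightarrow> real \<Rightarrow> nat \<Rightarrow> nat \<Rightarrow> real" where
  "mu_coeff \<mu> \<beta> n k =
     Gamma (real n + \<beta>) / (fact n * Gamma \<beta>) * (LINT t:{0..<1}|\<mu>. t ^ (n + k))"

definition H_coeff :: "real measure \<Rightarrow> real \<Rightarrow> (complex \<Rightarrow> complex) \<Rightarrow> nat \<Rightarrow> complex" where
  "H_coeff \<mu> \<beta> f n = (\<Sum>k. of_real (mu_coeff \<mu> \<beta> n k) * taylor_coeff f k)"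

definition H_defined :: "real measure \<Rightarrow> real \<Rightarrow> (complex \<Rightarrow> complex) \<Rightarrow> bool" where
  "H_defined \<mu> \<beta> f \<longleftrightarrow>
     (\<forall>n. summable (\<lambda>k. of_real (mu_coeff \<mu> \<beta> n k) * taylor_coeff f k)) \<and>
     (\<forall>z \<in> ball 0 1. summable (\<lambda>n. H_coeff \<mu> \<beta> f n * z ^ n))"

definition H_op :: "real measure \<Rightarrow> real \<Rightarrow> (complex \<Rightarrow> complex) \<Rightarrow> complex \<Rightarrow> complex" where
  "H_op \<mu> \<beta> f z = (\<Sum>n. H_coeff \<mu> \<beta> f n * z ^ n)"

text \<open>Compactness of H_{mu,beta} from A^p_alpha into A^q_alpha: it maps A^p_alpha into
  A^q_alpha and maps bounded sets to relatively compact sets (stated sequentially: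
  every bounded sequence has a subsequence whose images converge in A^q_alpha).\<close>
definition H_compact :: "real measure \<Rightarrow> real \<Rightarrow> real \<Rightarrow> real \<Rightarrow> real \<Rightarrow> bool" where
  "H_compact \<mu> \<beta> p \<alpha> q \<longleftrightarrow>
     (\<forall>f \<in> bergman_space p \<alpha>. H_defined \<mu> \<beta> f \<and> H_op \<mu> \<beta> f \<in> bergman_space q \<alpha>) \<and>
     (\<forall>F :: nat \<Rightarrow> complex \<Rightarrow> complex.
        (\<forall>j. F j \<in> bergman_space p \<alpha>) \<and> (\<exists>B. \<forall>j. bergman_norm p \<alpha> (F j) \<le> B) \<longrightarrow>
        (\<exists>r g. strict_mono r \<and> g \<in> bergman_space q \<alpha> \<and>
           (\<lambda>j. bergman_norm q \<alpha> (\<lambda>z. H_op \<mu> \<beta> (F (r j)) z - g z)) \<longlonglongrightarrow> 0))"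

definition carleson :: "real measure \<Rightarrow> real \<Rightarrow> bool" where
  "carleson \<mu> s \<longleftrightarrow> (\<exists>C. \<forall>t. 0 \<le> t \<and> t < 1 \<longrightarrow> emeasure \<mu> {t..<1} \<le> ennreal (C * (1 - t) powr s))"

definition arc :: "real \<Rightarrow> real \<Rightarrow> complex set" where
  "arc a L = {cis \<theta> | \<theta>. a \<le> \<theta> \<and> \<theta> \<le> a + L}"

definition carleson_box :: "real \<Rightarrow> real \<Rightarrow> complex set" where
  "carleson_box a L = {complex_of_real r * w | r w. w \<in> arc a L \<and> 1 - L / (2 * pi) \<le> r \<and> r \<le> 1}"

text \<open>mu(S(I)), mu regarded as a measure on the disc supported on [0,1).\<close>
definition box_measure :: "real measure \<Rightarrow> real \<Rightarrow> real \<Rightarrow> ennreal" where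
  "box_measure \<mu> a L = emeasure \<mu> {t. 0 \<le> t \<and> t < 1 \<and> complex_of_real t \<in> carleson_box a L}"

definition vanishing_log_carleson :: "real measure \<Rightarrow> real \<Rightarrow> real \<Rightarrow> bool" where
  "vanishing_log_carleson \<mu> \<gamma> s \<longleftrightarrow>
     (\<forall>\<epsilon>>0. \<exists>\<delta>>0. \<forall>a L. 0 < L \<and> L < 2 * pi \<and> L < \<delta> \<longrightarrow>
        box_measure \<mu> a L * ennreal (ln (2 * pi / L) powr \<gamma>) \<le> ennreal (\<epsilon> * L powr s))"

definition vanishing_carleson :: "real measure \<Rightarrow> real \<Rightarrow> bool" where
  "vanishing_carleson \<mu> s \<longleftrightarrow>
     (\<forall>\<epsilon>>0. \<exists>\<delta>>0. \<forall>a L. 0 < L \<and> L < 2 * pi \<and> L < \<delta> \<longrightarrow>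
        box_measure \<mu> a L \<le> ennreal (\<epsilon> * L powr s))"

definition W_cond :: "real measure \<Rightarrow> real \<Rightarrow> real \<Rightarrow> bool" where
  "W_cond \<mu> p \<alpha> \<longleftrightarrow>
     (p \<le> 1 \<longrightarrow> carleson \<mu> ((\<alpha> + 2) / p)) \<and>
     (1 \<le> p \<and> p \<le> 2 \<longrightarrow> carleson \<mu> ((\<alpha> + 2 - (p - 1)\<^sup>2) / p)) \<and>
     (2 \<le> p \<longrightarrow> carleson \<mu> ((\<alpha> + 1) / p))"

definition conj_exp :: "real \<Rightarrow> real" where
  "conj_exp q = q / (q - 1)"

end

theory Submission
  imports Defs "HOL-Complex_Analysis.Complex_Analysis"
begin

text \<open>
  Whenever the coefficient sums converge absolutely, the operator is the integral of
  \<open>f t / (1 - t z) powr (\<alpha> + 2)\<close> against \<open>\<mu>\<close>. Cut \<open>[0,1)\<close> into the intervals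
  \<open>I\<^sub>n = [1 - 2\<^sup>-\<^sup>n, 1 - 2\<^sup>-\<^sup>n\<^sup>-\<^sup>1)\<close> and the disc into the shells
  where \<open>|1 - z|\<close> is about \<open>2\<^sup>-\<^sup>m\<close>. The shell has weighted area of order
  \<open>2 powr (- m (\<alpha> + 2))\<close> and there \<open>|1 - t z|\<close> is of order \<open>2 powr (- min n m)\<close>. By the
  submean value property the suprema of \<open>|f|\<close> over the \<open>I\<^sub>n\<close>, suitably scaled, form an
  \<open>l\<^sup>p\<close> sequence, hence an \<open>l\<^sup>q\<close> sequence. For \<open>q > 1\<close> the operator then becomes
  a discrete convolution with an exponentially decaying kernel, bounded on \<open>l\<^sup>q\<close>; for \<open>q = 1\<close> the
  kernel does not decay on one side and its sum produces the factor \<open>n\<close>, that is, the logarithm. The weights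
  \<open>\<mu> I\<^sub>n\<close> enter as multipliers tending to \<open>0\<close>, which together with Montel's theorem gives
  compactness.

  For necessity, test functions \<open>(1 - a z) powr (- c)\<close>, \<open>a = 1 - 2\<^sup>-\<^sup>n\<close>, normalised in the
  source space, have images that are large at the real points \<open>1 - 2\<^sup>-\<^sup>m\<close>, \<open>m \<le> n\<close>. Any
  limit \<open>g\<close> of a subsequence of images has little mass on small discs around these points, so no identification of
  \<open>g\<close> is needed.
\<close>

section \<open>Area integrals and rotations\<close>

text \<open>Exponents p < 1 are allowed, so the source space is in general only quasi-normed and
  duality is not at hand. The proof rests instead on a local inequality: |f(z)|^p
  (1-|z|)^(\<alpha>+2) is at most a constant times the weighted integral of |f|^p over the disc
  about z of radius (1-|z|)/4. Keeping this local integral instead of the whole norm permits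
  summation over many discs, in both directions of the proof.

  A second obstacle is that the operator is given by coefficient sums. Its integral form needs the
  sum of |a_k| t^k to be \<mu>-integrable. For sufficiency this follows from the decay of the masses
  of the intervals, with each coefficient estimated by the mean of |f| over an annulus. For
  necessity it holds because the test functions are holomorphic across the unit circle and \<mu> is
  finite, which the condition W supplies.

  Circle means and area integrals are connected without polar coordinates, by integrating over all
  rotations. This needs rotation invariance of the area measure, which is why shears come at the
  start.\<close>

lemma lborel_complex:
  "lborel = distr (lborel \<Otimes>\<^sub>M lborel) borel (\<lambda>(x, y). Complex x y)"
proof (rule lborel_eqI)
  have m: "(\<lambda>(x, y). Complex x y) \<in> borel_measurable (lborel \<Otimes>\<^sub>M lborel)"
    unfolding lborel_prod Complex_eq case_prod_unfold
    by (simp, intro borel_measurable_continuous_onI continuous_intros)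
  fix l u :: complex
  assume "\<And>b. b \<in> Basis \<Longrightarrow> l \<bullet> b \<le> u \<bullet> b"
  then have le: "Re l \<le> Re u" "Im l \<le> Im u"
    by (metis complex_inner_1_right complex_inner_i_right insertCI Basis_complex_def)+
  have "(\<lambda>(x, y). Complex x y) -` box l u \<inter> space (lborel \<Otimes>\<^sub>M lborel)
      = {Re l<..<Re u} \<times> {Im l<..<Im u}"
    by (auto simp: box_def Basis_complex_def space_pair_measure)
  then show "emeasure (distr (lborel \<Otimes>\<^sub>M lborel) borel (\<lambda>(x, y). Complex x y)) (box l u)
      = (\<Prod>b\<in>Basis. (u - l) \<bullet> b)"
    using le m by (simp add: emeasure_distr lborel.emeasure_pair_measure_Times
        Basis_complex_def ennreal_mult' )
qed simp

lemma nn_integral_complex: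
  assumes [measurable]: "f \<in> borel_measurable borel"
  shows "(\<integral>\<^sup>+z. f z \<partial>lborel) = (\<integral>\<^sup>+y. \<integral>\<^sup>+x. f (Complex x y) \<partial>lborel \<partial>lborel)"
    and "(\<integral>\<^sup>+z. f z \<partial>lborel) = (\<integral>\<^sup>+x. \<integral>\<^sup>+y. f (Complex x y) \<partial>lborel \<partial>lborel)"
proof -
  have m[measurable]: "(\<lambda>(x, y). Complex x y) \<in> borel_measurable (lborel \<Otimes>\<^sub>M lborel)"
    unfolding lborel_prod Complex_eq case_prod_unfold
    by (simp, intro borel_measurable_continuous_onI continuous_intros)
  have mf: "(\<lambda>(x, y). f (Complex x y)) \<in> borel_measurable (lborel \<Otimes>\<^sub>M lborel)"
    using measurable_compose[OF m assms] by (simp add: case_prod_unfold)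
  have "(\<integral>\<^sup>+z. f z \<partial>lborel) = (\<integral>\<^sup>+w. (case w of (x, y) \<Rightarrow> f (Complex x y)) \<partial>(lborel \<Otimes>\<^sub>M lborel))"
    by (subst lborel_complex) (simp add: nn_integral_distr m case_prod_unfold)
  then show 2: "(\<integral>\<^sup>+z. f z \<partial>lborel) = (\<integral>\<^sup>+x. \<integral>\<^sup>+y. f (Complex x y) \<partial>lborel \<partial>lborel)"
    using lborel.nn_integral_fst[OF mf] by simp
  show "(\<integral>\<^sup>+z. f z \<partial>lborel) = (\<integral>\<^sup>+y. \<integral>\<^sup>+x. f (Complex x y) \<partial>lborel \<partial>lborel)"
    using lborel_pair.Fubini'[OF mf] 2 by simp
qed

lemma nn_integral_translate:
  fixes f :: "real \<Rightarrow> ennreal"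
  assumes "f \<in> borel_measurable borel"
  shows "(\<integral>\<^sup>+x. f (x + t) \<partial>lborel) = (\<integral>\<^sup>+x. f x \<partial>lborel)"
  using nn_integral_real_affine[OF assms, of 1 t] by (simp add: add.commute)

text \<open>A shear translates each horizontal (or vertical) line by an amount that is constant on
  that line. Iterated integration therefore reduces the claim to translation invariance on the real
  line.\<close>

lemma nn_integral_shear:
  fixes f :: "complex \<Rightarrow> ennreal"
  assumes [measurable]: "f \<in> borel_measurable borel"
  shows "(\<integral>\<^sup>+z. f (Complex (Re z + a * Im z) (Im z)) \<partial>lborel) = (\<integral>\<^sup>+z. f z \<partial>lborel)"
    and "(\<integral>\<^sup>+z. f (Complex (Re z) (Im z + a * Re z)) \<partial>lborel) = (\<integral>\<^sup>+z. f z \<partial>lborel)"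
proof -
  have [measurable]: "(\<lambda>z. Complex (Re z + a * Im z) (Im z)) \<in> borel_measurable borel"
    "(\<lambda>z. Complex (Re z) (Im z + a * Re z)) \<in> borel_measurable borel"
    "(\<lambda>x. Complex x y) \<in> borel_measurable borel"
    "(\<lambda>x. Complex y x) \<in> borel_measurable borel" for y
    by (simp_all add: Complex_eq)
  have "(\<integral>\<^sup>+x. f (Complex (x + a * y) y) \<partial>lborel) = (\<integral>\<^sup>+x. f (Complex x y) \<partial>lborel)" for y
    using nn_integral_translate[of "\<lambda>x. f (Complex x y)" "a * y"] by simp
  then show "(\<integral>\<^sup>+z. f (Complex (Re z + a * Im z) (Im z)) \<partial>lborel) = (\<integral>\<^sup>+z. f z \<partial>lborel)"
    by (simp add: nn_integral_complex(1))
  have "(\<integral>\<^sup>+x. f (Complex y (x + a * y)) \<partial>lborel) = (\<integral>\<^sup>+x. f (Complex y x) \<partial>lborel)" for y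
    using nn_integral_translate[of "\<lambda>x. f (Complex y x)" "a * y"] by simp
  then show "(\<integral>\<^sup>+z. f (Complex (Re z) (Im z + a * Re z)) \<partial>lborel) = (\<integral>\<^sup>+z. f z \<partial>lborel)"
    by (simp add: nn_integral_complex(2))
qed

text \<open>A rotation by an angle other than a multiple of \<open>\<pi>\<close> is a product of three shears.\<close>
lemma nn_integral_rotate:
  fixes f :: "complex \<Rightarrow> ennreal"
  assumes f[measurable]: "f \<in> borel_measurable borel" and c: "norm c = 1"
  shows "(\<integral>\<^sup>+z. f (c * z) \<partial>lborel) = (\<integral>\<^sup>+z. f z \<partial>lborel)"
proof -
  have *: "(\<integral>\<^sup>+z. f (c * z) \<partial>lborel) = (\<integral>\<^sup>+z. f z \<partial>lborel)"
    if c: "norm c = 1" and s: "Im c \<noteq> 0" and f[measurable]: "f \<in> borel_measurable borel"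
    for c and f :: "complex \<Rightarrow> ennreal"
  proof -
    \<comment> \<open>For c = cis \<theta> this is -tan(\<theta>/2), the outer parameter in the
      factorisation of a rotation into shears; the middle parameter is sin \<theta> =
      \<open>Im c\<close>.\<close>
    define e where "e = (Re c - 1) / Im c"
    have e: "e * Im c = Re c - 1"
      using s by (simp add: e_def)
    have cc: "Re c * Re c + Im c * Im c = 1"
      using c by (simp add: cmod_def power2_eq_square)
    have "Im c * (e * (1 + Re c)) = (Re c - 1) * (1 + Re c)"
      using e by (simp add: mult.commute mult.left_commute)
    also have "\<dots> = Im c * (- Im c)"
      using cc by (simp add: algebra_simps)
    finally have e2: "e * (1 + Re c) = - Im c"
      using s by (metis mult_left_cancel)
    define A where "A = (\<lambda>z. Complex (Re z + e * Im z) (Im z))"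
    define B where "B = (\<lambda>z. Complex (Re z) (Im z + Im c * Re z))"
    have [measurable]: "A \<in> borel_measurable borel" "B \<in> borel_measurable borel"
      unfolding A_def B_def by (simp_all add: Complex_eq)
    have eq: "c * z = A (B (A z))" for z
    proof -
      have 1: "Im z + Im c * (Re z + e * Im z) = Re c * Im z + Im c * Re z"
        using e by (auto simp: algebra_simps) (metis distrib_right e diff_add_cancel mult.assoc mult.commute mult_1)
      have "Re z + e * Im z + e * (Re c * Im z + Im c * Re z) = Re z + (e * (1 + Re c)) * Im z + (e * Im c) * Re z"
        by (simp add: algebra_simps)
      also have "\<dots> = Re c * Re z - Im c * Im z"
        unfolding e e2 by (simp add: algebra_simps)
      finally show ?thesis
        using 1 by (simp add: A_def B_def complex_eq_iff)
    qed
    have sA: "(\<integral>\<^sup>+z. g (A z) \<partial>lborel) = (\<integral>\<^sup>+z. g z \<partial>lborel)"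
      and sB: "(\<integral>\<^sup>+z. g (B z) \<partial>lborel) = (\<integral>\<^sup>+z. g z \<partial>lborel)"
      if "g \<in> borel_measurable borel" for g :: "complex \<Rightarrow> ennreal"
      unfolding A_def B_def using that by (simp_all add: nn_integral_shear)
    have "(\<integral>\<^sup>+z. f (c * z) \<partial>lborel) = (\<integral>\<^sup>+z. f (A (B (A z))) \<partial>lborel)"
      by (simp add: eq)
    also have "\<dots> = (\<integral>\<^sup>+z. f (A (B z)) \<partial>lborel)"
      by (rule sA) simp
    also have "\<dots> = (\<integral>\<^sup>+z. f (A z) \<partial>lborel)"
      by (rule sB) simp
    also have "\<dots> = (\<integral>\<^sup>+z. f z \<partial>lborel)"
      by (rule sA) simp
    finally show ?thesis .
  qed
  show ?thesis
  proof (cases "Im c = 0")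
    case False
    then show ?thesis using *[OF c] f by simp
  next
    case True
    then have "Re c \<noteq> 0" using c by (auto simp: cmod_def)
    then have "(\<integral>\<^sup>+z. f (\<i> * ((- \<i> * c) * z)) \<partial>lborel) = (\<integral>\<^sup>+z. f (\<i> * z) \<partial>lborel)"
      using c by (intro *[of "- \<i> * c" "\<lambda>z. f (\<i> * z)"]) (auto simp: norm_mult)
    also have "\<dots> = (\<integral>\<^sup>+z. f z \<partial>lborel)"
      by (intro *) auto
    finally show ?thesis by (simp add: mult.assoc[symmetric])
  qed
qed

text \<open>After interchanging the integrals, the inner one is rotation invariant for each fixed t.
  This takes the place of polar coordinates: an estimate of a function by its means over circles
  turns into an estimate of area integrals.\<close>

lemma nn_integral_angular_mean:
  fixes g :: "complex \<Rightarrow> ennreal"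
  assumes g[measurable]: "g \<in> borel_measurable borel"
  shows "(\<integral>\<^sup>+z. (\<integral>\<^sup>+t\<in>{0..1}. g (cis (2 * pi * t) * z) \<partial>lborel) \<partial>lborel) = (\<integral>\<^sup>+z. g z \<partial>lborel)"
proof -
  have m1: "(\<lambda>(t, z). cis (2 * pi * t) * z) \<in> borel_measurable (borel :: (real \<times> complex) measure)"
    by (intro borel_measurable_continuous_onI) (auto intro!: continuous_intros simp: case_prod_unfold)
  have m[measurable]: "(\<lambda>(t, z). cis (2 * pi * t) * z) \<in> borel_measurable (lborel \<Otimes>\<^sub>M lborel)"
    unfolding lborel_prod using m1 by simp
  have mg: "(\<lambda>(t, z). g (cis (2 * pi * t) * z)) \<in> borel_measurable (lborel \<Otimes>\<^sub>M lborel)"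
    using measurable_compose[OF m g] by (simp add: case_prod_unfold)
  have mi: "(\<lambda>w. indicator {0..1} (fst w) :: ennreal) \<in> borel_measurable ((lborel :: real measure) \<Otimes>\<^sub>M (lborel :: complex measure))"
    by measurable
  have mf: "(\<lambda>(t, z). g (cis (2 * pi * t) * z) * indicator {0..1} t) \<in> borel_measurable (lborel \<Otimes>\<^sub>M lborel)"
    using borel_measurable_times_ennreal[OF mg mi] by (simp add: case_prod_unfold)
  have "(\<integral>\<^sup>+z. (\<integral>\<^sup>+t\<in>{0..1}. g (cis (2 * pi * t) * z) \<partial>lborel) \<partial>lborel)
      = (\<integral>\<^sup>+t. (\<integral>\<^sup>+z. g (cis (2 * pi * t) * z) * indicator {0..1} t \<partial>lborel) \<partial>lborel)"
    using lborel_pair.Fubini'[OF mf] by simp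
  also have "\<dots> = (\<integral>\<^sup>+t. (\<integral>\<^sup>+z. g z \<partial>lborel) * indicator {0..1} (t::real) \<partial>lborel)"
    by (simp add: nn_integral_multc nn_integral_rotate)
  also have "\<dots> = (\<integral>\<^sup>+z. g z \<partial>lborel)"
    by (simp add: nn_integral_cmult_indicator)
  finally show ?thesis .
qed

text \<open>This is Cauchy's estimate on the circle through z, with the mean of |f| in place of its
  maximum, so that it can be integrated in z afterwards.\<close>

lemma taylor_coeff_circle_bound:
  assumes hol: "f holomorphic_on ball 0 R" and z: "norm z < R"
  shows "ennreal (norm (taylor_coeff f k) * norm z ^ k)
       \<le> (\<integral>\<^sup>+t\<in>{0..1}. ennreal (norm (f (cis (2 * pi * t) * z))) \<partial>lborel)"
proof -
  have cont: "continuous_on {0..1} (\<lambda>t. norm (f (cis (2 * pi * t) * z)))"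
    by (intro continuous_on_norm continuous_on_compose2[OF holomorphic_on_imp_continuous_on[OF hol]]
        continuous_intros) (use z in \<open>auto simp: norm_mult\<close>)
  have si: "set_integrable lborel {0..1} (\<lambda>t. norm (f (cis (2 * pi * t) * z)))"
    by (rule borel_integrable_atLeastAtMost'[OF cont])
  have nn: "(\<integral>\<^sup>+t\<in>{0..1}. ennreal (norm (f (cis (2 * pi * t) * z))) \<partial>lborel)
      = ennreal (integral {0..1} (\<lambda>t. norm (f (cis (2 * pi * t) * z))))"
  proof -
    have "(\<integral>\<^sup>+t\<in>{0..1}. ennreal (norm (f (cis (2 * pi * t) * z))) \<partial>lborel)
        = (\<integral>\<^sup>+t. ennreal (indicator {0..1} t *\<^sub>R norm (f (cis (2 * pi * t) * z))) \<partial>lborel)"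
      by (intro nn_integral_cong) (auto simp: indicator_def)
    also have "\<dots> = ennreal (LINT t:{0..1}|lborel. norm (f (cis (2 * pi * t) * z)))"
      unfolding set_lebesgue_integral_def
      by (rule nn_integral_eq_integral) (use si in \<open>auto simp: set_integrable_def\<close>)
    finally show ?thesis
      by (simp add: set_borel_integral_eq_integral[OF si])
  qed
  have main: "norm (taylor_coeff f k) * norm z ^ k \<le> integral {0..1} (\<lambda>t. norm (f (cis (2 * pi * t) * z)))"
  proof (cases "z = 0")
    case True
    then show ?thesis by (cases "k = 0") (auto simp: taylor_coeff_def power_0_left)
  next
    case False
    define r where "r = norm z"
    define u where "u = z / of_real r"
    have r: "r > 0" "r < R" using False z by (auto simp: r_def)
    have u: "norm u = 1" "z = u * of_real r" using r by (auto simp: u_def r_def norm_divide)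
    \<comment> \<open>The rotation makes the standard parametrisation of the circle start at z; it
      multiplies the k-th Taylor coefficient only by the unimodular factor u^k.\<close>
    define F where "F = (\<lambda>w. f (u * w))"
    have holF: "F holomorphic_on ball 0 R"
      unfolding F_def by (intro holomorphic_on_compose_gen[OF _ hol, unfolded o_def] holomorphic_intros)
        (auto simp: norm_mult u)
    have dF: "(deriv ^^ k) F 0 = u ^ k * (deriv ^^ k) f 0"
      unfolding F_def using r u
      by (subst higher_deriv_compose_linear[OF hol, of "ball 0 R"]) (auto simp: norm_mult)
    have "contour_integral (circlepath 0 r) (\<lambda>w. F w / (w - 0) ^ Suc k)
        = (2 * pi * \<i>) * (deriv ^^ k) F 0 / fact k"
      using r by (intro Cauchy_contour_integral_circlepath)
        (auto intro!: holomorphic_on_imp_continuous_on holomorphic_on_subset[OF holF])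
    also have "contour_integral (circlepath 0 r) (\<lambda>w. F w / (w - 0) ^ Suc k)
       = integral {0..1} (\<lambda>t. F (circlepath 0 r t) / circlepath 0 r t ^ Suc k * vector_derivative (circlepath 0 r) (at t))"
      by (simp add: contour_integral_integral)
    finally have eq: "norm (integral {0..1} (\<lambda>t. F (circlepath 0 r t) / circlepath 0 r t ^ Suc k * vector_derivative (circlepath 0 r) (at t)))
        = 2 * pi * norm (taylor_coeff f k)"
      using dF u by (simp add: taylor_coeff_def norm_mult norm_divide norm_power)
    have cp: "circlepath 0 r t = of_real r * cis (2 * pi * t)" for t
      by (simp add: circlepath cis_conv_exp mult.commute mult.left_commute)
    have "norm (integral {0..1} (\<lambda>t. F (circlepath 0 r t) / circlepath 0 r t ^ Suc k * vector_derivative (circlepath 0 r) (at t)))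
       \<le> integral {0..1} (\<lambda>t. 2 * pi / r ^ k * norm (f (cis (2 * pi * t) * z)))"
    proof (rule integral_norm_bound_integral)
      have "continuous_on {0..1} (\<lambda>t. F (of_real r * cis (2 * pi * t)))"
        by (intro continuous_on_compose2[OF holomorphic_on_imp_continuous_on[OF holF]] continuous_intros)
          (use r in \<open>auto simp: norm_mult\<close>)
      then show "(\<lambda>t. F (circlepath 0 r t) / circlepath 0 r t ^ Suc k * vector_derivative (circlepath 0 r) (at t)) integrable_on {0..1}"
        using r unfolding vector_derivative_circlepath cp
        by (intro integrable_continuous_interval continuous_intros) auto
      show "(\<lambda>t. 2 * pi / r ^ k * norm (f (cis (2 * pi * t) * z))) integrable_on {0..1}"
        by (intro integrable_continuous_interval continuous_intros cont)
      show "norm (F (circlepath 0 r t) / circlepath 0 r t ^ Suc k * vector_derivative (circlepath 0 r) (at t))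
        \<le> 2 * pi / r ^ k * norm (f (cis (2 * pi * t) * z))" for t
        using r unfolding cp vector_derivative_circlepath
        by (simp add: norm_mult norm_divide norm_power F_def u(2) mult_ac del: of_real_mult)
    qed
    also have "\<dots> = 2 * pi / r ^ k * integral {0..1} (\<lambda>t. norm (f (cis (2 * pi * t) * z)))"
      by simp
    finally show ?thesis using eq r by (simp add: r_def field_simps)
  qed
  show ?thesis unfolding nn by (rule ennreal_leI[OF main])
qed

text \<open>Nothing is known about f outside S, so measurability is claimed only after cutting off
  to a Borel subset of S.\<close>

lemma holomorphic_indicator_measurable:
  assumes "f holomorphic_on S" "E \<in> sets borel" "E \<subseteq> S"
    and c: "continuous_on UNIV \<phi>"
  shows "(\<lambda>z. ennreal (\<phi> (f z)) * indicator E z) \<in> borel_measurable borel"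
proof -
  have "(\<lambda>z. indicator E z *\<^sub>R \<phi> (f z)) \<in> borel_measurable borel"
    by (intro borel_measurable_continuous_on_indicator assms
        continuous_on_compose2[OF c holomorphic_on_imp_continuous_on[OF holomorphic_on_subset[OF assms(1,3)]]]) auto
  from measurable_compose[OF this measurable_ennreal] show ?thesis
    by (rule measurable_cong[THEN iffD1, rotated]) (auto simp: indicator_def)
qed

text \<open>Integrate the circle estimate over the rotation invariant set E. For a disc and k = 0
  this gives the mean value inequality; for an annulus it bounds every coefficient by the values of
  f on that annulus alone.\<close>

lemma taylor_coeff_area_bound:
  assumes hol: "f holomorphic_on ball 0 R" and E: "E \<in> sets borel" "E \<subseteq> ball 0 R"
    and rot: "\<And>z c. norm c = 1 \<Longrightarrow> z \<in> E \<Longrightarrow> c * z \<in> E"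
  shows "(\<integral>\<^sup>+z\<in>E. ennreal (norm (taylor_coeff f k) * norm z ^ k) \<partial>lborel)
       \<le> (\<integral>\<^sup>+z\<in>E. ennreal (norm (f z)) \<partial>lborel)"
proof -
  define g where "g = (\<lambda>z. ennreal (norm (f z)) * indicator E z)"
  have g[measurable]: "g \<in> borel_measurable borel"
    unfolding g_def by (rule holomorphic_indicator_measurable[OF hol]) (use E in \<open>auto intro: continuous_intros\<close>)
  have "(\<integral>\<^sup>+z\<in>E. ennreal (norm (taylor_coeff f k) * norm z ^ k) \<partial>lborel)
    \<le> (\<integral>\<^sup>+z. (\<integral>\<^sup>+t\<in>{0..1}. g (cis (2 * pi * t) * z) \<partial>lborel) \<partial>lborel)"
  proof (rule nn_integral_mono, goal_cases)
    case (1 z)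
    show ?case
    proof (cases "z \<in> E")
      case True
      then have "g (cis (2 * pi * t) * z) = ennreal (norm (f (cis (2 * pi * t) * z)))" for t
        using rot[of "cis (2 * pi * t)" z] by (simp add: g_def)
      then show ?thesis
        using taylor_coeff_circle_bound[OF hol, of z k] True E by auto
    qed simp
  qed
  also have "\<dots> = (\<integral>\<^sup>+z. g z \<partial>lborel)"
    by (rule nn_integral_angular_mean[OF g])
  finally show ?thesis by (simp add: g_def)
qed

lemma emeasure_complex_ball: "r \<ge> 0 \<Longrightarrow> emeasure lborel (ball (a::complex) r) = ennreal (pi * r\<^sup>2)"
  by (simp add: emeasure_ball unit_ball_vol_2)

text \<open>Translate the centre to 0 and use the area bound for the coefficient of order 0, which
  is the value at the centre.\<close>

lemma area_mean_value:
  assumes hol: "f holomorphic_on ball a r" and r: "r > 0"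
  shows "ennreal (norm (f a) * (pi * r\<^sup>2)) \<le> (\<integral>\<^sup>+z\<in>ball a r. ennreal (norm (f z)) \<partial>lborel)"
proof -
  define F where "F = (\<lambda>z. f (a + z))"
  have holF: "F holomorphic_on ball 0 r"
    unfolding F_def by (intro holomorphic_on_compose_gen[OF _ hol, unfolded o_def] holomorphic_intros)
      (auto simp: dist_norm)
  have "ennreal (norm (f a) * (pi * r\<^sup>2)) = (\<integral>\<^sup>+z\<in>ball (0::complex) r. ennreal (norm (taylor_coeff F 0) * norm z ^ 0) \<partial>lborel)"
    using r by (simp add: taylor_coeff_def F_def nn_integral_cmult_indicator ennreal_mult')
      (subst emeasure_complex_ball, auto simp: ennreal_mult')
  also have "\<dots> \<le> (\<integral>\<^sup>+z\<in>ball 0 r. ennreal (norm (F z)) \<partial>lborel)"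
    by (rule taylor_coeff_area_bound[OF holF]) (auto simp: norm_mult)
  also have "\<dots> = (\<integral>\<^sup>+z. ennreal (norm (f (a + z))) * indicator (ball a r) (a + z) \<partial>lborel)"
    by (intro nn_integral_cong) (auto simp: F_def indicator_def dist_norm)
  also have "\<dots> = (\<integral>\<^sup>+z\<in>ball a r. ennreal (norm (f z)) \<partial>(distr lborel borel ((+) a)))"
    using holomorphic_indicator_measurable[OF hol, of "ball a r" norm]
    by (subst nn_integral_distr) (auto intro: continuous_on_norm_id)
  finally show ?thesis by (simp add: lborel_distr_plus)
qed

section \<open>Submean value property and the weight near 1\<close>

lemma nn_integral_powr_left:
  fixes X r \<alpha> :: real
  assumes "\<alpha> > -1" "r \<ge> 0"
  shows "(\<integral>\<^sup>+x\<in>{X - r..X}. ennreal ((X - x) powr \<alpha>) \<partial>lborel) = ennreal (r powr (\<alpha> + 1) / (\<alpha> + 1))"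
proof -
  have "(\<integral>\<^sup>+x\<in>{X - r..X}. ennreal ((X - x) powr \<alpha>) \<partial>lborel)
     = (\<integral>\<^sup>+x. ennreal ((X - (X + (-1) * x)) powr \<alpha>) * indicator {X - r..X} (X + (-1) * x) \<partial>lborel)"
    using nn_integral_real_affine[of "\<lambda>x. ennreal ((X - x) powr \<alpha>) * indicator {X - r..X} x" "-1" X]
    by simp
  also have "\<dots> = (\<integral>\<^sup>+x. ennreal (indicator {0..r} x * x powr \<alpha>) \<partial>lborel)"
    by (intro nn_integral_cong) (auto simp: indicator_def)
  also have "\<dots> = ennreal (r powr (\<alpha> + 1) / (\<alpha> + 1))"
    using nn_integral_has_integral_lebesgue[OF _ has_integral_powr_from_0[OF assms]]
    by simp
  finally show ?thesis .
qed

text \<open>The exponent may have either sign, so the power may increase or decrease; hence the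
  minimum and the maximum of the two endpoint constants.\<close>

lemma powr_between:
  fixes x u A B \<alpha> :: real
  assumes "0 < u" "0 < A" "A * u \<le> x" "x \<le> B * u"
  shows "min (A powr \<alpha>) (B powr \<alpha>) * u powr \<alpha> \<le> x powr \<alpha>"
    and "x powr \<alpha> \<le> max (A powr \<alpha>) (B powr \<alpha>) * u powr \<alpha>"
proof -
  have x: "0 < x" using assms by (meson less_le_trans mult_pos_pos)
  then have B: "0 < B" using assms by (smt (verit) mult_nonpos_nonneg)
  have eq: "x powr \<alpha> = (x / u) powr \<alpha> * u powr \<alpha>"
    using x assms by (simp add: powr_divide)
  have A': "A \<le> x / u" "x / u \<le> B" "0 < x / u"
    using assms x by (simp_all add: field_simps)
  have "min (A powr \<alpha>) (B powr \<alpha>) \<le> (x / u) powr \<alpha> \<and> (x / u) powr \<alpha> \<le> max (A powr \<alpha>) (B powr \<alpha>)"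
  proof (cases "\<alpha> \<ge> 0")
    case True
    then show ?thesis
      using powr_mono2[of \<alpha> A "x / u"] powr_mono2[of \<alpha> "x / u" B] A' assms by auto
  next
    case False
    then show ?thesis
      using powr_mono2'[of \<alpha> A "x / u"] powr_mono2'[of \<alpha> "x / u" B] A' assms by auto
  qed
  then show "min (A powr \<alpha>) (B powr \<alpha>) * u powr \<alpha> \<le> x powr \<alpha>"
    "x powr \<alpha> \<le> max (A powr \<alpha>) (B powr \<alpha>) * u powr \<alpha>"
    unfolding eq using assms(1) by (auto intro!: mult_right_mono)
qed

lemma one_minus_norm_sq:
  fixes z :: complex
  assumes "norm z < 1"
  shows "1 - norm z \<le> 1 - (norm z)\<^sup>2" "1 - (norm z)\<^sup>2 \<le> 2 * (1 - norm z)"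
proof -
  have "0 \<le> norm z * (1 - norm z)" "0 \<le> (1 - norm z) * (1 - norm z)"
    using assms by auto
  then show "1 - norm z \<le> 1 - (norm z)\<^sup>2" "1 - (norm z)\<^sup>2 \<le> 2 * (1 - norm z)"
    by (auto simp: algebra_simps power2_eq_square)
qed

abbreviation wt :: "real \<Rightarrow> complex \<Rightarrow> real" where
  "wt \<alpha> z \<equiv> (1 - (norm z)\<^sup>2) powr \<alpha>"

lemma wt_measurable[measurable]: "wt \<alpha> \<in> borel_measurable borel"
  by measurable

lemma strip_borel: "{z::complex. norm z < 1 \<and> a < Re z \<and> \<bar>Im z\<bar> < \<rho>} \<in> sets borel"
proof -
  have "open ({z::complex. norm z < 1} \<inter> {z. a < Re z} \<inter> {z. \<bar>Im z\<bar> < \<rho>})"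
    by (intro open_Int open_Collect_less continuous_intros)
  then show ?thesis by (simp add: Collect_conj_eq Int_assoc)
qed

text \<open>Slice horizontally. At height y the slice of the disc ends at X = sqrt(1-y^2), and
  1-|z|^2 = (X-x)(X+x). The second factor is at least 1/2 because r \<le> 1/2, and since \<alpha> <
  0 its power is at most (1/2)^\<alpha>. What remains is the integral of (X-x)^\<alpha> over a
  segment of length r, which converges because \<alpha> > -1.\<close>

lemma weight_near_1_strip:
  fixes \<alpha> r \<rho> :: real
  assumes \<alpha>: "-1 < \<alpha>" "\<alpha> < 0" and r: "0 < r" "r \<le> 1/2" and \<rho>: "0 < \<rho>"
  defines "Q \<equiv> {z::complex. norm z < 1 \<and> 1 - r < Re z \<and> \<bar>Im z\<bar> < \<rho>}"
  shows "(\<integral>\<^sup>+z\<in>Q. ennreal (wt \<alpha> z) \<partial>lborel)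
       \<le> ennreal (2 * \<rho> * (1/2) powr \<alpha> * (r powr (\<alpha> + 1) / (\<alpha> + 1)))"
proof -
  have [measurable]: "Q \<in> sets borel" unfolding Q_def by (rule strip_borel)
  have "(\<integral>\<^sup>+z\<in>Q. ennreal (wt \<alpha> z) \<partial>lborel)
     = (\<integral>\<^sup>+y. \<integral>\<^sup>+x. ennreal ((1 - (norm (Complex x y))\<^sup>2) powr \<alpha>) * indicator Q (Complex x y) \<partial>lborel \<partial>lborel)"
    by (rule nn_integral_complex(1)) measurable
  also have "\<dots> \<le> (\<integral>\<^sup>+y. ennreal ((1/2) powr \<alpha> * (r powr (\<alpha> + 1) / (\<alpha> + 1))) * indicator {-\<rho><..<\<rho>} y \<partial>lborel)"
  proof (rule nn_integral_mono, goal_cases)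
    case (1 y)
    show ?case
    proof (cases "\<bar>y\<bar> < \<rho> \<and> \<bar>y\<bar> < 1")
      case False
      then have "Complex x y \<notin> Q" for x
        using abs_Im_le_cmod[of "Complex x y"] by (auto simp: Q_def simp del: abs_Im_le_cmod)
      then show ?thesis by simp
    next
      case True
      define X where "X = sqrt (1 - y\<^sup>2)"
      have X: "X\<^sup>2 = 1 - y\<^sup>2" "0 \<le> X" "X \<le> 1"
        using True abs_square_le_1[of y] by (auto simp: X_def)
      have "(\<integral>\<^sup>+x. ennreal ((1 - (norm (Complex x y))\<^sup>2) powr \<alpha>) * indicator Q (Complex x y) \<partial>lborel)
         \<le> (\<integral>\<^sup>+x. ennreal ((1/2) powr \<alpha>) * (ennreal ((X - x) powr \<alpha>) * indicator {X - r..X} x) \<partial>lborel)"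
      proof (rule nn_integral_mono, goal_cases)
        case (1 x)
        show ?case
        proof (cases "Complex x y \<in> Q")
          case True
          then have x: "x\<^sup>2 + y\<^sup>2 < 1" "1 - r < x"
            by (auto simp: Q_def cmod_def)
          then have "x\<^sup>2 < X\<^sup>2" using X by simp
          then have xX: "x < X" using X(2) by (rule power2_less_imp_less)
          have eq: "1 - (norm (Complex x y))\<^sup>2 = (X - x) * (X + x)"
          proof -
            have "(X - x) * (X + x) = X\<^sup>2 - x\<^sup>2" by (simp add: algebra_simps power2_eq_square)
            then show ?thesis using X(1) by (simp add: cmod_power2)
          qed
          have "(1 - (norm (Complex x y))\<^sup>2) powr \<alpha> = (X - x) powr \<alpha> * (X + x) powr \<alpha>"
            unfolding eq using xX x r by (simp add: powr_mult)
          also have "\<dots> \<le> (X - x) powr \<alpha> * (1/2) powr \<alpha>"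
            using xX x r \<alpha> X by (intro mult_left_mono powr_mono2') auto
          finally show ?thesis
            using True x xX X by (auto simp: ennreal_mult'[symmetric] mult.commute intro!: ennreal_leI)
        qed simp
      qed
      also have "\<dots> = ennreal ((1/2) powr \<alpha>) * ennreal (r powr (\<alpha> + 1) / (\<alpha> + 1))"
        using nn_integral_powr_left[of \<alpha> r X] \<alpha> r by (subst nn_integral_cmult) auto
      finally show ?thesis
        using True by (auto simp: ennreal_mult'[symmetric] abs_less_iff indicator_def)
    qed
  qed
  also have "\<dots> = ennreal ((1/2) powr \<alpha> * (r powr (\<alpha> + 1) / (\<alpha> + 1))) * ennreal (2 * \<rho>)"
    using \<rho> by (simp add: nn_integral_cmult_indicator)
  also have "\<dots> = ennreal (2 * \<rho> * (1/2) powr \<alpha> * (r powr (\<alpha> + 1) / (\<alpha> + 1)))"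
    using \<rho> by (simp add: ennreal_mult'[symmetric] mult_ac)
  finally show ?thesis .
qed

text \<open>Away from the disc of radius 9/10 one of the four rotations by multiples of \<open>\<pi>/2\<close> moves a point
  into the strip \<open>Re z > 1/2\<close>.\<close>
lemma weight_total_finite:
  assumes \<alpha>: "-1 < \<alpha>"
  shows "(\<integral>\<^sup>+z\<in>ball (0::complex) 1. ennreal (wt \<alpha> z) \<partial>lborel) < \<infinity>"
proof (cases "\<alpha> < 0")
  case False
  have "(\<integral>\<^sup>+z\<in>ball (0::complex) 1. ennreal (wt \<alpha> z) \<partial>lborel)
     \<le> (\<integral>\<^sup>+z. 1 * indicator (ball (0::complex) 1) z \<partial>lborel)"
  proof (rule nn_integral_mono, goal_cases)
    case (1 z)
    have "wt \<alpha> z \<le> 1 powr \<alpha>" if "norm z < 1"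
      using that False by (intro powr_mono2) (auto simp: abs_square_le_1)
    then show ?case by (auto simp: indicator_def)
  qed
  also have "\<dots> < \<infinity>"
    by (subst nn_integral_cmult_indicator) (auto simp: emeasure_complex_ball)
  finally show ?thesis .
next
  case True
  define Q where "Q = {z::complex. norm z < 1 \<and> 1 - 1/2 < Re z \<and> \<bar>Im z\<bar> < 1}"
  define w where "w = (\<lambda>z. ennreal (wt \<alpha> z) * indicator Q z)"
  have [measurable]: "Q \<in> sets borel" unfolding Q_def by (rule strip_borel)
  have [measurable]: "w \<in> borel_measurable borel" unfolding w_def by measurable
  have fin: "(\<integral>\<^sup>+z. w z \<partial>lborel) < \<infinity>"
    unfolding w_def Q_def
    by (rule le_less_trans[OF weight_near_1_strip[of \<alpha> "1/2" 1]]) (use \<alpha> True in auto)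
  \<comment> \<open>For \<alpha> < 0 the weight grows with |z|, so its value on the circle of radius
    9/10 bounds it on the whole inner disc.\<close>
  define B where "B = (1 - (9/10)\<^sup>2) powr \<alpha>"
  have "(\<integral>\<^sup>+z\<in>ball (0::complex) 1. ennreal (wt \<alpha> z) \<partial>lborel)
     \<le> (\<integral>\<^sup>+z. ennreal B * indicator (ball (0::complex) 1) z + w (1 * z) + w (\<i> * z) + w ((-1) * z) + w ((-\<i>) * z) \<partial>lborel)"
  proof (rule nn_integral_mono, goal_cases)
    case (1 z)
    show ?case
    proof (cases "norm z < 1")
      case nz: True
      show ?thesis
      proof (cases "norm z \<le> 9/10")
        case le: True
        have "(norm z)\<^sup>2 \<le> (9/10)\<^sup>2" using le by (intro power_mono) auto
        then have "wt \<alpha> z \<le> B"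
          unfolding B_def using True by (intro powr_mono2') (auto simp: power2_eq_square)
        then show ?thesis using nz
          by (auto intro!: ennreal_leI add_increasing2)
      next
        case False
        then have "(9/10)\<^sup>2 < (norm z)\<^sup>2" by (intro power_strict_mono) auto
        then have "(9/10)\<^sup>2 < (Re z)\<^sup>2 + (Im z)\<^sup>2" by (simp add: cmod_power2)
        \<comment> \<open>The radius 9/10 works because 0.81 exceeds 1/4 + 1/4, so at least one
          coordinate is larger than 1/2 in modulus.\<close>
        then have "(1/2)\<^sup>2 < (Re z)\<^sup>2 \<or> (1/2)\<^sup>2 < (Im z)\<^sup>2" by (auto simp: power2_eq_square)
        then have "1/2 < \<bar>Re z\<bar> \<or> 1/2 < \<bar>Im z\<bar>"
          by (metis abs_ge_zero power2_abs power2_less_imp_less)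
        moreover have "\<bar>Re z\<bar> < 1" "\<bar>Im z\<bar> < 1"
          using nz abs_Re_le_cmod[of z] abs_Im_le_cmod[of z] by linarith+
        ultimately have "1 * z \<in> Q \<or> \<i> * z \<in> Q \<or> (-1) * z \<in> Q \<or> (-\<i>) * z \<in> Q"
          using nz by (auto simp: Q_def norm_mult abs_if split: if_splits)
        then have "ennreal (wt \<alpha> z) \<in> {w (1 * z), w (\<i> * z), w ((-1) * z), w ((-\<i>) * z)}"
          by (auto simp: w_def norm_mult)
        then show ?thesis using nz by (auto intro: add_increasing add_increasing2)
      qed
    qed simp
  qed
  also have "\<dots> = (\<integral>\<^sup>+z. ennreal B * indicator (ball (0::complex) 1) z \<partial>lborel)
      + (\<integral>\<^sup>+z. w (1 * z) \<partial>lborel) + (\<integral>\<^sup>+z. w (\<i> * z) \<partial>lborel) + (\<integral>\<^sup>+z. w ((-1) * z) \<partial>lborel) + (\<integral>\<^sup>+z. w ((-\<i>) * z) \<partial>lborel)"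
  proof -
    have m: "(\<lambda>z. w (c * z)) \<in> borel_measurable lborel" for c by simp
    have b: "(\<lambda>z. ennreal B * indicator (ball (0::complex) 1) z) \<in> borel_measurable lborel"
      by (intro borel_measurable_times_ennreal borel_measurable_indicator) simp_all
    show ?thesis
      by (subst nn_integral_add, intro borel_measurable_add m b, rule m)+ (rule refl)
  qed
  also have "\<dots> = ennreal B * ennreal (pi * 1\<^sup>2) + (\<integral>\<^sup>+z. w z \<partial>lborel) + (\<integral>\<^sup>+z. w z \<partial>lborel)
      + (\<integral>\<^sup>+z. w z \<partial>lborel) + (\<integral>\<^sup>+z. w z \<partial>lborel)"
    by (simp only: nn_integral_rotate[of w] norm_minus_cancel norm_one norm_ii \<open>w \<in> borel_measurable borel\<close>)
      (subst nn_integral_cmult_indicator, auto simp: emeasure_complex_ball)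
  also have "\<dots> < \<infinity>" using fin by (simp add: ennreal_mult_less_top)
  finally show ?thesis .
qed

text \<open>The exponent \<alpha> + 2 is that of the area r^2 times a weight of order r^\<alpha>.
  For \<alpha> \<ge> 0 the weight is indeed at most (2r)^\<alpha> on the disc of radius r about 1.
  For \<alpha> < 0 it is unbounded there, and only its integral over a strip containing that disc
  has the right order.\<close>

lemma weight_near_1:
  assumes \<alpha>: "-1 < \<alpha>"
  obtains C where "C > 0" "\<And>r. 0 < r \<Longrightarrow> r \<le> 2 \<Longrightarrow>
     (\<integral>\<^sup>+z\<in>ball 0 1 \<inter> ball (1::complex) r. ennreal (wt \<alpha> z) \<partial>lborel) \<le> ennreal (C * r powr (\<alpha> + 2))"
proof (cases "\<alpha> < 0")
  case False
  show ?thesis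
  proof (rule that)
    show "2 powr \<alpha> * pi > 0" by simp
    fix r :: real assume r: "0 < r" "r \<le> 2"
    have "(\<integral>\<^sup>+z\<in>ball 0 1 \<inter> ball (1::complex) r. ennreal (wt \<alpha> z) \<partial>lborel)
       \<le> (\<integral>\<^sup>+z. ennreal ((2 * r) powr \<alpha>) * indicator (ball (1::complex) r) z \<partial>lborel)"
    proof (rule nn_integral_mono, goal_cases)
      case (1 z)
      have "wt \<alpha> z \<le> (2 * r) powr \<alpha>" if "norm z < 1" "dist 1 z < r"
      proof (rule powr_mono2)
        have "1 - norm z \<le> dist 1 z" using norm_triangle_ineq2[of 1 z] by (simp add: dist_norm)
        then show "1 - (norm z)\<^sup>2 \<le> 2 * r"
          using one_minus_norm_sq(2)[OF that(1)] that(2) by argo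
      qed (use False that in \<open>auto simp: abs_square_le_1\<close>)
      then show ?case by (auto simp: indicator_def intro!: ennreal_leI)
    qed
    also have "\<dots> = ennreal ((2 * r) powr \<alpha>) * ennreal (pi * r\<^sup>2)"
      using r by (subst nn_integral_cmult_indicator) (auto simp: emeasure_complex_ball)
    also have "\<dots> = ennreal (2 powr \<alpha> * pi * r powr (\<alpha> + 2))"
      using r by (simp add: ennreal_mult'[symmetric] powr_mult powr_add mult_ac)
    finally show "(\<integral>\<^sup>+z\<in>ball 0 1 \<inter> ball (1::complex) r. ennreal (wt \<alpha> z) \<partial>lborel)
       \<le> ennreal (2 powr \<alpha> * pi * r powr (\<alpha> + 2))" .
  qed
next
  case True
  define T where "T = enn2real (\<integral>\<^sup>+z\<in>ball (0::complex) 1. ennreal (wt \<alpha> z) \<partial>lborel)"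
  have T: "(\<integral>\<^sup>+z\<in>ball (0::complex) 1. ennreal (wt \<alpha> z) \<partial>lborel) = ennreal T" "T \<ge> 0"
    using weight_total_finite[OF \<alpha>] by (auto simp: T_def)
  define A where "A = 2 * (1/2) powr \<alpha> / (\<alpha> + 1)"
  have A: "A > 0" using \<alpha> by (simp add: A_def)
  \<comment> \<open>The summand A serves radii up to 1/2. For larger radii (2r)^(\<alpha>+2) is at
    least 1, so the total mass T is absorbed by the second summand.\<close>
  define C where "C = A + T * 2 powr (\<alpha> + 2)"
  show ?thesis
  proof (rule that)
    show "C > 0" using A T by (simp add: C_def add_pos_nonneg)
    fix r :: real assume r: "0 < r" "r \<le> 2"
    show "(\<integral>\<^sup>+z\<in>ball 0 1 \<inter> ball (1::complex) r. ennreal (wt \<alpha> z) \<partial>lborel) \<le> ennreal (C * r powr (\<alpha> + 2))"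
    proof (cases "r \<le> 1/2")
      case le: True
      have "(\<integral>\<^sup>+z\<in>ball 0 1 \<inter> ball (1::complex) r. ennreal (wt \<alpha> z) \<partial>lborel)
       \<le> (\<integral>\<^sup>+z\<in>{z::complex. norm z < 1 \<and> 1 - r < Re z \<and> \<bar>Im z\<bar> < r}. ennreal (wt \<alpha> z) \<partial>lborel)"
      proof (rule nn_integral_mono, goal_cases)
        case (1 z)
        have "1 - r < Re z \<and> \<bar>Im z\<bar> < r" if "dist 1 z < r"
          using that abs_Re_le_cmod[of "1 - z"] abs_Im_le_cmod[of "1 - z"] by (auto simp: dist_norm)
        then show ?case by (auto simp: indicator_def)
      qed
      also have "\<dots> \<le> ennreal (2 * r * (1/2) powr \<alpha> * (r powr (\<alpha> + 1) / (\<alpha> + 1)))"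
        by (rule weight_near_1_strip) (use r le \<alpha> True in auto)
      also have "2 * r * (1/2) powr \<alpha> * (r powr (\<alpha> + 1) / (\<alpha> + 1)) = A * (r powr (\<alpha> + 1) * r powr 1)"
        using r by (simp add: A_def)
      also have "r powr (\<alpha> + 1) * r powr 1 = r powr (\<alpha> + 2)"
        by (subst powr_add[symmetric]) (simp add: add.assoc)
      also have "A * r powr (\<alpha> + 2) \<le> C * r powr (\<alpha> + 2)"
        using T by (intro mult_right_mono) (auto simp: C_def)
      finally show ?thesis by (simp add: ennreal_leI)
    next
      case False
      have "(\<integral>\<^sup>+z\<in>ball 0 1 \<inter> ball (1::complex) r. ennreal (wt \<alpha> z) \<partial>lborel) \<le> ennreal T"
        unfolding T(1)[symmetric] by (intro nn_integral_mono) (auto simp: indicator_def)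
      also have "T * 1 \<le> T * (2 * r) powr (\<alpha> + 2)"
        using False \<alpha> T by (intro mult_left_mono ge_one_powr_ge_zero) auto
      then have "T \<le> C * r powr (\<alpha> + 2)"
        using A r by (simp add: C_def powr_mult algebra_simps add_increasing)
      finally show ?thesis by (simp add: ennreal_leI)
    qed
  qed
qed

section \<open>The submean value inequality for powers of the modulus of a holomorphic
  function\<close>

lemma submean_powr_le_1:
  fixes p R :: real
  assumes hol: "f holomorphic_on S" and S: "cball a R \<subseteq> S" and R: "R > 0" and p: "0 < p" "p \<le> 1"
  shows "ennreal (norm (f a) powr p * R\<^sup>2) \<le> ennreal (2 powr (2/p) / pi) * (\<integral>\<^sup>+z\<in>ball a R. ennreal (norm (f z) powr p) \<partial>lborel)"
proof (cases "(\<integral>\<^sup>+z\<in>ball a R. ennreal (norm (f z) powr p) \<partial>lborel)")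
  case top
  then show ?thesis by (simp add: ennreal_mult_top)
next
  case (real I)
  \<comment> \<open>Subharmonicity of |f|^p is bypassed by maximising |f| against a power of the
    distance to the boundary of the disc. At a maximum point z0 with positive value, f is controlled
    throughout a disc about z0 of half the boundary distance, so the mean value inequality for f
    itself applies there. The exponent 2/p makes the p-th power at the centre equal to R^2
    |f(a)|^p.\<close>
  define \<phi> where "\<phi> = (\<lambda>z. (R - dist a z) powr (2/p) * norm (f z))"
  have "continuous_on (cball a R) f"
    using hol S holomorphic_on_imp_continuous_on continuous_on_subset by blast
  then have "continuous_on (cball a R) \<phi>"
    unfolding \<phi>_def using p by (intro continuous_intros continuous_on_powr') auto
  then obtain z0 where z0: "z0 \<in> cball a R" "\<And>z. z \<in> cball a R \<Longrightarrow> \<phi> z \<le> \<phi> z0"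
    using continuous_attains_sup[of "cball a R" \<phi>] R by auto
  define M where "M = \<phi> z0"
  have M0: "M \<ge> 0" by (simp add: M_def \<phi>_def)
  have fa: "R powr (2/p) * norm (f a) \<le> M"
    using z0(2)[of a] R by (simp add: M_def \<phi>_def)
  have "R\<^sup>2 * norm (f a) powr p = (R powr (2/p) * norm (f a)) powr p"
    using R p by (simp add: powr_mult powr_powr)
  also have "\<dots> \<le> M powr p"
    using fa p R by (intro powr_mono2) auto
  finally have fa': "norm (f a) powr p * R\<^sup>2 \<le> M powr p" by (simp add: mult.commute)
  have "M powr p \<le> 2 powr (2/p) / pi * I"
  proof (cases "M = 0")
    case True
    then show ?thesis using real by simp
  next
    case False
    then have M: "M > 0" using M0 by simp
    define d where "d = (R - dist a z0) / 2"
    have d: "d > 0" "R - dist a z0 = 2 * d"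
      using M p z0(1) by (auto simp: d_def M_def \<phi>_def intro!: order_neq_le_trans)
    have Rd: "R - dist a w > d" if "w \<in> ball z0 d" for w
      using that d dist_triangle[of a w z0] by auto
    have sub: "ball z0 d \<subseteq> ball a R" using Rd d by fastforce
    \<comment> \<open>On the small disc maximality gives |f| \<le> M d^(-2/p), so K bounds |f|^(1-p)
      and converts |f| into a multiple of |f|^p under the integral. Here p \<le> 1 is used.\<close>
    define K where "K = (M * d powr (-2/p)) powr (1 - p)"
    have fw: "norm (f w) \<le> K * norm (f w) powr p" if w: "w \<in> ball z0 d" for w
    proof (cases "f w = 0")
      case False
      have "d powr (2/p) * norm (f w) \<le> (R - dist a w) powr (2/p) * norm (f w)"
        using Rd[OF w] d p by (intro mult_right_mono powr_mono2) auto
      also have "\<dots> \<le> M"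
        using z0(2)[of w] sub w by (auto simp: M_def \<phi>_def)
      finally have "norm (f w) \<le> M * d powr (-2/p)"
        using d by (simp add: powr_minus field_simps)
      then have "norm (f w) powr (1 - p) \<le> K"
        unfolding K_def using p by (intro powr_mono2) auto
      then have "norm (f w) powr (1 - p) * norm (f w) powr p \<le> K * norm (f w) powr p"
        by (intro mult_right_mono) auto
      then show ?thesis using False by (simp add: powr_add[symmetric])
    qed (use p in auto)
    have "ball z0 d \<subseteq> S" using sub S ball_subset_cball by blast
    then have "ennreal (norm (f z0) * (pi * d\<^sup>2)) \<le> (\<integral>\<^sup>+z\<in>ball z0 d. ennreal (norm (f z)) \<partial>lborel)"
      using d by (intro area_mean_value holomorphic_on_subset[OF hol]) auto
    also have "\<dots> \<le> (\<integral>\<^sup>+z. ennreal K * (ennreal (norm (f z) powr p) * indicator (ball a R) z) \<partial>lborel)"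
    proof (intro nn_integral_mono)
      fix z
      show "ennreal (norm (f z)) * indicator (ball z0 d) z
        \<le> ennreal K * (ennreal (norm (f z) powr p) * indicator (ball a R) z)"
      proof (cases "z \<in> ball z0 d")
        case True
        then show ?thesis
          using fw[of z] sub by (auto simp: ennreal_mult'[symmetric] K_def intro!: ennreal_leI)
      qed simp
    qed
    also have "\<dots> = ennreal K * ennreal I"
    proof -
      have "continuous_on UNIV (\<lambda>z::complex. norm z powr p)"
        using p by (intro continuous_on_powr' continuous_intros) auto
      from holomorphic_indicator_measurable[OF holomorphic_on_subset[OF hol S] _ ball_subset_cball this]
      have "(\<lambda>z. ennreal (norm (f z) powr p) * indicator (ball a R) z) \<in> borel_measurable borel"
        by simp
      then show ?thesis using real by (subst nn_integral_cmult) auto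
    qed
    also have "\<dots> = ennreal (K * I)"
      using real by (simp add: K_def ennreal_mult')
    finally have "norm (f z0) * (pi * d\<^sup>2) \<le> K * I"
      using real by (simp add: ennreal_le_iff K_def)
    moreover have "norm (f z0) = M * (2 * d) powr (-2/p)"
    proof -
      have "M = (2 * d) powr (2/p) * norm (f z0)" by (simp add: M_def \<phi>_def d(2))
      moreover have "(2 * d) powr (2/p) * (2 * d) powr (-2/p) = 1"
        using d(1) by (simp flip: powr_add)
      moreover have "n = m * b" if "m = a * n" "a * b = 1" for m n a b :: real
        using that by algebra
      ultimately show ?thesis by blast
    qed
    ultimately have 1: "M * (2 * d) powr (-2/p) * (pi * d\<^sup>2) \<le> K * I" by simp
    have dd: "(2 * d) powr (-2/p) * d\<^sup>2 = 2 powr (-2/p) * d powr (2 - 2/p)"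
    proof -
      have "d\<^sup>2 = d powr 2" using d(1) by simp
      then have "(2 * d) powr (-2/p) * d\<^sup>2 = 2 powr (-2/p) * (d powr (-2/p) * d powr 2)"
        using d(1) by (simp add: powr_mult)
      also have "d powr (-2/p) * d powr 2 = d powr (2 - 2/p)"
        by (simp flip: powr_add)
      finally show ?thesis .
    qed
    have KK: "K = M powr (1 - p) * d powr (2 - 2/p)"
    proof -
      have "(-2/p) * (1 - p) = 2 - 2/p" using p by (simp add: field_simps)
      then show ?thesis by (metis K_def powr_mult powr_powr)
    qed
    have "(M * 2 powr (-2/p) * pi) * d powr (2 - 2/p) = M * pi * ((2 * d) powr (-2/p) * d\<^sup>2)"
      unfolding dd by simp
    also have "\<dots> \<le> (M powr (1 - p) * I) * d powr (2 - 2/p)"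
      using 1 unfolding KK by (simp only: mult_ac)
    finally have "M * 2 powr (-2/p) * pi \<le> M powr (1 - p) * I"
      by (rule mult_right_le_imp_le) (use d(1) in simp)
    then have "M powr (p - 1) * (M * 2 powr (-2/p) * pi) \<le> M powr (p - 1) * (M powr (1 - p) * I)"
      by (intro mult_left_mono) auto
    moreover have "M powr (p - 1) * M powr (1 - p) = 1" "M powr (p - 1) * M = M powr p"
      using M by (simp_all add: powr_add[symmetric] powr_diff)
    ultimately have "M powr p * 2 powr (-2/p) * pi \<le> I"
      by (metis mult.assoc mult_1)
    then have "2 powr (2/p) * (M powr p * 2 powr (-2/p) * pi) \<le> 2 powr (2/p) * I"
      by (intro mult_left_mono) auto
    moreover have "2 powr (2/p) * 2 powr (-2/p) = (1::real)" by (simp flip: powr_add)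
    ultimately have "M powr p * pi \<le> 2 powr (2/p) * I"
      by (metis mult.assoc mult.left_commute mult_1)
    then show ?thesis by (simp add: pos_le_divide_eq)
  qed
  then show ?thesis
    using fa' real by (simp add: ennreal_mult'[symmetric] ennreal_leI)
qed

text \<open>For a natural number n \<ge> p, the function f^n is holomorphic and |f^n|^(p/n) = |f|^p.
  This reduces every exponent to one that is at most 1.\<close>

lemma submean_powr:
  fixes p :: real
  assumes p: "0 < p"
  obtains C where "C > 0" "\<And>f S a R. f holomorphic_on S \<Longrightarrow> cball a R \<subseteq> S \<Longrightarrow> R > 0 \<Longrightarrow>
     ennreal (norm (f a) powr p * R\<^sup>2) \<le> ennreal C * (\<integral>\<^sup>+z\<in>ball a R. ennreal (norm (f z) powr p) \<partial>lborel)"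
proof -
  obtain n :: nat where n: "p \<le> real n" using real_arch_simple by blast
  have n0: "real n > 0" using n p by simp
  have eq: "norm (w ^ n) powr (p / real n) = norm w powr p" for w :: complex
    using n0 by (cases "w = 0") (auto simp: norm_power powr_realpow[symmetric] powr_powr)
  show ?thesis
  proof (rule that)
    show "2 powr (2 / (p / real n)) / pi > 0" by simp
    fix f S a and R :: real assume *: "f holomorphic_on S" "cball a R \<subseteq> S" "R > 0"
    show "ennreal (norm (f a) powr p * R\<^sup>2) \<le> ennreal (2 powr (2 / (p / real n)) / pi) * (\<integral>\<^sup>+z\<in>ball a R. ennreal (norm (f z) powr p) \<partial>lborel)"
      using submean_powr_le_1[of "\<lambda>z. f z ^ n" S a R "p / real n"] * n n0 p
      by (simp add: eq holomorphic_on_power)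
  qed
qed

section \<open>Dyadic decompositions of the disc\<close>

text \<open>Treating the local integrals as values of a measure turns sums over disjoint families
  into countable additivity. The indicator is part of the density because f is arbitrary outside the
  disc.\<close>

definition bergman_measure :: "real \<Rightarrow> real \<Rightarrow> (complex \<Rightarrow> complex) \<Rightarrow> complex measure" where
  "bergman_measure p \<alpha> f =
     density lborel (\<lambda>z. ennreal (norm (f z) powr p * wt \<alpha> z) * indicator (ball 0 1) z)"

lemma bergman_density_measurable:
  assumes "f holomorphic_on ball 0 1" "p > 0"
  shows "(\<lambda>z. ennreal (norm (f z) powr p * wt \<alpha> z) * indicator (ball 0 1) z) \<in> borel_measurable borel"
proof -
  have "continuous_on UNIV (\<lambda>z::complex. norm z powr p)"
    using assms(2) by (intro continuous_on_powr' continuous_intros) auto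
  from holomorphic_indicator_measurable[OF assms(1) _ order_refl this]
  have m: "(\<lambda>z. ennreal (norm (f z) powr p) * indicator (ball 0 1) z) \<in> borel_measurable borel"
    by simp
  have "(\<lambda>z. ennreal (wt \<alpha> z) * (ennreal (norm (f z) powr p) * indicator (ball 0 1) z))
      \<in> borel_measurable borel"
    by (intro borel_measurable_times_ennreal m) measurable
  also have "?this \<longleftrightarrow> ?thesis"
    by (intro measurable_cong) (simp add: ennreal_mult' mult_ac)
  finally show ?thesis .
qed

lemma sets_bergman_measure [simp]: "sets (bergman_measure p \<alpha> f) = sets borel"
  by (simp add: bergman_measure_def)

lemma emeasure_bergman_measure:
  assumes "f holomorphic_on ball 0 1" "p > 0" "E \<in> sets borel"
  shows "emeasure (bergman_measure p \<alpha> f) E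
    = (\<integral>\<^sup>+z. ennreal (norm (f z) powr p * wt \<alpha> z) * indicator (ball 0 1) z * indicator E z \<partial>lborel)"
  unfolding bergman_measure_def
  by (intro emeasure_density) (use assms bergman_density_measurable in auto)

lemma bergman_integral_eq:
  assumes "f holomorphic_on ball 0 1" "p > 0"
  shows "bergman_integral p \<alpha> f = emeasure (bergman_measure p \<alpha> f) UNIV"
  using assms by (simp add: emeasure_bergman_measure bergman_integral_def)

lemma emeasure_bergman_measure_le:
  assumes "f holomorphic_on ball 0 1" "p > 0"
  shows "emeasure (bergman_measure p \<alpha> f) E \<le> bergman_integral p \<alpha> f"
  unfolding bergman_integral_eq[OF assms] by (intro emeasure_mono) auto

text \<open>On the disc about z of radius (1-|z|)/4 the weight is comparable to (1-|z|)^\<alpha>,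
  and the submean inequality with this radius contributes the remaining factor (1-|z|)^2.\<close>

lemma local_growth:
  assumes p: "0 < p"
  obtains C where "C > 0" "\<And>f z. f holomorphic_on ball 0 1 \<Longrightarrow> norm z < 1 \<Longrightarrow>
     ennreal (norm (f z) powr p * (1 - norm z) powr (\<alpha> + 2))
       \<le> ennreal C * emeasure (bergman_measure p \<alpha> f) (ball z ((1 - norm z) / 4))"
proof -
  obtain C0 where C0: "C0 > 0" "\<And>f S a R. f holomorphic_on S \<Longrightarrow> cball a R \<subseteq> S \<Longrightarrow> R > 0 \<Longrightarrow>
     ennreal (norm (f a) powr p * R\<^sup>2) \<le> ennreal C0 * (\<integral>\<^sup>+z\<in>ball a R. ennreal (norm (f z) powr p) \<partial>lborel)"
    using submean_powr[OF p] by blast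
  \<comment> \<open>With u = 1-|z|, on the small disc 1-|w| lies between 3u/4 and 5u/4, and 1-|w|^2
    lies between 1-|w| and twice that, hence between 3u/4 and 5u/2.\<close>
  define c :: real where "c = min ((3/4) powr \<alpha>) ((5/2) powr \<alpha>)"
  have c: "c > 0" by (simp add: c_def)
  show ?thesis
  proof (rule that)
    show "16 * C0 / c > 0" using c C0 by simp
    fix f and z :: complex assume f: "f holomorphic_on ball 0 1" and z: "norm z < 1"
    define u where "u = 1 - norm z"
    have u: "u > 0" "u \<le> 1" using z by (auto simp: u_def)
    have nb: "3/4 * u \<le> 1 - norm w" "1 - norm w \<le> 5/4 * u" if "w \<in> ball z (u/4)" for w
      using that norm_triangle_ineq2[of z w] norm_triangle_ineq2[of w z] by (auto simp: u_def dist_norm norm_minus_commute)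
    have nb1: "norm w < 1" if "w \<in> ball z (u/4)" for w using nb[OF that] u by linarith
    have sub: "cball z (u/4) \<subseteq> ball 0 1"
    proof
      fix w assume "w \<in> cball z (u/4)"
      then show "w \<in> ball 0 1"
        using norm_triangle_ineq2[of w z] u by (auto simp: u_def dist_norm norm_minus_commute)
    qed
    have wt: "c * u powr \<alpha> \<le> wt \<alpha> w" if "w \<in> ball z (u/4)" for w
      unfolding c_def using powr_between(1)[of u "3/4" "1 - (norm w)\<^sup>2" "5/2" \<alpha>]
        one_minus_norm_sq[OF nb1[OF that]] nb[OF that] u by argo
    have "ennreal (norm (f z) powr p * u powr (\<alpha> + 2))
       = ennreal (16 * u powr \<alpha>) * ennreal (norm (f z) powr p * (u/4)\<^sup>2)"
      using u by (simp add: ennreal_mult'[symmetric] powr_add power2_eq_square mult_ac)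
    also have "\<dots> \<le> ennreal (16 * u powr \<alpha>) * (ennreal C0 * (\<integral>\<^sup>+w\<in>ball z (u/4). ennreal (norm (f w) powr p) \<partial>lborel))"
      using u by (intro mult_left_mono C0(2)[OF f sub]) auto
    also have "\<dots> = ennreal (16 * C0 / c) * (ennreal (c * u powr \<alpha>) * (\<integral>\<^sup>+w\<in>ball z (u/4). ennreal (norm (f w) powr p) \<partial>lborel))"
    proof -
      have "ennreal (16 * u powr \<alpha>) * ennreal C0 = ennreal (16 * C0 / c) * ennreal (c * u powr \<alpha>)"
        using c C0(1) by (simp add: ennreal_mult'[symmetric] mult_ac)
      then show ?thesis by (simp only: mult.assoc[symmetric])
    qed
    also have "\<dots> = ennreal (16 * C0 / c) * (\<integral>\<^sup>+w. ennreal (c * u powr \<alpha>) * (ennreal (norm (f w) powr p) * indicator (ball z (u/4)) w) \<partial>lborel)"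
    proof -
      have "continuous_on UNIV (\<lambda>z::complex. norm z powr p)"
        using p by (intro continuous_on_powr' continuous_intros) auto
      from holomorphic_indicator_measurable[OF holomorphic_on_subset[OF f sub] _ ball_subset_cball this]
      have "(\<lambda>w. ennreal (norm (f w) powr p) * indicator (ball z (u/4)) w) \<in> borel_measurable lborel"
        by simp
      then show ?thesis by (subst nn_integral_cmult) auto
    qed
    also have "\<dots> \<le> ennreal (16 * C0 / c) * (\<integral>\<^sup>+w. ennreal (norm (f w) powr p * wt \<alpha> w) * indicator (ball 0 1) w * indicator (ball z (u/4)) w \<partial>lborel)"
    proof (intro mult_left_mono nn_integral_mono)
      fix w
      show "ennreal (c * u powr \<alpha>) * (ennreal (norm (f w) powr p) * indicator (ball z (u/4)) w)
         \<le> ennreal (norm (f w) powr p * wt \<alpha> w) * indicator (ball 0 1) w * indicator (ball z (u/4)) w"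
      proof (cases "w \<in> ball z (u/4)")
        case True
        have "c * u powr \<alpha> * norm (f w) powr p \<le> norm (f w) powr p * wt \<alpha> w"
          using wt[OF True] by (subst mult.commute) (intro mult_left_mono, auto)
        then show ?thesis using True nb1[OF True] c
          by (simp add: ennreal_mult'[symmetric] ennreal_leI)
      qed simp
    qed auto
    also have "\<dots> = ennreal (16 * C0 / c) * emeasure (bergman_measure p \<alpha> f) (ball z (u/4))"
      using f p by (simp add: emeasure_bergman_measure)
    finally show "ennreal (norm (f z) powr p * (1 - norm z) powr (\<alpha> + 2))
       \<le> ennreal (16 * C0 / c) * emeasure (bergman_measure p \<alpha> f) (ball z ((1 - norm z) / 4))"
      by (simp add: u_def)
  qed
qed

section \<open>Dyadic annuli and the suprema of a function along the radius\<close>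

definition layer :: "nat \<Rightarrow> complex set" where
  "layer n = {z. (1/2) ^ Suc n < 1 - norm z \<and> 1 - norm z \<le> (1/2) ^ n}"

lemma layer_measurable [measurable]: "layer n \<in> sets borel"
proof -
  have "layer n = {z. (1/2) ^ Suc n < 1 - norm z} \<inter> {z. 1 - norm z \<le> (1/2) ^ n}"
    by (auto simp: layer_def)
  moreover have "open {z::complex. (1/2) ^ Suc n < 1 - norm z}" "closed {z::complex. 1 - norm z \<le> (1/2) ^ n}"
    by (intro open_Collect_less closed_Collect_le continuous_intros)+
  ultimately show ?thesis by simp
qed

lemma half_power_powr: "(1/2::real) ^ n = 2 powr (- real n)"
  by (simp add: powr_minus powr_realpow power_one_over inverse_eq_divide)

lemma half_power_antimono: "m \<le> n \<Longrightarrow> (1/2::real) ^ n \<le> (1/2) ^ m"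
  by (rule power_decreasing) auto

lemma disjoint_layer: "disjoint_family layer"
  unfolding disjoint_family_on_def
proof (intro ballI impI)
  fix m n :: nat assume "m \<noteq> n"
  then have "Suc m \<le> n \<or> Suc n \<le> m" by arith
  then show "layer m \<inter> layer n = {}"
    using half_power_antimono[of "Suc m" n] half_power_antimono[of "Suc n" m]
    by (auto simp: layer_def)
qed

lemma layer_sum_le:
  assumes "f holomorphic_on ball 0 1" "p > 0"
  shows "(\<Sum>n. emeasure (bergman_measure p \<alpha> f) (layer n)) \<le> bergman_integral p \<alpha> f"
  using suminf_emeasure[of layer "bergman_measure p \<alpha> f"] disjoint_layer emeasure_bergman_measure_le[OF assms]
  by (auto simp: image_subset_iff)

text \<open>Within the ball the distance to the unit circle changes only by factors between 3/4 and
  5/4, while consecutive layers scale by 2, so only the neighbouring layers can be met.\<close>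

lemma ball_in_layers:
  assumes u: "(1/2) ^ Suc n \<le> 1 - norm z" "1 - norm z \<le> (1/2) ^ n"
  shows "ball z ((1 - norm z) / 4) \<subseteq> layer (n - 1) \<union> layer n \<union> layer (Suc n)"
proof
  fix w assume w: "w \<in> ball z ((1 - norm z) / 4)"
  then have 1: "1 - norm w < 5/4 * (1 - norm z)" "3/4 * (1 - norm z) < 1 - norm w"
    using norm_triangle_ineq2[of z w] norm_triangle_ineq2[of w z] by (auto simp: dist_norm norm_minus_commute)
  have a: "(1/2) ^ Suc (Suc n) < 1 - norm w" "1 - norm w < 5/4 * (1/2) ^ n"
    using 1 u by simp_all
  show "w \<in> layer (n - 1) \<union> layer n \<union> layer (Suc n)"
  proof (cases "1 - norm w \<le> (1/2) ^ n")
    case True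
    then show ?thesis using a by (cases "1 - norm w \<le> (1/2) ^ Suc n") (auto simp: layer_def)
  next
    case False
    \<comment> \<open>For n = 0 no point lies beyond the bound 1, so the truncated index
      \<open>n - 1\<close> does no harm.\<close>
    then have "n \<noteq> 0" by (auto intro: ccontr)
    then obtain k where k: "n = Suc k" by (cases n) auto
    show ?thesis using a False by (auto simp: layer_def k)
  qed
qed

text \<open>The intervals are closed so that continuous functions attain their suprema. Adjacent
  ones share an endpoint, so masses of \<mu> are taken on the half-open version
  \<open>half_open_dyadic\<close> instead.\<close>

definition dyadic_interval :: "nat \<Rightarrow> real set" where
  "dyadic_interval n = {1 - (1/2) ^ n .. 1 - (1/2) ^ Suc n}"

lemma dyadic_interval_props:
  assumes "t \<in> dyadic_interval n"
  shows "0 \<le> t" "t < 1" "(1/2) ^ Suc n \<le> 1 - t" "1 - t \<le> (1/2) ^ n"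
proof -
  have "(1/2::real) ^ n \<le> 1" "(0::real) < (1/2) ^ Suc n" by (auto simp: power_le_one)
  then show "0 \<le> t" "t < 1" "(1/2) ^ Suc n \<le> 1 - t" "1 - t \<le> (1/2) ^ n"
    using assms unfolding dyadic_interval_def atLeastAtMost_iff by linarith+
qed

lemma dyadic_interval_compact: "compact (complex_of_real ` dyadic_interval n)" "dyadic_interval n \<noteq> {}"
  unfolding dyadic_interval_def
  using half_power_antimono[of n "Suc n"]
  by (intro compact_continuous_image continuous_intros) auto

text \<open>Normalised so that the \<open>p\<close>-th powers are summable for \<open>f\<close> in the Bergman space.\<close>
definition dyadic_sup :: "real \<Rightarrow> real \<Rightarrow> (complex \<Rightarrow> complex) \<Rightarrow> nat \<Rightarrow> real" where
  "dyadic_sup p \<alpha> f n = 2 powr (- (real n * (\<alpha> + 2) / p)) * (SUP t\<in>dyadic_interval n. norm (f (of_real t)))"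

lemma dyadic_sup_attained:
  assumes "f holomorphic_on ball 0 1"
  obtains t where "t \<in> dyadic_interval n" "(SUP t\<in>dyadic_interval n. norm (f (of_real t))) = norm (f (of_real t))"
    "\<And>s. s \<in> dyadic_interval n \<Longrightarrow> norm (f (of_real s)) \<le> norm (f (of_real t))"
proof -
  have "compact (dyadic_interval n)" by (simp add: dyadic_interval_def)
  moreover have "continuous_on (dyadic_interval n) (\<lambda>t. norm (f (of_real t)))"
    by (intro continuous_on_norm continuous_on_compose2[OF holomorphic_on_imp_continuous_on[OF assms]] continuous_intros)
      (use dyadic_interval_props in fastforce)
  ultimately obtain t where t: "t \<in> dyadic_interval n" "\<forall>s\<in>dyadic_interval n. norm (f (of_real s)) \<le> norm (f (of_real t))"
    using continuous_attains_sup dyadic_interval_compact(2) by metis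
  then have "(SUP t\<in>dyadic_interval n. norm (f (of_real t))) = norm (f (of_real t))"
    by (intro cSup_eq_maximum) auto
  with t that show ?thesis by blast
qed

lemma dyadic_sup_nonneg:
  assumes "f holomorphic_on ball 0 1"
  shows "0 \<le> dyadic_sup p \<alpha> f n"
  by (rule dyadic_sup_attained[OF assms, of n]) (simp add: dyadic_sup_def)

lemma norm_le_dyadic_sup:
  assumes f: "f holomorphic_on ball 0 1" and t: "t \<in> dyadic_interval n"
  shows "norm (f (of_real t)) \<le> 2 powr (real n * (\<alpha> + 2) / p) * dyadic_sup p \<alpha> f n"
proof -
  obtain s where s: "(SUP t\<in>dyadic_interval n. norm (f (of_real t))) = norm (f (of_real s))"
    "norm (f (of_real t)) \<le> norm (f (of_real s))"
    using dyadic_sup_attained[OF f, of n] t by metis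
  have "2 powr (real n * (\<alpha> + 2) / p) * dyadic_sup p \<alpha> f n
     = (2 powr (real n * (\<alpha> + 2) / p) * 2 powr (- (real n * (\<alpha> + 2) / p))) * norm (f (of_real s))"
    by (simp add: dyadic_sup_def s(1))
  also have "\<dots> = norm (f (of_real s))" by (simp flip: powr_add)
  finally show ?thesis using s(2) by simp
qed

text \<open>With truncated subtraction the shifted sequence \<open>Y (n - 1)\<close> counts
  \<open>Y 0\<close> twice, which is why the factor is 4 and not 3.\<close>

lemma suminf_ennreal_shifts_le:
  fixes Y :: "nat \<Rightarrow> ennreal"
  shows "(\<Sum>n. Y (n - 1) + Y n + Y (Suc n)) \<le> 4 * (\<Sum>n. Y n)"
proof -
  have 1: "(\<Sum>n. Y (n - 1)) = Y 0 + (\<Sum>n. Y n)"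
    using suminf_offset[of "\<lambda>n. Y (n - 1)" 1] by simp
  have 2: "(\<Sum>n. Y n) = Y 0 + (\<Sum>n. Y (Suc n))"
    using suminf_offset[of Y 1] by simp
  have 3: "Y 0 \<le> (\<Sum>n. Y n)" "(\<Sum>n. Y (Suc n)) \<le> (\<Sum>n. Y n)" by (subst 2; simp)+
  have "(\<Sum>n. Y (n - 1) + Y n + Y (Suc n)) = (\<Sum>n. Y (n - 1)) + (\<Sum>n. Y n) + (\<Sum>n. Y (Suc n))"
    by (simp add: suminf_add)
  also have "\<dots> \<le> ((\<Sum>n. Y n) + (\<Sum>n. Y n)) + (\<Sum>n. Y n) + (\<Sum>n. Y n)"
    unfolding 1 by (intro add_mono 3 order_refl)
  also have "\<dots> = 4 * (\<Sum>n. Y n)"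
  proof -
    have "S + S + S + S = 4 * S" for S :: ennreal
    proof -
      have "4 * S = 2 * (2 * S)" by (simp flip: mult.assoc)
      also have "\<dots> = S + S + S + S" by (simp only: mult.assoc mult_2 add.assoc)
      finally show ?thesis ..
    qed
    then show ?thesis by simp
  qed
  finally show ?thesis .
qed

text \<open>Apply the local growth estimate at the point of the n-th interval where |f| is largest.
  The disc used there meets only the layers n-1, n and n+1, so the sum over n counts each layer a
  bounded number of times.\<close>

lemma dyadic_sup_sum:
  assumes p: "0 < p"
  obtains C where "C > 0" "\<And>f. f holomorphic_on ball 0 1 \<Longrightarrow>
     (\<Sum>n. ennreal (dyadic_sup p \<alpha> f n powr p)) \<le> ennreal C * bergman_integral p \<alpha> f"
proof -
  obtain C0 where C0: "C0 > 0" "\<And>f z. f holomorphic_on ball 0 1 \<Longrightarrow> norm z < 1 \<Longrightarrow>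
     ennreal (norm (f z) powr p * (1 - norm z) powr (\<alpha> + 2))
       \<le> ennreal C0 * emeasure (bergman_measure p \<alpha> f) (ball z ((1 - norm z) / 4))"
    using local_growth[OF p] by blast
  define c :: real where "c = min ((1/2) powr (\<alpha> + 2)) (1 powr (\<alpha> + 2))"
  have c: "c > 0" by (simp add: c_def)
  show ?thesis
  proof (rule that)
    show "C0 / c * 4 > 0" using C0 c by simp
    fix f assume f: "f holomorphic_on ball 0 1"
    define Y where "Y = (\<lambda>n. emeasure (bergman_measure p \<alpha> f) (layer n))"
    have 1: "ennreal (dyadic_sup p \<alpha> f n powr p) \<le> ennreal (C0 / c) * (Y (n - 1) + Y n + Y (Suc n))" for n
    proof -
      obtain t where t: "t \<in> dyadic_interval n" "(SUP t\<in>dyadic_interval n. norm (f (of_real t))) = norm (f (of_real t))"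
        using dyadic_sup_attained[OF f, of n] by metis
      note tt = dyadic_interval_props[OF t(1)]
      have nt: "norm (complex_of_real t) = t" using tt by simp
      have "c * ((1/2) ^ n) powr (\<alpha> + 2) \<le> (1 - t) powr (\<alpha> + 2)"
        unfolding c_def by (rule powr_between(1)) (use tt in auto)
      also have "((1/2::real) ^ n) powr (\<alpha> + 2) = 2 powr (- (real n * (\<alpha> + 2)))"
        unfolding half_power_powr by (simp add: powr_powr)
      finally have w: "c * 2 powr (- (real n * (\<alpha> + 2))) \<le> (1 - t) powr (\<alpha> + 2)" .
      have "dyadic_sup p \<alpha> f n powr p = norm (f (of_real t)) powr p * 2 powr (- (real n * (\<alpha> + 2)))"
        using p by (simp add: dyadic_sup_def t(2) powr_mult powr_powr mult.commute)
      also have "\<dots> \<le> norm (f (of_real t)) powr p * ((1 - t) powr (\<alpha> + 2) / c)"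
        using w c by (intro mult_left_mono) (auto simp: field_simps)
      finally have "ennreal (dyadic_sup p \<alpha> f n powr p) \<le> ennreal (1 / c) * ennreal (norm (f (of_real t)) powr p * (1 - t) powr (\<alpha> + 2))"
        using c by (simp add: ennreal_mult'[symmetric] ennreal_leI)
      also have "\<dots> \<le> ennreal (1 / c) * (ennreal C0 * emeasure (bergman_measure p \<alpha> f) (ball (of_real t) ((1 - t) / 4)))"
        using C0(2)[OF f, of "of_real t"] tt by (intro mult_left_mono) auto
      also have "\<dots> \<le> ennreal (1 / c) * (ennreal C0 * emeasure (bergman_measure p \<alpha> f) (layer (n - 1) \<union> layer n \<union> layer (Suc n)))"
        using ball_in_layers[of n "of_real t"] tt unfolding nt by (intro mult_left_mono emeasure_mono) auto
      also have "\<dots> \<le> ennreal (1 / c) * (ennreal C0 * (Y (n - 1) + Y n + Y (Suc n)))"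
        unfolding Y_def
        by (intro mult_left_mono order_trans[OF emeasure_subadditive] add_mono emeasure_subadditive) auto
      also have "\<dots> = ennreal (C0 / c) * (Y (n - 1) + Y n + Y (Suc n))"
        using C0(1) c by (simp add: ennreal_mult'[symmetric] mult.assoc[symmetric])
      finally show ?thesis .
    qed
    have "(\<Sum>n. ennreal (dyadic_sup p \<alpha> f n powr p)) \<le> (\<Sum>n. ennreal (C0 / c) * (Y (n - 1) + Y n + Y (Suc n)))"
      by (intro suminf_le 1) auto
    also have "\<dots> = ennreal (C0 / c) * (\<Sum>n. Y (n - 1) + Y n + Y (Suc n))" by simp
    also have "\<dots> \<le> ennreal (C0 / c) * (4 * (\<Sum>n. Y n))"
      by (intro mult_left_mono suminf_ennreal_shifts_le) auto
    also have "\<dots> \<le> ennreal (C0 / c) * (4 * bergman_integral p \<alpha> f)"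
      using layer_sum_le[OF f p] by (intro mult_left_mono) (auto simp: Y_def)
    also have "\<dots> = ennreal (C0 / c * 4) * bergman_integral p \<alpha> f"
    proof -
      have "ennreal (C0 / c * 4) = ennreal (C0 / c) * 4"
        using C0(1) c by (subst ennreal_mult) auto
      then show ?thesis by (simp add: mult.assoc)
    qed
    finally show "(\<Sum>n. ennreal (dyadic_sup p \<alpha> f n powr p)) \<le> ennreal (C0 / c * 4) * bergman_integral p \<alpha> f" .
  qed
qed

text \<open>These are dyadic annuli around the point 1, cut with the disc: since \<mu> lives on
  [0,1), the kernel is singular only at 1. The outer radius of shell 0 is 2, so the shells cover the
  disc.\<close>

definition shell :: "nat \<Rightarrow> complex set" where
  "shell m = {z. norm z < 1 \<and> (1/2) ^ m \<le> norm (1 - z) \<and> norm (1 - z) < 2 * (1/2) ^ m}"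

lemma shell_exists:
  assumes "norm z < 1"
  obtains m where "z \<in> shell m"
proof -
  have lt: "norm (1 - z) < 2" using norm_triangle_ineq4[of 1 z] assms by simp
  have pos: "norm (1 - z) > 0" using assms by auto
  have ex: "\<exists>m. (1/2) ^ m \<le> norm (1 - z)"
    using real_arch_pow_inv[OF pos, of "1/2"] by (auto intro: less_imp_le)
  define m where "m = (LEAST m. (1/2) ^ m \<le> norm (1 - z))"
  have 1: "(1/2) ^ m \<le> norm (1 - z)" unfolding m_def by (rule LeastI_ex[OF ex])
  have "norm (1 - z) < 2 * (1/2) ^ m"
  proof (cases m)
    case (Suc k)
    then have "\<not> (1/2) ^ k \<le> norm (1 - z)" using not_less_Least[of k "\<lambda>m. (1/2) ^ m \<le> norm (1 - z)"] by (simp add: m_def)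
    then show ?thesis using Suc by simp
  qed (use lt in simp)
  then show ?thesis using that[of m] 1 assms by (simp add: shell_def)
qed

text \<open>Each shell lies in the part of the disc within distance 2 * 2^-m of 1, whose weighted
  area is known. The bounds \<open>c m\<close> may be infinite, and G need not be measurable because
  only monotonicity of the integral is applied to it.\<close>

lemma shell_integral_bound:
  assumes \<alpha>: "\<alpha> > -1"
  obtains C where "C > 0" "\<And>G c. (\<And>m z. z \<in> shell m \<Longrightarrow> ennreal (G z) \<le> c m) \<Longrightarrow>
    (\<integral>\<^sup>+z\<in>ball 0 1. ennreal (G z * wt \<alpha> z) \<partial>lborel)
      \<le> ennreal C * (\<Sum>m. c m * ennreal (2 powr (- (real m * (\<alpha> + 2)))))"
proof -
  obtain C0 where C0: "C0 > 0" "\<And>r. 0 < r \<Longrightarrow> r \<le> 2 \<Longrightarrow>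
     (\<integral>\<^sup>+z\<in>ball 0 1 \<inter> ball (1::complex) r. ennreal (wt \<alpha> z) \<partial>lborel) \<le> ennreal (C0 * r powr (\<alpha> + 2))"
    using weight_near_1[OF \<alpha>] by blast
  show ?thesis
  proof (rule that)
    show "C0 * 2 powr (\<alpha> + 2) > 0" using C0 by simp
    fix G :: "complex \<Rightarrow> real" and c
    assume G: "\<And>m z. z \<in> shell m \<Longrightarrow> ennreal (G z) \<le> c m"
    define B where "B = (\<lambda>m::nat. ball 0 1 \<inter> ball (1::complex) (2 * (1/2) ^ m))"
    have B: "B m \<in> sets borel" for m by (simp add: B_def)
    have meas: "(\<lambda>z. ennreal (wt \<alpha> z) * indicator (B m) z) \<in> borel_measurable lborel" for m
      using B by (intro borel_measurable_times_ennreal borel_measurable_indicator) auto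
    have "(\<integral>\<^sup>+z\<in>ball 0 1. ennreal (G z * wt \<alpha> z) \<partial>lborel)
       \<le> (\<integral>\<^sup>+z. (\<Sum>m. c m * (ennreal (wt \<alpha> z) * indicator (B m) z)) \<partial>lborel)"
    proof (rule nn_integral_mono, goal_cases)
      case (1 z)
      show ?case
      proof (cases "norm z < 1")
        case True
        then obtain m where m: "z \<in> shell m" using shell_exists by blast
        then have zB: "z \<in> B m" by (auto simp: B_def shell_def dist_norm)
        have "ennreal (G z * wt \<alpha> z) = ennreal (G z) * ennreal (wt \<alpha> z)"
          by (cases "G z \<ge> 0") (auto simp: ennreal_mult ennreal_neg mult_nonpos_nonneg)
        also have "\<dots> \<le> c m * ennreal (wt \<alpha> z)"
          using G[OF m] by (intro mult_right_mono) auto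
        also have "\<dots> = (\<Sum>k\<in>{m}. c k * (ennreal (wt \<alpha> z) * indicator (B k) z))"
          using zB by simp
        also have "\<dots> \<le> (\<Sum>m. c m * (ennreal (wt \<alpha> z) * indicator (B m) z))"
          by (intro sum_le_suminf) auto
        finally show ?thesis using True by simp
      qed simp
    qed
    also have "\<dots> = (\<Sum>m. c m * (\<integral>\<^sup>+z. ennreal (wt \<alpha> z) * indicator (B m) z \<partial>lborel))"
      using meas by (subst nn_integral_suminf) (auto simp: nn_integral_cmult)
    also have "\<dots> \<le> (\<Sum>m. ennreal (C0 * 2 powr (\<alpha> + 2)) * (c m * ennreal (2 powr (- (real m * (\<alpha> + 2))))))"
    proof (intro suminf_le)
      fix m
      have h: "(1/2::real) ^ m \<le> 1" by (simp add: power_le_one)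
      have "(\<integral>\<^sup>+z. ennreal (wt \<alpha> z) * indicator (B m) z \<partial>lborel) \<le> ennreal (C0 * (2 * (1/2) ^ m) powr (\<alpha> + 2))"
        unfolding B_def using h by (intro C0) auto
      also have "(2 * (1/2::real) ^ m) powr (\<alpha> + 2) = 2 powr (\<alpha> + 2) * 2 powr (- (real m * (\<alpha> + 2)))"
        unfolding half_power_powr by (simp add: powr_mult powr_powr)
      finally have "c m * (\<integral>\<^sup>+z. ennreal (wt \<alpha> z) * indicator (B m) z \<partial>lborel)
         \<le> c m * ennreal (C0 * (2 powr (\<alpha> + 2) * 2 powr (- (real m * (\<alpha> + 2)))))"
        by (intro mult_left_mono) auto
      also have "\<dots> = ennreal (C0 * 2 powr (\<alpha> + 2)) * (c m * ennreal (2 powr (- (real m * (\<alpha> + 2)))))"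
        using C0(1) by (simp add: ennreal_mult' mult_ac)
      finally show "c m * (\<integral>\<^sup>+z. ennreal (wt \<alpha> z) * indicator (B m) z \<partial>lborel) \<le> \<dots>" .
    qed auto
    also have "\<dots> = ennreal (C0 * 2 powr (\<alpha> + 2)) * (\<Sum>m. c m * ennreal (2 powr (- (real m * (\<alpha> + 2)))))"
      by simp
    finally show "(\<integral>\<^sup>+z\<in>ball 0 1. ennreal (G z * wt \<alpha> z) \<partial>lborel)
      \<le> ennreal (C0 * 2 powr (\<alpha> + 2)) * (\<Sum>m. c m * ennreal (2 powr (- (real m * (\<alpha> + 2)))))" .
  qed
qed

section \<open>Discrete convolutions with dyadic kernels\<close>

definition kernel :: "real \<Rightarrow> nat \<Rightarrow> nat \<Rightarrow> real" where
  "kernel \<epsilon> n m = 2 powr (- (\<epsilon> * real ((n - m) + (m - n))))"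

lemma kernel_sym: "kernel \<epsilon> n m = kernel \<epsilon> m n"
  by (simp add: kernel_def add.commute)

lemma kernel_nonneg [simp]: "0 \<le> kernel \<epsilon> n m"
  by (simp add: kernel_def)

lemma sum_power_inj_le:
  fixes \<rho> :: real
  assumes "0 \<le> \<rho>" "\<rho> < 1" "finite A" "inj_on h A"
  shows "(\<Sum>m\<in>A. \<rho> ^ h m) \<le> 1 / (1 - \<rho>)"
proof -
  have "(\<Sum>m\<in>A. \<rho> ^ h m) = (\<Sum>j\<in>h ` A. \<rho> ^ j)"
    using assms by (simp add: sum.reindex)
  also have "\<dots> \<le> (\<Sum>j. \<rho> ^ j)"
    using assms by (intro sum_le_suminf summable_geometric) auto
  also have "\<dots> = 1 / (1 - \<rho>)" using assms by (intro suminf_geometric) auto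
  finally show ?thesis .
qed

text \<open>The exponent \<open>(n - m) + (m - n)\<close> is the distance |n-m| written with
  truncated subtraction. On each side of n the distance is injective in m, so each half of the sum
  is at most a full geometric series.\<close>

lemma kernel_sum:
  assumes "\<epsilon> > 0"
  shows "(\<Sum>m. ennreal (kernel \<epsilon> n m)) \<le> ennreal (2 / (1 - 2 powr (- \<epsilon>)))"
proof -
  define \<rho> where "\<rho> = 2 powr (- \<epsilon>)"
  have \<rho>: "0 \<le> \<rho>" "\<rho> < 1" using assms by (auto simp: \<rho>_def powr_less_one)
  have k: "kernel \<epsilon> n m = \<rho> ^ ((n - m) + (m - n))" for m
    unfolding \<rho>_def kernel_def by (subst powr_realpow[symmetric]) (auto simp: powr_powr)
  have "(\<Sum>m<N. kernel \<epsilon> n m) \<le> 2 / (1 - \<rho>)" for N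
  proof -
    have "{..<N} = {m. m < N \<and> m \<le> n} \<union> {m. m < N \<and> n < m}" by auto
    then have "(\<Sum>m<N. kernel \<epsilon> n m) = (\<Sum>m\<in>{m. m < N \<and> m \<le> n}. kernel \<epsilon> n m) + (\<Sum>m\<in>{m. m < N \<and> n < m}. kernel \<epsilon> n m)"
      by (metis (no_types, lifting) disjoint_iff finite_Un finite_lessThan linorder_not_less mem_Collect_eq sum.union_disjoint)
    also have "\<dots> \<le> 1 / (1 - \<rho>) + 1 / (1 - \<rho>)"
      unfolding k using \<rho> by (intro add_mono sum_power_inj_le) (auto simp: inj_on_def)
    finally show ?thesis by simp
  qed
  then have "(\<Sum>m<N. ennreal (kernel \<epsilon> n m)) \<le> ennreal (2 / (1 - \<rho>))" for N
    by (simp add: sum_ennreal ennreal_leI)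
  then show ?thesis unfolding \<rho>_def by (intro suminf_le_const) auto
qed

lemma suminf_swap_ennreal:
  fixes f :: "nat \<Rightarrow> nat \<Rightarrow> ennreal"
  shows "(\<Sum>m. \<Sum>n. f m n) = (\<Sum>n. \<Sum>m. f m n)"
  using nn_integral_suminf[of "\<lambda>n m. f m n" "count_space UNIV"]
  by (simp add: nn_integral_count_space_nat)

definition half_open_dyadic :: "nat \<Rightarrow> real set" where
  "half_open_dyadic n = {1 - (1/2) ^ n ..< 1 - (1/2) ^ Suc n}"

lemma half_open_dyadic_subset: "half_open_dyadic n \<subseteq> dyadic_interval n"
  by (auto simp: half_open_dyadic_def dyadic_interval_def)

lemma half_open_dyadic_borel [measurable]: "half_open_dyadic n \<in> sets borel"
  by (simp add: half_open_dyadic_def)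

lemma half_open_dyadic_exists:
  assumes "0 \<le> t" "t < 1"
  obtains n where "t \<in> half_open_dyadic n"
proof -
  have ex: "\<exists>n. (1/2) ^ Suc n < 1 - t"
  proof -
    obtain n where "(1/2::real) ^ n < 1 - t" using real_arch_pow_inv[of "1 - t" "1/2"] assms by auto
    then have "(1/2::real) ^ Suc n < 1 - t"
      using half_power_antimono[of n "Suc n"] by linarith
    then show ?thesis ..
  qed
  define n where "n = (LEAST n. (1/2) ^ Suc n < 1 - t)"
  have 1: "(1/2) ^ Suc n < 1 - t" unfolding n_def by (rule LeastI_ex[OF ex])
  have "1 - t \<le> (1/2) ^ n"
  proof (cases n)
    case (Suc k)
    then have "\<not> (1/2) ^ Suc k < 1 - t" using not_less_Least[of k "\<lambda>n. (1/2) ^ Suc n < 1 - t"] by (simp add: n_def)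
    then show ?thesis using Suc by simp
  qed (use assms in simp)
  then show ?thesis using that[of n] 1 by (simp add: half_open_dyadic_def)
qed

lemma bergman_integral_shell_bound:
  assumes \<alpha>: "\<alpha> > -1"
  obtains C where "C > 0" "\<And>q G c. (\<And>m z. z \<in> shell m \<Longrightarrow> ennreal (norm (G z) powr q) \<le> c m) \<Longrightarrow>
    bergman_integral q \<alpha> G \<le> ennreal C * (\<Sum>m. c m * ennreal (2 powr (- (real m * (\<alpha> + 2)))))"
proof -
  obtain C where C: "C > 0" "\<And>G c. (\<And>m z. z \<in> shell m \<Longrightarrow> ennreal (G z) \<le> c m) \<Longrightarrow>
    (\<integral>\<^sup>+z\<in>ball 0 1. ennreal (G z * wt \<alpha> z) \<partial>lborel)
      \<le> ennreal C * (\<Sum>m. c m * ennreal (2 powr (- (real m * (\<alpha> + 2)))))"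
    using shell_integral_bound[OF \<alpha>] by blast
  show ?thesis
  proof (rule that[OF C(1)])
    fix q G c assume "\<And>m z. z \<in> shell m \<Longrightarrow> ennreal (norm (G z :: complex) powr q) \<le> c m"
    then show "bergman_integral q \<alpha> G \<le> ennreal C * (\<Sum>m. c m * ennreal (2 powr (- (real m * (\<alpha> + 2)))))"
      unfolding bergman_integral_def by (intro C(2)) auto
  qed
qed

text \<open>Instead of Schur's test: the convolution with a kernel decaying like \<open>2 powr (-\<epsilon> d)\<close> is dominated
  by a multiple of the supremum of the same terms with half the decay, and the \<open>q\<close>-th power of a supremum is at
  most the sum of the \<open>q\<close>-th powers.\<close>
lemma dyadic_bound_gt_1:
  assumes \<alpha>: "\<alpha> > -1" and q: "q > 1"
  obtains C where "C > 0" "\<And>u G. (\<And>n. 0 \<le> u n) \<Longrightarrow>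
    (\<And>m z. z \<in> shell m \<Longrightarrow> ennreal (norm (G z)) \<le>
       (\<Sum>n. ennreal (2 powr (\<alpha> + 2) * u n * 2 powr ((\<alpha> + 2) * real (min n m) - real n * ((\<alpha> + 2) * (1 - 1/q)))))) \<Longrightarrow>
    bergman_integral q \<alpha> G \<le> ennreal C * (\<Sum>n. ennreal (u n powr q))"
proof -
  obtain C0 where C0: "C0 > 0" "\<And>q G c. (\<And>m z. z \<in> shell m \<Longrightarrow> ennreal (norm (G z) powr q) \<le> c m) \<Longrightarrow>
    bergman_integral q \<alpha> G \<le> ennreal C0 * (\<Sum>m. c m * ennreal (2 powr (- (real m * (\<alpha> + 2)))))"
    using bergman_integral_shell_bound[OF \<alpha>] by blast
  define b where "b = \<alpha> + 2"
  have b: "b > 1" using \<alpha> by (simp add: b_def)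
  \<comment> \<open>The numbers e1 = b/q and e2 = b/q' are the decay rates for m > n and for m < n
    once the growth 2^(m e1) has been split off. Both are positive exactly because q > 1.\<close>
  define e1 where "e1 = b / q"
  define e2 where "e2 = b * (1 - 1/q)"
  have e: "e1 > 0" "e2 > 0" "e1 + e2 = b" using b q by (auto simp: e1_def e2_def field_simps)
  define \<epsilon> where "\<epsilon> = min e1 e2"
  have \<epsilon>: "\<epsilon> > 0" "\<epsilon> \<le> e1" "\<epsilon> \<le> e2" using e by (auto simp: \<epsilon>_def)
  have expo: "b * real (min n m) - real n * e2 \<le> real m * e1 - \<epsilon> * real ((n - m) + (m - n))" for n m
  proof (cases "n \<le> m")
    case True
    then have "\<epsilon> * (real m - real n) \<le> e1 * (real m - real n)" using \<epsilon> by (intro mult_right_mono) auto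
    moreover have "b * real n = e1 * real n + e2 * real n" using e(3) by (simp flip: distrib_right)
    ultimately show ?thesis using True by (simp add: of_nat_diff algebra_simps)
  next
    case False
    then have "\<epsilon> * (real n - real m) \<le> e2 * (real n - real m)" using \<epsilon> by (intro mult_right_mono) auto
    moreover have "b * real m = e1 * real m + e2 * real m" using e(3) by (simp flip: distrib_right)
    ultimately show ?thesis using False by (simp add: of_nat_diff algebra_simps)
  qed
  have ker: "2 powr (b * real (min n m) - real n * e2) \<le> 2 powr (real m * e1) * kernel \<epsilon> n m" for n m
    unfolding kernel_def powr_add[symmetric] using expo[of n m] by (intro powr_mono) auto
  define S where "S = 2 / (1 - 2 powr (- (\<epsilon> / 2)))"
  have S: "S > 0" using \<epsilon> by (simp add: S_def powr_less_one)
  define S2 where "S2 = 2 / (1 - 2 powr (- (q * \<epsilon> / 2)))"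
  have S2: "S2 > 0" using \<epsilon> q by (simp add: S2_def powr_less_one)
  define K where "K = (2 powr b * S) powr q"
  have K: "K > 0" using S by (simp add: K_def)
  \<comment> \<open>One half of the decay is kept with u n to form a supremum; the other half is
    summed to the constant S.\<close>
  have kk: "kernel \<epsilon> n m = kernel (\<epsilon> / 2) n m * kernel (\<epsilon> / 2) n m" for n m
    unfolding kernel_def by (simp flip: powr_add)
  have kq: "kernel (\<epsilon> / 2) n m powr q = kernel (q * \<epsilon> / 2) n m" for n m
    unfolding kernel_def by (simp add: powr_powr mult_ac)
  show ?thesis
  proof (rule that)
    show "C0 * K * S2 > 0" using C0 K S2 by simp
    fix u :: "nat \<Rightarrow> real" and G :: "complex \<Rightarrow> complex"
    assume u: "\<And>n. 0 \<le> u n"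
    assume "\<And>m z. z \<in> shell m \<Longrightarrow> ennreal (norm (G z)) \<le>
       (\<Sum>n. ennreal (2 powr (\<alpha> + 2) * u n * 2 powr ((\<alpha> + 2) * real (min n m) - real n * ((\<alpha> + 2) * (1 - 1/q)))))"
    then have G: "ennreal (norm (G z)) \<le> (\<Sum>n. ennreal (2 powr b * u n * 2 powr (b * real (min n m) - real n * e2)))"
      if "z \<in> shell m" for m z using that by (simp add: b_def e2_def)
    \<comment> \<open>V m dominates the q-th power of every term
      \<open>u n * kernel (\<epsilon> / 2) n m\<close>, hence of their supremum. Its sum over m is
      accessible by interchanging the two summations.\<close>
    define V where "V = (\<lambda>m. (\<Sum>n. ennreal (u n powr q * kernel (q * \<epsilon> / 2) n m)))"
    have *: "ennreal (norm (G z) powr q) \<le> ennreal (K * 2 powr (real m * b)) * V m" if z: "z \<in> shell m" for m z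
    proof (cases "V m")
      case top
      then show ?thesis using K by (simp add: ennreal_mult_top)
    next
      case (real v)
      have un: "u n * kernel (\<epsilon> / 2) n m \<le> v powr (1 / q)" for n
      proof -
        have "ennreal (u n powr q * kernel (q * \<epsilon> / 2) n m) = (\<Sum>n\<in>{n}. ennreal (u n powr q * kernel (q * \<epsilon> / 2) n m))"
          by simp
        also have "\<dots> \<le> V m" unfolding V_def by (intro sum_le_suminf) auto
        finally have "u n powr q * kernel (q * \<epsilon> / 2) n m \<le> v"
          using real by simp
        then have "(u n * kernel (\<epsilon> / 2) n m) powr q \<le> v"
          by (simp add: powr_mult kq)
        then have "((u n * kernel (\<epsilon> / 2) n m) powr q) powr (1/q) \<le> v powr (1/q)"
          using q by (intro powr_mono2) auto
        then show ?thesis using u[of n] q by (simp add: powr_powr)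
      qed
      have "ennreal (norm (G z)) \<le> (\<Sum>n. ennreal (2 powr b * u n * 2 powr (b * real (min n m) - real n * e2)))"
        by (rule G[OF z])
      also have "\<dots> \<le> (\<Sum>n. ennreal (2 powr b * 2 powr (real m * e1) * v powr (1/q)) * ennreal (kernel (\<epsilon> / 2) n m))"
      proof (intro suminf_le)
        fix n
        have "2 powr b * u n * 2 powr (b * real (min n m) - real n * e2)
           \<le> 2 powr b * u n * (2 powr (real m * e1) * kernel \<epsilon> n m)"
          using u[of n] ker[of n m] by (intro mult_left_mono) auto
        also have "\<dots> = 2 powr b * 2 powr (real m * e1) * (u n * kernel (\<epsilon> / 2) n m) * kernel (\<epsilon> / 2) n m"
          unfolding kk by (simp add: mult_ac)
        also have "\<dots> \<le> 2 powr b * 2 powr (real m * e1) * v powr (1/q) * kernel (\<epsilon> / 2) n m"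
          using un[of n] by (intro mult_right_mono mult_left_mono) auto
        finally show "ennreal (2 powr b * u n * 2 powr (b * real (min n m) - real n * e2))
          \<le> ennreal (2 powr b * 2 powr (real m * e1) * v powr (1/q)) * ennreal (kernel (\<epsilon> / 2) n m)"
          by (simp add: ennreal_mult'[symmetric] ennreal_leI)
      qed auto
      also have "\<dots> = ennreal (2 powr b * 2 powr (real m * e1) * v powr (1/q)) * (\<Sum>n. ennreal (kernel (\<epsilon> / 2) m n))"
        by (simp add: kernel_sym)
      also have "\<dots> \<le> ennreal (2 powr b * 2 powr (real m * e1) * v powr (1/q)) * ennreal S"
        unfolding S_def using \<epsilon> by (intro mult_left_mono kernel_sum) auto
      also have "\<dots> = ennreal (2 powr b * 2 powr (real m * e1) * v powr (1/q) * S)"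
        by (simp add: ennreal_mult')
      finally have "norm (G z) \<le> 2 powr b * 2 powr (real m * e1) * v powr (1/q) * S"
        using S by (simp add: ennreal_le_iff)
      then have "norm (G z) powr q \<le> (2 powr b * 2 powr (real m * e1) * v powr (1/q) * S) powr q"
        using q by (intro powr_mono2) auto
      also have "\<dots> = K * 2 powr (real m * b) * v"
        using q real(1) by (simp add: K_def powr_mult powr_powr e1_def mult_ac)
      finally show ?thesis
        using real K by (simp add: ennreal_mult'[symmetric] ennreal_leI)
    qed
    have "bergman_integral q \<alpha> G \<le> ennreal C0 * (\<Sum>m. (ennreal (K * 2 powr (real m * b)) * V m) * ennreal (2 powr (- (real m * (\<alpha> + 2)))))"
      by (intro C0(2) *)
    also have "(\<lambda>m. (ennreal (K * 2 powr (real m * b)) * V m) * ennreal (2 powr (- (real m * (\<alpha> + 2))))) = (\<lambda>m. ennreal K * V m)"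
    proof
      fix m
      have e: "2 powr (real m * b) * 2 powr (- (real m * b)) = (1::real)"
        by (simp flip: powr_add)
      have "ennreal (K * 2 powr (real m * b)) * ennreal (2 powr (- (real m * b)))
          = ennreal (K * 2 powr (real m * b) * 2 powr (- (real m * b)))"
        by (rule ennreal_mult''[symmetric]) simp
      then have "ennreal (K * 2 powr (real m * b)) * ennreal (2 powr (- (real m * b))) = ennreal K"
        by (simp only: mult.assoc e mult_1_right)
      then show "(ennreal (K * 2 powr (real m * b)) * V m) * ennreal (2 powr (- (real m * (\<alpha> + 2)))) = ennreal K * V m"
        by (simp add: b_def mult_ac)
    qed
    also have "(\<Sum>m. ennreal K * V m) = ennreal K * (\<Sum>m. V m)" by simp
    finally have 1: "bergman_integral q \<alpha> G \<le> ennreal C0 * (ennreal K * (\<Sum>m. V m))" .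
    have "(\<Sum>m. V m) = (\<Sum>n. \<Sum>m. ennreal (u n powr q * kernel (q * \<epsilon> / 2) n m))"
      unfolding V_def by (rule suminf_swap_ennreal)
    also have "\<dots> = (\<Sum>n. ennreal (u n powr q) * (\<Sum>m. ennreal (kernel (q * \<epsilon> / 2) n m)))"
      by (simp add: ennreal_mult')
    also have "\<dots> \<le> (\<Sum>n. ennreal (u n powr q) * ennreal S2)"
      unfolding S2_def using \<epsilon> q by (intro suminf_le mult_left_mono kernel_sum) auto
    also have "\<dots> = (\<Sum>n. ennreal (u n powr q)) * ennreal S2" by simp
    finally have "(\<Sum>m. V m) \<le> (\<Sum>n. ennreal (u n powr q)) * ennreal S2" .
    with 1 have "bergman_integral q \<alpha> G \<le> ennreal C0 * (ennreal K * ((\<Sum>n. ennreal (u n powr q)) * ennreal S2))"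
      by (rule order_trans[OF _ mult_left_mono[OF mult_left_mono]]) auto
    also have "\<dots> = ennreal (C0 * K * S2) * (\<Sum>n. ennreal (u n powr q))"
      using C0(1) K S2 by (simp add: ennreal_mult' mult_ac)
    finally show "bergman_integral q \<alpha> G \<le> ennreal (C0 * K * S2) * (\<Sum>n. ennreal (u n powr q))" .
  qed
qed

text \<open>For q = 1 the two summations can be interchanged at once. For fixed n, after
  multiplication by the area factor 2^(-m(\<alpha>+2)), each of the n + 1 shells with m \<le> n
  contributes 1, and the shells with m > n contribute a convergent geometric series.\<close>

lemma dyadic_bound_1:
  assumes \<alpha>: "\<alpha> > -1"
  obtains C where "C > 0" "\<And>u G. (\<And>n. 0 \<le> u n) \<Longrightarrow>
    (\<And>m z. z \<in> shell m \<Longrightarrow> ennreal (norm (G z)) \<le>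
       (\<Sum>n. ennreal (2 powr (\<alpha> + 2) * u n * 2 powr ((\<alpha> + 2) * real (min n m))))) \<Longrightarrow>
    bergman_integral 1 \<alpha> G \<le> ennreal C * (\<Sum>n. ennreal ((real n + 1) * u n))"
proof -
  obtain C0 where C0: "C0 > 0" "\<And>q G c. (\<And>m z. z \<in> shell m \<Longrightarrow> ennreal (norm (G z) powr q) \<le> c m) \<Longrightarrow>
    bergman_integral q \<alpha> G \<le> ennreal C0 * (\<Sum>m. c m * ennreal (2 powr (- (real m * (\<alpha> + 2)))))"
    using bergman_integral_shell_bound[OF \<alpha>] by blast
  define b where "b = \<alpha> + 2"
  have b: "b > 1" using \<alpha> by (simp add: b_def)
  define S where "S = 2 / (1 - 2 powr (- b))"
  have S: "S > 0" using b by (simp add: S_def powr_less_one)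
  have T: "(\<Sum>m. ennreal (2 powr (b * real (min n m) - real m * b))) \<le> ennreal ((1 + S) * (real n + 1))" for n
  proof -
    have "(\<Sum>m. ennreal (2 powr (b * real (min n m) - real m * b)))
       \<le> (\<Sum>m. indicator {..n} m + ennreal (kernel b n m))"
    proof (intro suminf_le)
      fix m
      show "ennreal (2 powr (b * real (min n m) - real m * b)) \<le> indicator {..n} m + ennreal (kernel b n m)"
      proof (cases "m \<le> n")
        case True
        then show ?thesis by (simp add: mult.commute)
      next
        case False
        then have "b * real (min n m) - real m * b = - (b * real ((n - m) + (m - n)))"
          by (simp add: of_nat_diff algebra_simps)
        then show ?thesis by (simp add: kernel_def)
      qed
    qed auto
    also have "\<dots> = (\<Sum>m. indicator {..n} m) + (\<Sum>m. ennreal (kernel b n m))"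
      by (simp add: suminf_add)
    also have "\<dots> \<le> ennreal (real n + 1) + ennreal S"
    proof (rule add_mono)
      have "(\<Sum>m. indicator {..n} m :: ennreal) = (\<Sum>m\<le>n. indicator {..n} m)"
        by (intro suminf_finite) auto
      also have "\<dots> = ennreal (real n + 1)"
        by (simp add: ennreal_of_nat_eq_real_of_nat)
      finally show "(\<Sum>m. indicator {..n} m) \<le> ennreal (real n + 1)" by simp
      show "(\<Sum>m. ennreal (kernel b n m)) \<le> ennreal S"
        unfolding S_def using b by (intro kernel_sum) auto
    qed
    also have "\<dots> = ennreal (real n + 1 + S)" using S by simp
    also have "\<dots> \<le> ennreal ((1 + S) * (real n + 1))"
      using S by (intro ennreal_leI) (simp add: algebra_simps)
    finally show ?thesis .
  qed
  show ?thesis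
  proof (rule that)
    show "C0 * 2 powr b * (1 + S) > 0" using C0 S by simp
    fix u :: "nat \<Rightarrow> real" and G :: "complex \<Rightarrow> complex"
    assume u: "\<And>n. 0 \<le> u n"
    assume "\<And>m z. z \<in> shell m \<Longrightarrow> ennreal (norm (G z)) \<le>
       (\<Sum>n. ennreal (2 powr (\<alpha> + 2) * u n * 2 powr ((\<alpha> + 2) * real (min n m))))"
    then have "bergman_integral 1 \<alpha> G \<le> ennreal C0 * (\<Sum>m. (\<Sum>n. ennreal (2 powr b * u n * 2 powr (b * real (min n m)))) * ennreal (2 powr (- (real m * (\<alpha> + 2)))))"
      by (intro C0(2)) (auto simp: b_def)
    also have "(\<lambda>m. (\<Sum>n. ennreal (2 powr b * u n * 2 powr (b * real (min n m)))) * ennreal (2 powr (- (real m * (\<alpha> + 2)))))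
       = (\<lambda>m. \<Sum>n. ennreal (2 powr b * u n) * ennreal (2 powr (b * real (min n m) - real m * b)))"
    proof
      fix m
      have "ennreal (2 powr b * u n * 2 powr (b * real (min n m))) * ennreal (2 powr (- (real m * b)))
         = ennreal (2 powr b * u n) * ennreal (2 powr (b * real (min n m) - real m * b))" for n
        using u[of n] by (simp add: ennreal_mult''[symmetric] mult.assoc flip: powr_add)
      then show "(\<Sum>n. ennreal (2 powr b * u n * 2 powr (b * real (min n m)))) * ennreal (2 powr (- (real m * (\<alpha> + 2))))
        = (\<Sum>n. ennreal (2 powr b * u n) * ennreal (2 powr (b * real (min n m) - real m * b)))"
        by (simp add: b_def flip: ennreal_suminf_multc)
    qed
    finally have 1: "bergman_integral 1 \<alpha> G \<le> ennreal C0 * (\<Sum>m. \<Sum>n. ennreal (2 powr b * u n) * ennreal (2 powr (b * real (min n m) - real m * b)))" .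
    have "(\<Sum>m. \<Sum>n. ennreal (2 powr b * u n) * ennreal (2 powr (b * real (min n m) - real m * b)))
      = (\<Sum>n. ennreal (2 powr b * u n) * (\<Sum>m. ennreal (2 powr (b * real (min n m) - real m * b))))"
      by (subst suminf_swap_ennreal) simp
    also have "\<dots> \<le> (\<Sum>n. ennreal (2 powr b * u n) * ennreal ((1 + S) * (real n + 1)))"
      by (intro suminf_le mult_left_mono T) auto
    also have "\<dots> = (\<Sum>n. ennreal (2 powr b * (1 + S)) * ennreal ((real n + 1) * u n))"
      using u S by (simp add: ennreal_mult'[symmetric] mult_ac)
    also have "\<dots> = ennreal (2 powr b * (1 + S)) * (\<Sum>n. ennreal ((real n + 1) * u n))" by simp
    finally have "(\<Sum>m. \<Sum>n. ennreal (2 powr b * u n) * ennreal (2 powr (b * real (min n m) - real m * b)))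
      \<le> ennreal (2 powr b * (1 + S)) * (\<Sum>n. ennreal ((real n + 1) * u n))" .
    with 1 have "bergman_integral 1 \<alpha> G \<le> ennreal C0 * (ennreal (2 powr b * (1 + S)) * (\<Sum>n. ennreal ((real n + 1) * u n)))"
      by (rule order_trans[OF _ mult_left_mono]) auto
    also have "\<dots> = ennreal (C0 * 2 powr b * (1 + S)) * (\<Sum>n. ennreal ((real n + 1) * u n))"
      using C0(1) S by (simp add: ennreal_mult'[symmetric] mult.assoc[symmetric])
    finally show "bergman_integral 1 \<alpha> G \<le> ennreal (C0 * 2 powr b * (1 + S)) * (\<Sum>n. ennreal ((real n + 1) * u n))" .
  qed
qed

section \<open>The binomial series and lower bounds for |1 - t z|\<close>

definition binom_coeff :: "real \<Rightarrow> nat \<Rightarrow> real" where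
  "binom_coeff \<beta> n = Gamma (real n + \<beta>) / (fact n * Gamma \<beta>)"

lemma binom_coeff_nonneg: "\<beta> > 0 \<Longrightarrow> 0 \<le> binom_coeff \<beta> n"
  by (simp add: binom_coeff_def Gamma_real_nonneg)

text \<open>The Gamma quotient is the rising factorial of \<beta> divided by n!, which is the
  generalised binomial coefficient of -\<beta> up to the sign (-1)^n. This is how the factors in
  \<open>mu_coeff\<close> assemble to the kernel.\<close>

lemma binom_coeff_sums:
  assumes "\<beta> > 0" "norm (w::complex) < 1"
  shows "(\<lambda>n. of_real (binom_coeff \<beta> n) * w ^ n) sums (1 - w) powr (- of_real \<beta>)"
proof -
  have "(\<lambda>n. ((- of_real \<beta>) gchoose n) * (- w) ^ n) sums (1 + (- w)) powr (- of_real \<beta>)"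
    using assms by (intro gen_binomial_complex) auto
  moreover have "((- of_real \<beta>) gchoose n) * (- w) ^ n = of_real (binom_coeff \<beta> n) * w ^ n" for n
  proof -
    have "\<beta> \<notin> \<int>\<^sub>\<le>\<^sub>0" using assms by auto
    then have "binom_coeff \<beta> n = pochhammer \<beta> n / fact n"
      by (simp add: pochhammer_Gamma binom_coeff_def add.commute)
    then have "complex_of_real (binom_coeff \<beta> n) = pochhammer (of_real \<beta>) n / fact n"
      by (simp add: pochhammer_of_real)
    moreover have "(- w) ^ n = (-1) ^ n * w ^ n" by (simp add: power_minus')
    ultimately show ?thesis
      by (simp add: gbinomial_pochhammer power_mult_distrib[symmetric])
  qed
  ultimately show ?thesis by simp
qed

lemma binom_coeff_summable:
  assumes "\<beta> > 0" "0 \<le> r" "r < 1"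
  shows "summable (\<lambda>n. binom_coeff \<beta> n * r ^ n)"
proof -
  have "summable (\<lambda>n. complex_of_real (binom_coeff \<beta> n) * of_real r ^ n)"
    using binom_coeff_sums[of \<beta> "of_real r"] assms by (auto simp: sums_iff)
  then have "summable (\<lambda>n. complex_of_real (binom_coeff \<beta> n * r ^ n))" by simp
  then show ?thesis by (simp only: summable_of_real_iff)
qed

text \<open>First, |1 - t z| \<ge> 1 - t. Second, |1 - z| \<le> |1 - t z| + (1 - t)|z|, and by the
  first bound the right side is at most 2 |1 - t z|. The two bounds give the index n and the index m
  respectively.\<close>

lemma kernel_lower_bound:
  assumes t: "t \<in> dyadic_interval n" and z: "z \<in> shell m"
  shows "norm (1 - of_real t * z) \<ge> (1/2) ^ Suc (min n m)"
proof -
  note tt = dyadic_interval_props[OF t]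
  have nz: "norm z < 1" "(1/2) ^ m \<le> norm (1 - z)" using z by (auto simp: shell_def)
  have ntz: "norm (of_real t * z) \<le> t" using tt nz by (simp add: norm_mult mult_left_le)
  have 1: "1 - t \<le> norm (1 - of_real t * z)"
    using norm_triangle_ineq2[of 1 "of_real t * z"] ntz by simp
  have "norm (1 - z) \<le> norm (1 - of_real t * z) + norm (of_real t * z - z)"
    using norm_triangle_ineq[of "1 - of_real t * z" "of_real t * z - z"] by simp
  also have "of_real t * z - z = - (of_real (1 - t) * z)" by (simp add: algebra_simps)
  also have "norm (- (of_real (1 - t) * z)) = (1 - t) * norm z"
    unfolding norm_minus_cancel norm_mult norm_of_real using tt by simp
  also have "(1 - t) * norm z \<le> 1 - t" using tt nz by (simp add: mult_left_le)
  finally have "norm (1 - z) \<le> 2 * norm (1 - of_real t * z)" using 1 by simp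
  then have "(1/2) ^ Suc m \<le> norm (1 - of_real t * z)" using nz(2) by simp
  moreover have "(1/2) ^ Suc n \<le> norm (1 - of_real t * z)" using 1 tt by linarith
  ultimately show ?thesis by (auto simp: min_def)
qed

lemma kernel_powr_bound:
  assumes "t \<in> dyadic_interval n" "z \<in> shell m" "\<beta> > 0"
  shows "norm (1 - of_real t * z) powr (- \<beta>) \<le> 2 powr \<beta> * 2 powr (\<beta> * real (min n m))"
proof -
  have "norm (1 - of_real t * z) powr (- \<beta>) \<le> ((1/2) ^ Suc (min n m)) powr (- \<beta>)"
    by (rule powr_mono2') (use kernel_lower_bound[OF assms(1,2)] assms(3) in auto)
  also have "\<dots> = 2 powr (\<beta> * real (Suc (min n m)))"
  proof -
    have "(2 powr (- real k)) powr (- \<beta>) = 2 powr (\<beta> * real k)" for k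
      by (simp add: powr_powr mult.commute)
    then show ?thesis unfolding half_power_powr .
  qed
  also have "\<dots> = 2 powr \<beta> * 2 powr (\<beta> * real (min n m))"
    by (simp add: powr_add[symmetric] algebra_simps)
  finally show ?thesis .
qed

lemma taylor_sums:
  assumes "f holomorphic_on ball 0 r" "norm w < r"
  shows "(\<lambda>k. taylor_coeff f k * w ^ k) sums f w"
  using holomorphic_power_series[OF assms(1), of w] assms(2) by (simp add: taylor_coeff_def)

lemma taylor_abs_summable:
  assumes "f holomorphic_on ball 0 r" "0 \<le> t" "t < r"
  shows "summable (\<lambda>k. norm (taylor_coeff f k) * t ^ k)"
proof -
  have "norm (complex_of_real ((t + r) / 2)) < r" unfolding norm_of_real using assms by simp
  then have "summable (\<lambda>k. taylor_coeff f k * of_real ((t + r) / 2) ^ k)"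
    by (intro sums_summable[OF taylor_sums[OF assms(1)]])
  then have "summable (\<lambda>k. norm (taylor_coeff f k * of_real t ^ k))"
  proof (rule powser_insidea)
    show "norm (complex_of_real t) < norm (complex_of_real ((t + r) / 2))"
      unfolding norm_of_real using assms by simp
  qed
  then show ?thesis using assms by (simp add: norm_mult norm_power)
qed

section \<open>The operator as an integral against the measure\<close>

locale interval_measure = finite_measure \<mu> for \<mu> :: "real measure" +
  assumes sets_mu [measurable_cong, simp]: "sets \<mu> = sets borel"
begin

abbreviation mass :: "nat \<Rightarrow> real" where
  "mass n \<equiv> measure \<mu> (half_open_dyadic n)"

abbreviation tail :: "nat \<Rightarrow> real" where
  "tail n \<equiv> measure \<mu> {1 - (1/2) ^ n..<1}"

text \<open>For m \<le> n this is, up to constants, a lower bound for the q-th power of the image of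
  the n-th test function at 1 - 2^-m, multiplied by the order 2^(-m(\<alpha>+2)) of the weighted
  area of a small disc about that point.\<close>

abbreviation test_term :: "real \<Rightarrow> real \<Rightarrow> real \<Rightarrow> nat \<Rightarrow> nat \<Rightarrow> real" where
  "test_term p \<alpha> q n m \<equiv> 2 powr (- (real m * (\<alpha> + 2)))
     * (2 powr (real n * ((\<alpha> + 2) / p)) * 2 powr (real m * (\<alpha> + 2)) * tail n) powr q"

text \<open>This is the Fubini condition that allows the sum over k to be exchanged with the
  integral. It implies convergence of all sums occurring in the definition of the operator.\<close>

definition coeff_summable :: "(complex \<Rightarrow> complex) \<Rightarrow> bool" where
  "coeff_summable f \<longleftrightarrow>
     f holomorphic_on ball 0 1 \<and>
     (\<integral>\<^sup>+t\<in>{0..<1}. (\<Sum>k. ennreal (norm (taylor_coeff f k) * t ^ k)) \<partial>\<mu>) < \<infinity>"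

lemma restrict_bounded_integrable:
  fixes g :: "real \<Rightarrow> complex"
  assumes "continuous_on {0..<1} g" "\<And>t. 0 \<le> t \<Longrightarrow> t < 1 \<Longrightarrow> norm (g t) \<le> B"
  shows "integrable \<mu> (\<lambda>t. indicator {0..<1} t *\<^sub>R g t)"
proof (rule integrable_const_bound)
  show "(\<lambda>t. indicator {0..<1} t *\<^sub>R g t) \<in> borel_measurable \<mu>"
    using borel_measurable_continuous_on_indicator[OF _ assms(1)] by simp
  show "AE t in \<mu>. norm (indicator {0..<1} t *\<^sub>R g t) \<le> max B 0"
    using assms(2) by (auto simp: indicator_def le_max_iff_disj)
qed

text \<open>Termwise integration of the Taylor series of f multiplied by t^n. Because t^n \<le> 1,
  the condition \<open>coeff_summable\<close> dominates the terms for all n simultaneously.\<close>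

lemma moment_series:
  assumes f: "coeff_summable f"
  shows "summable (\<lambda>k. (LINT t:{0..<1}|\<mu>. of_real (t ^ (n + k)) :: complex) * taylor_coeff f k)"
    and "(\<Sum>k. (LINT t:{0..<1}|\<mu>. of_real (t ^ (n + k))) * taylor_coeff f k)
      = (LINT t:{0..<1}|\<mu>. of_real t ^ n * f (of_real t))"
    and "set_integrable \<mu> {0..<1} (\<lambda>t. of_real t ^ n * f (of_real t))"
proof -
  have hol: "f holomorphic_on ball 0 1" using f by (simp add: coeff_summable_def)
  define F where "F = (\<lambda>k t. indicator {0..<1} t *\<^sub>R (of_real (t ^ (n + k)) * taylor_coeff f k))"
  have intF: "integrable \<mu> (F k)" for k
    unfolding F_def
  proof (rule restrict_bounded_integrable)
    show "continuous_on {0..<1} (\<lambda>t. complex_of_real (t ^ (n + k)) * taylor_coeff f k)"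
      by (intro continuous_intros)
    show "norm (complex_of_real (t ^ (n + k)) * taylor_coeff f k) \<le> norm (taylor_coeff f k)" if "0 \<le> t" "t < 1" for t
      using that by (simp add: norm_mult norm_power mult_left_le_one_le power_le_one)
  qed
  have normF: "norm (F k t) \<le> indicator {0..<1} t * (norm (taylor_coeff f k) * t ^ k)" for k t
    by (auto simp: F_def indicator_def norm_mult norm_power power_add mult_ac
        intro!: mult_left_mono mult_left_le_one_le power_le_one)
  have sumF: "(\<lambda>k. F k t) sums (indicator {0..<1} t *\<^sub>R (of_real t ^ n * f (of_real t)))" for t
  proof (cases "t \<in> {0..<1}")
    case True
    then have "(\<lambda>k. of_real t ^ n * (taylor_coeff f k * of_real t ^ k)) sums (of_real t ^ n * f (of_real t))"
      by (intro sums_mult taylor_sums[OF hol]) auto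
    then show ?thesis using True by (simp add: F_def power_add mult_ac)
  qed (simp add: F_def)
  have s1: "AE t in \<mu>. summable (\<lambda>k. norm (F k t))"
  proof (rule AE_I2)
    fix t
    show "summable (\<lambda>k. norm (F k t))"
    proof (cases "t \<in> {0..<1}")
      case True
      then have "summable (\<lambda>k. norm (taylor_coeff f k) * t ^ k)"
        by (intro taylor_abs_summable[OF hol]) auto
      then show ?thesis
        by (rule summable_comparison_test') (use normF[of _ t] True in auto)
    qed (simp add: F_def)
  qed
  have s2: "summable (\<lambda>k. LINT t|\<mu>. norm (F k t))"
  proof (rule summable_suminf_not_top)
    have "(\<Sum>k. ennreal (LINT t|\<mu>. norm (F k t))) = (\<Sum>k. \<integral>\<^sup>+t. ennreal (norm (F k t)) \<partial>\<mu>)"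
      using intF by (intro suminf_cong nn_integral_eq_integral[symmetric]) auto
    also have "\<dots> = (\<integral>\<^sup>+t. (\<Sum>k. ennreal (norm (F k t))) \<partial>\<mu>)"
      using intF by (intro nn_integral_suminf[symmetric]) (auto simp: borel_measurable_integrable)
    also have "\<dots> \<le> (\<integral>\<^sup>+t\<in>{0..<1}. (\<Sum>k. ennreal (norm (taylor_coeff f k) * t ^ k)) \<partial>\<mu>)"
    proof (rule nn_integral_mono, goal_cases)
      case (1 t)
      show ?case
      proof (cases "t \<in> {0..<1}")
        case True
        then show ?thesis using normF[of _ t] by (auto intro!: suminf_le ennreal_leI)
      qed (simp add: F_def)
    qed
    also have "\<dots> < \<infinity>" using f by (simp add: coeff_summable_def)
    finally show "(\<Sum>k. ennreal (LINT t|\<mu>. norm (F k t))) \<noteq> top" by simp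
  qed simp
  have "(\<lambda>k. integral\<^sup>L \<mu> (F k)) sums (\<integral>t. (\<Sum>k. F k t) \<partial>\<mu>)"
    by (rule sums_integral[OF intF s1 s2])
  moreover have "(\<lambda>t. \<Sum>k. F k t) = (\<lambda>t. indicator {0..<1} t *\<^sub>R (of_real t ^ n * f (of_real t)))"
    using sumF by (auto simp: sums_iff)
  moreover have "integral\<^sup>L \<mu> (F k) = (LINT t:{0..<1}|\<mu>. of_real (t ^ (n + k))) * taylor_coeff f k" for k
    unfolding F_def set_lebesgue_integral_def by (simp flip: mult_scaleR_left)
  ultimately have "(\<lambda>k. (LINT t:{0..<1}|\<mu>. of_real (t ^ (n + k))) * taylor_coeff f k) sums
      (LINT t:{0..<1}|\<mu>. of_real t ^ n * f (of_real t))"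
    by (simp add: set_lebesgue_integral_def)
  then show "summable (\<lambda>k. (LINT t:{0..<1}|\<mu>. of_real (t ^ (n + k)) :: complex) * taylor_coeff f k)"
    "(\<Sum>k. (LINT t:{0..<1}|\<mu>. of_real (t ^ (n + k))) * taylor_coeff f k)
      = (LINT t:{0..<1}|\<mu>. of_real t ^ n * f (of_real t))"
    by (auto simp: sums_iff)
  show "set_integrable \<mu> {0..<1} (\<lambda>t. of_real t ^ n * f (of_real t))"
    using integrable_suminf[OF intF s1 s2] sumF by (simp add: set_integrable_def sums_iff)
qed

lemma mu_coeff_eq:
  "complex_of_real (mu_coeff \<mu> \<beta> n k) = of_real (binom_coeff \<beta> n) * (LINT t:{0..<1}|\<mu>. of_real (t ^ (n + k)))"
proof -
  have "(LINT t:{0..<1}|\<mu>. complex_of_real (t ^ (n + k))) = of_real (LINT t:{0..<1}|\<mu>. t ^ (n + k))"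
    unfolding set_lebesgue_integral_def
    by (subst integral_complex_of_real[symmetric]) (simp add: scaleR_conv_of_real)
  then show ?thesis by (simp add: mu_coeff_def binom_coeff_def)
qed

lemma H_coeff_eq:
  assumes f: "coeff_summable f"
  shows "summable (\<lambda>k. of_real (mu_coeff \<mu> \<beta> n k) * taylor_coeff f k)"
    and "H_coeff \<mu> \<beta> f n = of_real (binom_coeff \<beta> n) * (LINT t:{0..<1}|\<mu>. of_real t ^ n * f (of_real t))"
proof -
  show "summable (\<lambda>k. of_real (mu_coeff \<mu> \<beta> n k) * taylor_coeff f k)"
    unfolding mu_coeff_eq mult.assoc by (intro summable_mult moment_series(1)[OF f])
  show "H_coeff \<mu> \<beta> f n = of_real (binom_coeff \<beta> n) * (LINT t:{0..<1}|\<mu>. of_real t ^ n * f (of_real t))"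
    unfolding H_coeff_def mu_coeff_eq mult.assoc moment_series(2)[OF f, symmetric]
    by (intro suminf_mult moment_series(1)[OF f])
qed

text \<open>A second exchange, now of the sum over n with the integral. For fixed z in the disc the
  n-th term is at most |f(t)| times the n-th term of the binomial series at |z|, and f is
  \<mu>-integrable on [0,1) by the moment formula with n = 0.\<close>

lemma H_op_sums:
  assumes f: "coeff_summable f" and \<beta>: "\<beta> > 0" and z: "norm z < 1"
  shows "(\<lambda>n. H_coeff \<mu> \<beta> f n * z ^ n) sums (LINT t:{0..<1}|\<mu>. f (of_real t) * (1 - of_real t * z) powr (- of_real \<beta>))"
    and "set_integrable \<mu> {0..<1} (\<lambda>t. f (of_real t) * (1 - of_real t * z) powr (- of_real \<beta>))"
proof -
  define F where "F = (\<lambda>n t. indicator {0..<1} t *\<^sub>R (of_real t ^ n * f (of_real t)) * (of_real (binom_coeff \<beta> n) * z ^ n))"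
  have if0: "integrable \<mu> (\<lambda>t. indicator {0..<1} t *\<^sub>R (of_real t ^ n * f (of_real t)))" for n
    using moment_series(3)[OF f, of n] by (simp add: set_integrable_def)
  have intF: "integrable \<mu> (F n)" for n
    unfolding F_def by (intro integrable_mult_left if0)
  have if1: "integrable \<mu> (\<lambda>t. norm (indicator {0..<1} t *\<^sub>R f (of_real t)))"
    using if0[of 0] by (intro integrable_norm) simp
  have normF: "norm (F n t) \<le> norm (indicator {0..<1} t *\<^sub>R f (of_real t)) * (binom_coeff \<beta> n * norm z ^ n)" for n t
  proof (cases "t \<in> {0..<1}")
    case True
    then have "t ^ n * norm (f (of_real t)) \<le> norm (f (of_real t))"
      by (intro mult_left_le_one_le) (auto simp: power_le_one)
    then have "(t ^ n * norm (f (of_real t))) * (binom_coeff \<beta> n * norm z ^ n) \<le> norm (f (of_real t)) * (binom_coeff \<beta> n * norm z ^ n)"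
      using binom_coeff_nonneg[OF \<beta>, of n] by (intro mult_right_mono) auto
    then show ?thesis using True binom_coeff_nonneg[OF \<beta>, of n] by (simp add: F_def norm_mult norm_power)
  qed (simp add: F_def)
  have sm: "summable (\<lambda>n. binom_coeff \<beta> n * norm z ^ n)"
    using binom_coeff_summable[OF \<beta>, of "norm z"] z by simp
  have s1: "AE t in \<mu>. summable (\<lambda>n. norm (F n t))"
    by (intro AE_I2 summable_comparison_test'[OF summable_mult[OF sm]]) (use normF in auto)
  have s2: "summable (\<lambda>n. LINT t|\<mu>. norm (F n t))"
  proof (rule summable_comparison_test'[OF summable_mult[OF sm]])
    fix n :: nat
    have "(LINT t|\<mu>. norm (F n t)) \<le> (LINT t|\<mu>. norm (indicator {0..<1} t *\<^sub>R f (of_real t)) * (binom_coeff \<beta> n * norm z ^ n))"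
      by (intro integral_mono integrable_norm intF integrable_mult_left if1 normF)
    then show "norm (LINT t|\<mu>. norm (F n t)) \<le> (LINT t|\<mu>. norm (indicator {0..<1} t *\<^sub>R f (of_real t))) * (binom_coeff \<beta> n * norm z ^ n)"
      by simp
  qed
  have sumF: "(\<lambda>n. F n t) sums (indicator {0..<1} t *\<^sub>R (f (of_real t) * (1 - of_real t * z) powr (- of_real \<beta>)))" for t
  proof (cases "t \<in> {0..<1}")
    case True
    have "norm (of_real t * z) < 1"
      using True z mult_left_le_one_le[of "norm z" t] by (simp add: norm_mult)
    then have "(\<lambda>n. f (of_real t) * (of_real (binom_coeff \<beta> n) * (of_real t * z) ^ n)) sums (f (of_real t) * (1 - of_real t * z) powr (- of_real \<beta>))"
      by (intro sums_mult binom_coeff_sums[OF \<beta>])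
    then show ?thesis using True by (simp add: F_def power_mult_distrib mult_ac)
  qed (simp add: F_def)
  have "(\<lambda>n. integral\<^sup>L \<mu> (F n)) sums (\<integral>t. (\<Sum>n. F n t) \<partial>\<mu>)"
    by (rule sums_integral[OF intF s1 s2])
  moreover have "(\<lambda>t. \<Sum>n. F n t) = (\<lambda>t. indicator {0..<1} t *\<^sub>R (f (of_real t) * (1 - of_real t * z) powr (- of_real \<beta>)))"
    using sumF by (auto simp: sums_iff)
  moreover have "integral\<^sup>L \<mu> (F n) = H_coeff \<mu> \<beta> f n * z ^ n" for n
    unfolding F_def H_coeff_eq(2)[OF f] set_lebesgue_integral_def
    by (subst integral_mult_left_zero) (simp only: mult_ac)
  ultimately show "(\<lambda>n. H_coeff \<mu> \<beta> f n * z ^ n) sums (LINT t:{0..<1}|\<mu>. f (of_real t) * (1 - of_real t * z) powr (- of_real \<beta>))"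
    by (simp add: set_lebesgue_integral_def)
  show "set_integrable \<mu> {0..<1} (\<lambda>t. f (of_real t) * (1 - of_real t * z) powr (- of_real \<beta>))"
    using integrable_suminf[OF intF s1 s2] sumF by (simp add: set_integrable_def sums_iff)
qed

lemma H_op_eq:
  assumes "coeff_summable f" "\<beta> > 0" "norm z < 1"
  shows "H_op \<mu> \<beta> f z = (LINT t:{0..<1}|\<mu>. f (of_real t) * (1 - of_real t * z) powr (- of_real \<beta>))"
  using H_op_sums(1)[OF assms] by (simp add: H_op_def sums_iff)

lemma H_defined:
  assumes "coeff_summable f" "\<beta> > 0"
  shows "H_defined \<mu> \<beta> f"
  using H_op_sums(1)[OF assms] H_coeff_eq(1)[OF assms(1)] by (auto simp: H_defined_def sums_iff)

lemma H_op_holomorphic: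
  assumes "coeff_summable f" "\<beta> > 0"
  shows "H_op \<mu> \<beta> f holomorphic_on ball 0 1"
proof (rule power_series_holomorphic)
  fix w :: complex assume "w \<in> ball 0 1"
  then show "(\<lambda>n. H_coeff \<mu> \<beta> f n * (w - 0) ^ n) sums H_op \<mu> \<beta> f w"
    using H_op_sums(1)[OF assms, of w] H_op_eq[OF assms, of w] by simp
qed

lemma H_op_diff:
  assumes "coeff_summable f" "coeff_summable g" "coeff_summable (\<lambda>z. f z - g z)" "\<beta> > 0" "norm z < 1"
  shows "H_op \<mu> \<beta> f z - H_op \<mu> \<beta> g z = H_op \<mu> \<beta> (\<lambda>z. f z - g z) z"
proof -
  have "H_op \<mu> \<beta> f z - H_op \<mu> \<beta> g z
     = (LINT t:{0..<1}|\<mu>. f (of_real t) * (1 - of_real t * z) powr (- of_real \<beta>) - g (of_real t) * (1 - of_real t * z) powr (- of_real \<beta>))"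
    using assms by (simp add: H_op_eq set_integral_diff(2) H_op_sums(2))
  also have "\<dots> = H_op \<mu> \<beta> (\<lambda>z. f z - g z) z"
    using assms by (simp add: H_op_eq left_diff_distrib)
  finally show ?thesis .
qed

lemma norm_H_op_le:
  assumes "coeff_summable f" "\<beta> > 0" "norm z < 1"
  shows "ennreal (norm (H_op \<mu> \<beta> f z)) \<le> (\<integral>\<^sup>+t\<in>{0..<1}. ennreal (norm (f (of_real t)) * norm (1 - of_real t * z) powr (- \<beta>)) \<partial>\<mu>)"
proof -
  have "ennreal (norm (H_op \<mu> \<beta> f z)) \<le> (\<integral>\<^sup>+t. ennreal (norm (indicator {0..<1} t *\<^sub>R (f (of_real t) * (1 - of_real t * z) powr (- of_real \<beta>)))) \<partial>\<mu>)"
    unfolding H_op_eq[OF assms] set_lebesgue_integral_def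
    using H_op_sums(2)[OF assms] by (intro integral_norm_bound_ennreal) (simp add: set_integrable_def)
  also have "\<dots> = (\<integral>\<^sup>+t\<in>{0..<1}. ennreal (norm (f (of_real t)) * norm (1 - of_real t * z) powr (- \<beta>)) \<partial>\<mu>)"
    by (intro nn_integral_cong) (auto simp: indicator_def norm_mult norm_powr_real_powr')
  finally show ?thesis .
qed

lemma nn_integral_dyadic_le:
  fixes g :: "real \<Rightarrow> ennreal"
  assumes "\<And>n t. t \<in> half_open_dyadic n \<Longrightarrow> g t \<le> c n"
  shows "(\<integral>\<^sup>+t\<in>{0..<1}. g t \<partial>\<mu>) \<le> (\<Sum>n. c n * ennreal (mass n))"
proof -
  have "(\<integral>\<^sup>+t\<in>{0..<1}. g t \<partial>\<mu>) \<le> (\<integral>\<^sup>+t. (\<Sum>n. c n * indicator (half_open_dyadic n) t) \<partial>\<mu>)"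
  proof (rule nn_integral_mono, goal_cases)
    case (1 t)
    show ?case
    proof (cases "t \<in> {0..<1}")
      case True
      then obtain n where n: "t \<in> half_open_dyadic n" using half_open_dyadic_exists[of t] by auto
      have "g t \<le> (\<Sum>k\<in>{n}. c k * indicator (half_open_dyadic k) t)" using assms[OF n] n by simp
      also have "\<dots> \<le> (\<Sum>n. c n * indicator (half_open_dyadic n) t)" by (intro sum_le_suminf) auto
      finally show ?thesis using True by simp
    qed simp
  qed
  also have "\<dots> = (\<Sum>n. \<integral>\<^sup>+t. c n * indicator (half_open_dyadic n) t \<partial>\<mu>)"
    by (intro nn_integral_suminf borel_measurable_times_ennreal borel_measurable_indicator) auto
  also have "\<dots> = (\<Sum>n. c n * ennreal (mass n))"
    by (intro suminf_cong) (simp add: nn_integral_cmult_indicator emeasure_eq_measure)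
  finally show ?thesis .
qed

lemma norm_H_op_shell:
  assumes f: "coeff_summable f" and \<beta>: "\<beta> > 0" and z: "z \<in> shell m"
    and x: "\<And>n t. t \<in> dyadic_interval n \<Longrightarrow> norm (f (of_real t)) \<le> y n"
  shows "ennreal (norm (H_op \<mu> \<beta> f z))
    \<le> (\<Sum>n. ennreal (2 powr \<beta> * (y n * mass n) * 2 powr (\<beta> * real (min n m))))"
proof -
  have y0: "0 \<le> y n" for n
    using x[of "1 - (1/2)^n" n] by (auto simp: dyadic_interval_def intro: order_trans[OF norm_ge_zero])
  have "ennreal (norm (H_op \<mu> \<beta> f z)) \<le> (\<integral>\<^sup>+t\<in>{0..<1}. ennreal (norm (f (of_real t)) * norm (1 - of_real t * z) powr (- \<beta>)) \<partial>\<mu>)"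
    using z by (intro norm_H_op_le f \<beta>) (auto simp: shell_def)
  also have "\<dots> \<le> (\<Sum>n. ennreal (y n * (2 powr \<beta> * 2 powr (\<beta> * real (min n m)))) * ennreal (mass n))"
  proof (rule nn_integral_dyadic_le)
    fix n t assume "t \<in> half_open_dyadic n"
    then have t: "t \<in> dyadic_interval n" using half_open_dyadic_subset by blast
    show "ennreal (norm (f (of_real t)) * norm (1 - of_real t * z) powr (- \<beta>)) \<le> ennreal (y n * (2 powr \<beta> * 2 powr (\<beta> * real (min n m))))"
      using x[OF t] kernel_powr_bound[OF t z \<beta>] by (intro ennreal_leI mult_mono) (auto simp: y0)
  qed
  also have "\<dots> = (\<Sum>n. ennreal (2 powr \<beta> * (y n * mass n) * 2 powr (\<beta> * real (min n m))))"
    by (intro suminf_cong, subst ennreal_mult''[symmetric]) (simp_all add: mult_ac)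
  finally show ?thesis .
qed

end

section \<open>Absolute convergence of the coefficient sums\<close>

lemma emeasure_layer:
  "emeasure lborel (layer j) = ennreal (pi * ((1/2) ^ j - 3/4 * ((1/2) ^ j)\<^sup>2))"
proof -
  define h :: real where "h = (1/2) ^ j"
  have h: "0 < h" "h \<le> 1" by (auto simp: h_def power_le_one)
  have "layer j = ball 0 (1 - h/2) - ball 0 (1 - h)"
    by (auto simp: layer_def h_def)
  then have "emeasure lborel (layer j) = emeasure lborel (ball (0::complex) (1 - h/2)) - emeasure lborel (ball (0::complex) (1 - h))"
    using h by (simp add: emeasure_Diff emeasure_complex_ball subset_ball)
  also have "\<dots> = ennreal (pi * (1 - h/2)\<^sup>2 - pi * (1 - h)\<^sup>2)"
    using h by (subst (1 2) emeasure_complex_ball) (auto simp: ennreal_minus)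
  also have "pi * (1 - h/2)\<^sup>2 - pi * (1 - h)\<^sup>2 = pi * (h - 3/4 * h\<^sup>2)"
    by (simp add: power2_eq_square field_simps)
  finally show ?thesis by (simp add: h_def)
qed

lemma emeasure_layer_bounds:
  "ennreal ((1/2) ^ j / 2) \<le> emeasure lborel (layer j)" "emeasure lborel (layer j) \<le> ennreal (4 * (1/2) ^ j)"
proof -
  define h :: real where "h = (1/2) ^ j"
  have h: "0 < h" "h \<le> 1" by (auto simp: h_def power_le_one)
  have hh: "h\<^sup>2 \<le> h" using h by (simp add: power2_eq_square mult_left_le)
  have "h / 2 \<le> 2 * (h / 4)" by simp
  also have "\<dots> \<le> pi * (h - 3/4 * h\<^sup>2)"
    using hh h pi_ge_two by (intro mult_mono) auto
  finally show "ennreal ((1/2) ^ j / 2) \<le> emeasure lborel (layer j)"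
    unfolding emeasure_layer h_def by (rule ennreal_leI)
  have "pi * (h - 3/4 * h\<^sup>2) \<le> 4 * h"
  proof (rule mult_mono)
    show "h - 3/4 * h\<^sup>2 \<le> h" using zero_le_power2[of h] by linarith
    show "0 \<le> h - 3/4 * h\<^sup>2" using hh h by linarith
  qed (use pi_less_4 in auto)
  then show "emeasure lborel (layer j) \<le> ennreal (4 * (1/2) ^ j)"
    unfolding emeasure_layer h_def by (rule ennreal_leI)
qed

lemma layer_subset: "layer n \<subseteq> ball 0 1"
proof
  fix z assume "z \<in> layer n"
  then have "(1/2) ^ Suc n < 1 - norm z" by (simp add: layer_def)
  moreover have "(0::real) < (1/2) ^ Suc n" by simp
  ultimately have "norm z < 1" by linarith
  then show "z \<in> ball 0 1" by simp
qed

text \<open>On the layer |z| is at least 1 - 2^-j, so the area bound for coefficients applies with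
  this radius; the factor 2 * 2^j is the reciprocal of the lower bound for the area of the
  layer.\<close>

lemma taylor_coeff_layer_bound:
  assumes f: "f holomorphic_on ball 0 1"
  shows "ennreal (norm (taylor_coeff f k) * (1 - (1/2) ^ j) ^ k)
    \<le> ennreal (2 * 2 ^ j) * (\<integral>\<^sup>+z\<in>layer j. ennreal (norm (f z)) \<partial>lborel)"
proof -
  define A where "A = norm (taylor_coeff f k) * (1 - (1/2) ^ j) ^ k"
  have h1: "(1/2::real) ^ j \<le> 1" by (simp add: power_le_one)
  have A: "A \<ge> 0" using h1 by (simp add: A_def)
  have "ennreal A * ennreal ((1/2) ^ j / 2) \<le> ennreal A * emeasure lborel (layer j)"
    by (intro mult_left_mono emeasure_layer_bounds) auto
  also have "\<dots> = (\<integral>\<^sup>+z\<in>layer j. ennreal A \<partial>lborel)"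
    by (simp add: nn_integral_cmult_indicator)
  also have "\<dots> \<le> (\<integral>\<^sup>+z\<in>layer j. ennreal (norm (taylor_coeff f k) * norm z ^ k) \<partial>lborel)"
    by (intro nn_integral_mono)
      (use h1 in \<open>auto simp: A_def layer_def indicator_def intro!: ennreal_leI mult_left_mono power_mono\<close>)
  also have "\<dots> \<le> (\<integral>\<^sup>+z\<in>layer j. ennreal (norm (f z)) \<partial>lborel)"
  proof (rule taylor_coeff_area_bound[OF f])
    show "layer j \<subseteq> ball 0 1" by (rule layer_subset)
  qed (auto simp: layer_def norm_mult)
  finally have *: "ennreal A * ennreal ((1/2) ^ j / 2) \<le> (\<integral>\<^sup>+z\<in>layer j. ennreal (norm (f z)) \<partial>lborel)" .
  have "A = 2 * 2 ^ j * (A * ((1/2) ^ j / 2))" by (simp add: power_one_over)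
  then have "ennreal A = ennreal (2 * 2 ^ j * (A * ((1/2) ^ j / 2)))" by (rule arg_cong)
  also have "\<dots> = ennreal (2 * 2 ^ j) * (ennreal A * ennreal ((1/2) ^ j / 2))"
    using A by (simp only: ennreal_mult' mult_nonneg_nonneg zero_le_power zero_le_numeral)
  also have "\<dots> \<le> ennreal (2 * 2 ^ j) * (\<integral>\<^sup>+z\<in>layer j. ennreal (norm (f z)) \<partial>lborel)"
    by (intro mult_left_mono *) auto
  finally show ?thesis by (simp add: A_def)
qed

text \<open>With h = 2^-(n+2), points of the n-th interval satisfy t < 1 - 2h, hence t \<le>
  (1-h)^2. One factor (1-h)^k goes into the coefficient bound on layer n+2; the other makes the sum
  over k geometric with value 1/h.\<close>

lemma taylor_abs_series_bound:
  assumes f: "f holomorphic_on ball 0 1" and t: "t \<in> half_open_dyadic n"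
  shows "(\<Sum>k. ennreal (norm (taylor_coeff f k) * t ^ k))
    \<le> ennreal (32 * 4 ^ n) * (\<integral>\<^sup>+z\<in>layer (n + 2). ennreal (norm (f z)) \<partial>lborel)"
proof -
  define J where "J = (\<integral>\<^sup>+z\<in>layer (n + 2). ennreal (norm (f z)) \<partial>lborel)"
  define h :: real where "h = (1/2) ^ (n + 2)"
  have h: "0 < h" "h \<le> 1" unfolding h_def by (simp, intro power_le_one) auto
  have "t < 1 - 2 * h" using t by (simp add: half_open_dyadic_def h_def)
  then have t2: "t \<le> (1 - h) * (1 - h)" by (simp add: algebra_simps add_increasing2)
  have t0: "0 \<le> t" using dyadic_interval_props(1)[of t n] t half_open_dyadic_subset by blast
  have "(\<Sum>k. ennreal (norm (taylor_coeff f k) * t ^ k)) \<le> (\<Sum>k. (ennreal (2 * 2 ^ (n + 2)) * J) * ennreal ((1 - h) ^ k))"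
  proof (intro suminf_le)
    fix k
    have "t ^ k \<le> (1 - h) ^ k * (1 - h) ^ k"
      using power_mono[OF t2 t0, of k] by (simp add: power_mult_distrib)
    then have "norm (taylor_coeff f k) * t ^ k \<le> norm (taylor_coeff f k) * (1 - h) ^ k * (1 - h) ^ k"
      unfolding mult.assoc by (rule mult_left_mono) simp
    then have "ennreal (norm (taylor_coeff f k) * t ^ k) \<le> ennreal (norm (taylor_coeff f k) * (1 - h) ^ k) * ennreal ((1 - h) ^ k)"
      using h by (subst ennreal_mult'[symmetric]) (auto intro!: ennreal_leI)
    also have "\<dots> \<le> (ennreal (2 * 2 ^ (n + 2)) * J) * ennreal ((1 - h) ^ k)"
      unfolding J_def h_def by (intro mult_right_mono taylor_coeff_layer_bound f) auto
    finally show "ennreal (norm (taylor_coeff f k) * t ^ k) \<le> (ennreal (2 * 2 ^ (n + 2)) * J) * ennreal ((1 - h) ^ k)" .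
  qed auto
  also have "\<dots> = (ennreal (2 * 2 ^ (n + 2)) * J) * (\<Sum>k. ennreal ((1 - h) ^ k))" by simp
  also have "(\<Sum>k. ennreal ((1 - h) ^ k)) = ennreal (1 / h)"
  proof -
    have "(\<Sum>k. ennreal ((1 - h) ^ k)) = ennreal (\<Sum>k. (1 - h) ^ k)"
      using h by (intro suminf_ennreal2 summable_geometric) auto
    also have "(\<Sum>k. (1 - h) ^ k) = 1 / (1 - (1 - h))"
      using h by (intro suminf_geometric) auto
    finally show ?thesis by simp
  qed
  also have "1 / h = 2 ^ (n + 2)" by (simp add: h_def power_one_over)
  also have "(ennreal (2 * 2 ^ (n + 2)) * J) * ennreal (2 ^ (n + 2)) = ennreal (2 * 2 ^ (n + 2) * 2 ^ (n + 2)) * J"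
    by (subst ennreal_mult'') (auto simp: mult_ac)
  also have "2 * 2 ^ (n + 2) * 2 ^ (n + 2) = (32 * 4 ^ n :: real)"
    by (simp add: power_add flip: power_mult_distrib)
  finally show ?thesis by (simp add: J_def)
qed

text \<open>The range of exponents \<open>s\<close> for which the \<open>s\<close>-Carleson condition makes the coefficient sums
  defining the operator converge absolutely on the Bergman space.\<close>
definition admissible :: "real \<Rightarrow> real \<Rightarrow> real \<Rightarrow> bool" where
  "admissible p \<alpha> s \<longleftrightarrow> (if p \<le> 1 then (\<alpha> + 2) / p \<le> s else (\<alpha> + 1) / p + 1 < s)"

lemma bergman_pointwise:
  assumes p: "0 < p"
  obtains C where "C > 0" "\<And>f z. f holomorphic_on ball 0 1 \<Longrightarrow> norm z < 1 \<Longrightarrow>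
     ennreal (norm (f z) powr p * (1 - norm z) powr (\<alpha> + 2)) \<le> ennreal C * bergman_integral p \<alpha> f"
proof -
  obtain C where C: "C > 0" "\<And>f z. f holomorphic_on ball 0 1 \<Longrightarrow> norm z < 1 \<Longrightarrow>
     ennreal (norm (f z) powr p * (1 - norm z) powr (\<alpha> + 2))
       \<le> ennreal C * emeasure (bergman_measure p \<alpha> f) (ball z ((1 - norm z) / 4))"
    using local_growth[OF p] by blast
  show ?thesis
    by (rule that[OF C(1)], rule order_trans[OF C(2)])
      (auto intro!: mult_left_mono emeasure_bergman_measure_le p)
qed

text \<open>The factor 2^(n(2-s)) is 4^n from the series bound times a mass of order 2^(-ns). The
  right side is designed for integration over the layer, whose area has order 2^-n: the first term
  sums to the Bergman integral, the second to the convergent sum of \<open>c n\<close>. For p \<le>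
  1 the pointwise growth of f removes the surplus power |f|^(1-p); for p > 1 small and large values
  of |f| are separated.\<close>

lemma layer_pointwise_bound:
  assumes p: "0 < p" and \<alpha>: "\<alpha> > -1" and s: "admissible p \<alpha> s" and f: "f \<in> bergman_space p \<alpha>"
  obtains C c where "C \<ge> 0" "\<And>n::nat. 0 \<le> c n" "summable c"
    "\<And>n z. z \<in> layer (n + 2) \<Longrightarrow> 2 powr (real n * (2 - s)) * norm (f z)
       \<le> C * (norm (f z) powr p * wt \<alpha> z) + c n * 2 ^ n"
proof -
  have hol: "f holomorphic_on ball 0 1" and fin: "bergman_integral p \<alpha> f < \<infinity>"
    using f by (auto simp: bergman_space_def)
  define K :: real where "K = max (4 powr (s - 2)) (8 powr (s - 2))"
  have K: "K > 0" by (simp add: K_def less_max_iff_disj)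
  define cw :: real where "cw = min (1 powr \<alpha>) (2 powr \<alpha>)"
  have cw: "cw > 0" by (simp add: cw_def)
  \<comment> \<open>On layer n+2 the number 1-|z| lies between 2^-(n+3) and 2^-(n+2), whence the
    factors 4 and 8.\<close>
  have v: "norm z < 1" "4 * (1 - norm z) \<le> (1/2) ^ n" "(1/2) ^ n \<le> 8 * (1 - norm z)" "1 - norm z \<le> 1"
    if "z \<in> layer (n + 2)" for n z
  proof -
    have "(0::real) < (1/2) ^ n" by simp
    then show "norm z < 1" "4 * (1 - norm z) \<le> (1/2) ^ n" "(1/2) ^ n \<le> 8 * (1 - norm z)" "1 - norm z \<le> 1"
      using that by (auto simp: layer_def)
  qed
  have w: "cw * (1 - norm z) powr \<alpha> \<le> wt \<alpha> z" if "z \<in> layer (n + 2)" for n z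
    unfolding cw_def using v(1)[OF that] one_minus_norm_sq[OF v(1)[OF that]] by (intro powr_between(1)) auto
  have K1: "2 powr (real n * (2 - s)) \<le> K * (1 - norm z) powr (s - 2)" if "z \<in> layer (n + 2)" for n z
  proof -
    have "2 powr (real n * (2 - s)) = ((1/2) ^ n) powr (s - 2)"
      unfolding half_power_powr by (simp add: powr_powr algebra_simps)
    also have "\<dots> \<le> K * (1 - norm z) powr (s - 2)"
      unfolding K_def by (rule powr_between(2)) (use v[OF that] in auto)
    finally show ?thesis .
  qed
  show ?thesis
  proof (cases "p \<le> 1")
    case True
    obtain C1 where C1: "C1 > 0" "\<And>f z. f holomorphic_on ball 0 1 \<Longrightarrow> norm z < 1 \<Longrightarrow>
     ennreal (norm (f z) powr p * (1 - norm z) powr (\<alpha> + 2)) \<le> ennreal C1 * bergman_integral p \<alpha> f"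
      using bergman_pointwise[OF p] by blast
    define B where "B = C1 * enn2real (bergman_integral p \<alpha> f)"
    have B0: "B \<ge> 0" using C1 by (simp add: B_def)
    have B: "norm (f z) powr p * (1 - norm z) powr (\<alpha> + 2) \<le> B" if "norm z < 1" for z
    proof -
      have "ennreal (norm (f z) powr p * (1 - norm z) powr (\<alpha> + 2)) \<le> ennreal B"
        using C1(2)[OF hol that] C1(1) fin by (simp add: B_def ennreal_mult')
      then show ?thesis using B0 by simp
    qed
    define B' where "B' = B powr ((1 - p) / p)"
    show ?thesis
    proof (rule that[of "K * B' / cw" "\<lambda>_. 0"])
      show "K * B' / cw \<ge> 0" using K cw by (simp add: B'_def)
      fix n z assume z: "z \<in> layer (n + 2)"
      define r where "r = 1 - norm z"
      have r: "0 < r" "r \<le> 1" using v[OF z] by (auto simp: r_def)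
      have f1: "norm (f z) \<le> norm (f z) powr p * (B' * r powr (- ((\<alpha> + 2) * ((1 - p) / p))))"
      proof (cases "f z = 0")
        case False
        have "norm (f z) powr p \<le> B * r powr (- (\<alpha> + 2))"
        proof -
          have "norm (f z) powr p * (r powr (\<alpha> + 2) * r powr (- (\<alpha> + 2))) \<le> B * r powr (- (\<alpha> + 2))"
            unfolding mult.assoc[symmetric] using B[OF v(1)[OF z]] by (intro mult_right_mono) (auto simp: r_def)
          moreover have "r powr (\<alpha> + 2) * r powr (- (\<alpha> + 2)) = 1"
            using r by (subst powr_add[symmetric]) simp
          ultimately show ?thesis by simp
        qed
        then have "(norm (f z) powr p) powr ((1 - p) / p) \<le> (B * r powr (- (\<alpha> + 2))) powr ((1 - p) / p)"
          using True p by (intro powr_mono2) auto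
        moreover have "p * ((1 - p) / p) = 1 - p" using p by simp
        moreover have "(B * r powr (- (\<alpha> + 2))) powr e = B powr e * r powr (- ((\<alpha> + 2) * e))" for e
          unfolding powr_mult powr_powr minus_mult_left ..
        ultimately have "norm (f z) powr (1 - p) \<le> B' * r powr (- ((\<alpha> + 2) * ((1 - p) / p)))"
          unfolding B'_def powr_powr by simp
        then have "norm (f z) powr p * norm (f z) powr (1 - p) \<le> norm (f z) powr p * (B' * r powr (- ((\<alpha> + 2) * ((1 - p) / p))))"
          by (intro mult_left_mono) auto
        moreover have "norm (f z) powr p * norm (f z) powr (1 - p) = norm (f z)"
          using False by (subst powr_add[symmetric]) simp
        ultimately show ?thesis by simp
      qed (use p in auto)
      have "2 powr (real n * (2 - s)) * norm (f z) \<le> (K * r powr (s - 2)) * (norm (f z) powr p * (B' * r powr (- ((\<alpha> + 2) * ((1 - p) / p)))))"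
        using K1[OF z] K by (intro mult_mono f1) (auto simp: r_def)
      also have "\<dots> = K * B' * norm (f z) powr p * r powr (s - 2 - (\<alpha> + 2) * ((1 - p) / p))"
      proof -
        have "r powr (s - 2 - (\<alpha> + 2) * ((1 - p) / p)) = r powr (s - 2) * r powr (- ((\<alpha> + 2) * ((1 - p) / p)))"
          by (subst powr_add[symmetric]) simp
        then show ?thesis by (simp only: mult_ac)
      qed
      also have "\<dots> \<le> K * B' * norm (f z) powr p * r powr \<alpha>"
      proof (intro mult_left_mono powr_mono')
        \<comment> \<open>The required comparison of exponents amounts to s \<ge> (\<alpha>+2)/p,
          the admissibility condition for p \<le> 1.\<close>
        have "(\<alpha> + 2) * ((1 - p) / p) = (\<alpha> + 2) / p - (\<alpha> + 2)" using p by (simp add: field_simps)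
        then show "\<alpha> \<le> s - 2 - (\<alpha> + 2) * ((1 - p) / p)"
          using s True by (simp add: admissible_def)
      qed (use r K in \<open>auto simp: B'_def\<close>)
      also have "\<dots> \<le> K * B' * norm (f z) powr p * (wt \<alpha> z / cw)"
        using w[OF z] cw K by (intro mult_left_mono) (auto simp: r_def B'_def pos_le_divide_eq mult.commute)
      finally show "2 powr (real n * (2 - s)) * norm (f z)
       \<le> K * B' / cw * (norm (f z) powr p * wt \<alpha> z) + 0 * 2 ^ n"
        by (simp add: mult_ac)
    qed auto
  next
    case False
    \<comment> \<open>Values of |f| are split at the threshold r^(-\<tau>), with r = 1-|z|. Above it
      |f| \<le> |f|^p r^(\<tau>(p-1)), and \<tau> is chosen such that r^(s-2) r^(\<tau>(p-1)) =
      r^\<alpha>, the order of the weight.\<close>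
    define \<tau> where "\<tau> = (\<alpha> + 2 - s) / (p - 1)"
    have \<tau>: "\<tau> * (p - 1) = \<alpha> + 2 - s" using False by (simp add: \<tau>_def)
    have \<tau>s: "\<tau> < s - 1"
    proof -
      have "\<alpha> + 1 < (s - 1) * p" using s False p by (simp add: admissible_def field_simps)
      then have "\<alpha> + 2 - s < (s - 1) * (p - 1)" by (simp add: algebra_simps)
      then show ?thesis using False by (simp add: \<tau>_def pos_divide_less_eq)
    qed
    \<comment> \<open>Below the threshold the bound is of order r^(\<kappa>-1), that is 2^n
      2^(-\<kappa> n) on the layer. Admissibility for p > 1 is equivalent to \<kappa> > 0, which
      makes these terms summable after integration.\<close>
    define \<kappa> where "\<kappa> = s - 1 - \<tau>"
    have \<kappa>: "\<kappa> > 0" using \<tau>s by (simp add: \<kappa>_def)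
    define L :: real where "L = max ((1/8) powr (\<kappa> - 1)) ((1/4) powr (\<kappa> - 1))"
    have L: "L > 0" by (simp add: L_def less_max_iff_disj)
    define c where "c = (\<lambda>n. K * L * (2 powr (- \<kappa>)) ^ n)"
    show ?thesis
    proof (rule that[of "K / cw" c])
      show "K / cw \<ge> 0" using K cw by simp
      show "0 \<le> c n" for n using K L by (simp add: c_def)
      show "summable c" unfolding c_def using \<kappa> by (intro summable_mult summable_geometric) (simp add: powr_less_one)
      fix n z assume z: "z \<in> layer (n + 2)"
      define r where "r = 1 - norm z"
      have r: "0 < r" "r \<le> 1" using v[OF z] by (auto simp: r_def)
      have f1: "norm (f z) \<le> r powr (- \<tau>) + norm (f z) powr p * r powr (\<alpha> + 2 - s)"
      proof (cases "norm (f z) \<le> r powr (- \<tau>)")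
        case False
        then have fz: "norm (f z) > 0" by (smt (verit) powr_ge_zero)
        have "norm (f z) powr (1 - p) \<le> (r powr (- \<tau>)) powr (1 - p)"
          using False \<open>\<not> p \<le> 1\<close> r by (intro powr_mono2') auto
        also have "(r powr (- \<tau>)) powr (1 - p) = r powr (\<alpha> + 2 - s)"
        proof -
          have "- \<tau> * (1 - p) = \<alpha> + 2 - s" using \<tau> by (simp add: algebra_simps)
          then show ?thesis by (simp only: powr_powr)
        qed
        finally have "norm (f z) powr p * norm (f z) powr (1 - p) \<le> norm (f z) powr p * r powr (\<alpha> + 2 - s)"
          by (intro mult_left_mono) auto
        moreover have "norm (f z) powr p * norm (f z) powr (1 - p) = norm (f z)"
          using fz by (subst powr_add[symmetric]) simp
        ultimately show ?thesis by (simp add: add_increasing)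
      qed (simp add: add_increasing2)
      have "2 powr (real n * (2 - s)) * norm (f z) \<le> (K * r powr (s - 2)) * (r powr (- \<tau>) + norm (f z) powr p * r powr (\<alpha> + 2 - s))"
        using K1[OF z] K by (intro mult_mono f1) (auto simp: r_def)
      also have "\<dots> = K * (r powr (s - 2) * r powr (- \<tau>)) + K * norm (f z) powr p * (r powr (s - 2) * r powr (\<alpha> + 2 - s))"
        by (simp add: algebra_simps)
      also have "r powr (s - 2) * r powr (- \<tau>) = r powr (\<kappa> - 1)"
        by (simp add: powr_add[symmetric] \<kappa>_def algebra_simps)
      also have "r powr (s - 2) * r powr (\<alpha> + 2 - s) = r powr \<alpha>"
        by (simp add: powr_add[symmetric])
      also have "K * r powr (\<kappa> - 1) + K * norm (f z) powr p * r powr \<alpha>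
        \<le> K * (L * ((1/2) ^ n) powr (\<kappa> - 1)) + K * norm (f z) powr p * (wt \<alpha> z / cw)"
      proof (intro add_mono mult_left_mono)
        show "r powr (\<kappa> - 1) \<le> L * ((1/2) ^ n) powr (\<kappa> - 1)"
          unfolding L_def by (rule powr_between(2)) (use v[OF z] in \<open>auto simp: r_def\<close>)
        show "r powr \<alpha> \<le> wt \<alpha> z / cw"
          using w[OF z] cw by (simp add: r_def pos_le_divide_eq mult.commute)
      qed (use K in auto)
      also have "((1/2::real) ^ n) powr (\<kappa> - 1) = (2 powr (- \<kappa>)) ^ n * 2 ^ n"
        unfolding half_power_powr
      proof -
        have "(2 powr (- \<kappa>)) ^ n = 2 powr (- (\<kappa> * real n))" "(2::real) ^ n = 2 powr real n"
          by (simp_all add: powr_realpow[symmetric] powr_powr)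
        then show "(2 powr (- real n)) powr (\<kappa> - 1) = (2 powr (- \<kappa>)) ^ n * 2 ^ n"
          by (simp add: powr_powr powr_add[symmetric] algebra_simps)
      qed
      finally show "2 powr (real n * (2 - s)) * norm (f z)
       \<le> K / cw * (norm (f z) powr p * wt \<alpha> z) + c n * 2 ^ n"
        by (simp add: c_def mult_ac)
    qed
  qed
qed

text \<open>Cut the integral over [0,1) into the dyadic intervals and bound the series on each by
  the integral of |f| over a layer. The layers are disjoint, so the main terms add up to at most the
  Bergman integral of f.\<close>

lemma (in interval_measure) coeff_summable_bergman:
  assumes p: "0 < p" and \<alpha>: "\<alpha> > -1" and s: "admissible p \<alpha> s" and f: "f \<in> bergman_space p \<alpha>"
    and M: "\<And>n. mass n \<le> K * 2 powr (- (real n * s))"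
  shows "coeff_summable f"
proof -
  have hol: "f holomorphic_on ball 0 1" and fin: "bergman_integral p \<alpha> f < \<infinity>"
    using f by (auto simp: bergman_space_def)
  have K: "K \<ge> 0" using M[of 0] measure_nonneg[of \<mu> "half_open_dyadic 0"]
    by (simp del: measure_nonneg)
  obtain C c where C: "C \<ge> 0" "\<And>n::nat. 0 \<le> c n" "summable c"
    "\<And>n z. z \<in> layer (n + 2) \<Longrightarrow> 2 powr (real n * (2 - s)) * norm (f z)
       \<le> C * (norm (f z) powr p * wt \<alpha> z) + c n * 2 ^ n"
    using layer_pointwise_bound[OF p \<alpha> s f] by blast
  define J where "J = (\<lambda>n. \<integral>\<^sup>+z\<in>layer (n + 2). ennreal (norm (f z)) \<partial>lborel)"
  define Y where "Y = (\<lambda>n. emeasure (bergman_measure p \<alpha> f) (layer n))"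
  have J: "ennreal (2 powr (real n * (2 - s))) * J n \<le> ennreal C * Y (n + 2) + ennreal (c n)" for n
  proof -
    have "ennreal (2 powr (real n * (2 - s))) * J n = (\<integral>\<^sup>+z. ennreal (2 powr (real n * (2 - s))) * (ennreal (norm (f z)) * indicator (layer (n + 2)) z) \<partial>lborel)"
      unfolding J_def
      using holomorphic_indicator_measurable[OF hol layer_measurable layer_subset continuous_on_norm_id, of "n + 2"]
      by (subst nn_integral_cmult) auto
    also have "\<dots> \<le> (\<integral>\<^sup>+z. ennreal C * (ennreal (norm (f z) powr p * wt \<alpha> z) * indicator (ball 0 1) z * indicator (layer (n + 2)) z)
        + ennreal (c n * 2 ^ n) * indicator (layer (n + 2)) z \<partial>lborel)"
    proof (rule nn_integral_mono, goal_cases)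
      case (1 z)
      show ?case
      proof (cases "z \<in> layer (n + 2)")
        case True
        then have zb: "z \<in> ball 0 1" using layer_subset by blast
        have "ennreal (2 powr (real n * (2 - s)) * norm (f z))
          \<le> ennreal (C * (norm (f z) powr p * wt \<alpha> z) + c n * 2 ^ n)"
          by (intro ennreal_leI C(4) True)
        then show ?thesis
          using True zb C(1,2) by (simp add: ennreal_mult' ennreal_plus)
      qed simp
    qed
    also have "\<dots> = ennreal C * Y (n + 2) + ennreal (c n * 2 ^ n) * emeasure lborel (layer (n + 2))"
    proof -
      have m: "(\<lambda>z. ennreal (norm (f z) powr p * wt \<alpha> z) * indicator (ball 0 1) z * indicator (layer (n + 2)) z) \<in> borel_measurable lborel"
        using borel_measurable_times_ennreal[OF bergman_density_measurable[OF hol p, of \<alpha>]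
            borel_measurable_indicator[OF layer_measurable, of "n + 2"]] by simp
      have m2: "(\<lambda>z. ennreal (c n * 2 ^ n) * indicator (layer (n + 2)) z) \<in> borel_measurable lborel"
        by (intro borel_measurable_times_ennreal borel_measurable_indicator) auto
      show ?thesis
        using m m2 by (subst nn_integral_add)
          (auto simp: nn_integral_cmult nn_integral_cmult_indicator Y_def emeasure_bergman_measure[OF hol p])
    qed
    also have "\<dots> \<le> ennreal C * Y (n + 2) + ennreal (c n)"
    proof (rule add_left_mono)
      have "ennreal (c n * 2 ^ n) * emeasure lborel (layer (n + 2)) \<le> ennreal (c n * 2 ^ n) * ennreal (4 * (1/2) ^ (n + 2))"
        by (intro mult_left_mono emeasure_layer_bounds) auto
      also have "\<dots> = ennreal (c n)"
        using C(2)[of n] by (simp add: ennreal_mult'[symmetric] power_divide)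
      finally show "ennreal (c n * 2 ^ n) * emeasure lborel (layer (n + 2)) \<le> ennreal (c n)" .
    qed
    finally show ?thesis .
  qed
  have "(\<integral>\<^sup>+t\<in>{0..<1}. (\<Sum>k. ennreal (norm (taylor_coeff f k) * t ^ k)) \<partial>\<mu>)
     \<le> (\<Sum>n. (ennreal (32 * 4 ^ n) * J n) * ennreal (mass n))"
    unfolding J_def by (intro nn_integral_dyadic_le taylor_abs_series_bound hol)
  also have "\<dots> \<le> (\<Sum>n. ennreal (32 * K) * (ennreal C * Y (n + 2) + ennreal (c n)))"
  proof (intro suminf_le)
    fix n
    have "(ennreal (32 * 4 ^ n) * J n) * ennreal (mass n)
       \<le> (ennreal (32 * 4 ^ n) * J n) * ennreal (K * 2 powr (- (real n * s)))"
      by (intro mult_left_mono ennreal_leI M) auto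
    also have "\<dots> = ennreal ((32 * 4 ^ n) * (K * 2 powr (- (real n * s)))) * J n"
      using K by (subst ennreal_mult'') (auto simp: mult_ac)
    also have "(32 * 4 ^ n) * (K * 2 powr (- (real n * s))) = (32 * K) * 2 powr (real n * (2 - s))"
    proof -
      have "(4::real) ^ n = 2 powr (2 * real n)"
        by (simp add: powr_powr[symmetric] powr_realpow)
      moreover have "2 powr (2 * real n) * 2 powr (- (real n * s)) = 2 powr (real n * (2 - s))"
        by (simp add: powr_add[symmetric] algebra_simps)
      ultimately show ?thesis by simp
    qed
    also have "ennreal (32 * K * 2 powr (real n * (2 - s))) * J n = ennreal (32 * K) * (ennreal (2 powr (real n * (2 - s))) * J n)"
      using K by (simp add: ennreal_mult' mult.assoc)
    also have "\<dots> \<le> ennreal (32 * K) * (ennreal C * Y (n + 2) + ennreal (c n))"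
      by (intro mult_left_mono J) auto
    finally show "(ennreal (32 * 4 ^ n) * J n) * ennreal (mass n)
      \<le> ennreal (32 * K) * (ennreal C * Y (n + 2) + ennreal (c n))" .
  qed auto
  also have "\<dots> = ennreal (32 * K) * (ennreal C * (\<Sum>n. Y (n + 2)) + (\<Sum>n. ennreal (c n)))"
    by (simp add: suminf_add[symmetric])
  also have "\<dots> < \<infinity>"
  proof -
    have "(\<Sum>n. Y (n + 2)) \<le> (\<Sum>n. Y n)"
      by (subst suminf_offset[of Y 2]) auto
    also have "\<dots> \<le> bergman_integral p \<alpha> f"
      unfolding Y_def by (rule layer_sum_le[OF hol p])
    finally have 1: "(\<Sum>n. Y (n + 2)) < \<infinity>" using fin by (rule le_less_trans)
    have "(\<Sum>n. ennreal (c n)) < \<infinity>" using C(2,3) by (simp add: suminf_ennreal2)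
    with 1 show ?thesis by (simp add: ennreal_mult_less_top)
  qed
  finally show ?thesis using hol by (simp add: coeff_summable_def)
qed

section \<open>Sufficiency\<close>

lemma powr_diff_norm_le:
  fixes a b :: complex
  assumes "p > 0"
  shows "norm (a - b) powr p \<le> 2 powr p * (norm a powr p + norm b powr p)"
proof -
  \<comment> \<open>Passing through the maximum works for every p > 0; for p < 1 there is no
    triangle inequality for the p-th root.\<close>
  have "norm (a - b) \<le> 2 * max (norm a) (norm b)"
    using norm_triangle_ineq4[of a b] by simp
  then have "norm (a - b) powr p \<le> (2 * max (norm a) (norm b)) powr p"
    using assms by (intro powr_mono2) auto
  also have "\<dots> = 2 powr p * max (norm a) (norm b) powr p"
    by (simp add: powr_mult)
  also have "\<dots> \<le> 2 powr p * (norm a powr p + norm b powr p)"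
    by (intro mult_left_mono) (auto simp: max_def)
  finally show ?thesis .
qed

lemma bergman_integral_diff:
  assumes f: "f holomorphic_on ball 0 1" and g: "g holomorphic_on ball 0 1" and p: "p > 0"
  shows "bergman_integral p \<alpha> (\<lambda>z. f z - g z) \<le> ennreal (2 powr p) * (bergman_integral p \<alpha> f + bergman_integral p \<alpha> g)"
proof -
  define w where "w = (\<lambda>(f :: complex \<Rightarrow> complex) z. ennreal (norm (f z) powr p * wt \<alpha> z) * indicator (ball 0 1) z)"
  have [measurable]: "w f \<in> borel_measurable borel" "w g \<in> borel_measurable borel"
    unfolding w_def by (intro bergman_density_measurable f g p)+
  have "bergman_integral p \<alpha> (\<lambda>z. f z - g z) \<le> (\<integral>\<^sup>+z. ennreal (2 powr p) * (w f z + w g z) \<partial>lborel)"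
    unfolding bergman_integral_def
  proof (rule nn_integral_mono, goal_cases)
    case (1 z)
    show ?case
    proof (cases "z \<in> ball 0 1")
      case True
      have "norm (f z - g z) powr p * wt \<alpha> z
        \<le> 2 powr p * (norm (f z) powr p + norm (g z) powr p) * wt \<alpha> z"
        by (intro mult_right_mono powr_diff_norm_le p) auto
      then have "ennreal (norm (f z - g z) powr p * wt \<alpha> z)
        \<le> ennreal (2 powr p * (norm (f z) powr p * wt \<alpha> z + norm (g z) powr p * wt \<alpha> z))"
        by (intro ennreal_leI) (simp add: algebra_simps)
      then show ?thesis using True by (simp add: w_def ennreal_mult' ennreal_plus)
    qed simp
  qed
  also have "\<dots> = ennreal (2 powr p) * ((\<integral>\<^sup>+z. w f z \<partial>lborel) + (\<integral>\<^sup>+z. w g z \<partial>lborel))"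
    by (simp add: nn_integral_cmult nn_integral_add)
  finally show ?thesis by (simp add: w_def bergman_integral_def)
qed

lemma bergman_space_diff:
  assumes "f \<in> bergman_space p \<alpha>" "g \<in> bergman_space p \<alpha>" "p > 0"
  shows "(\<lambda>z. f z - g z) \<in> bergman_space p \<alpha>"
proof -
  have "bergman_integral p \<alpha> (\<lambda>z. f z - g z) \<le> ennreal (2 powr p) * (bergman_integral p \<alpha> f + bergman_integral p \<alpha> g)"
    using assms by (intro bergman_integral_diff) (auto simp: bergman_space_def)
  also have "\<dots> < \<infinity>" using assms by (simp add: bergman_space_def ennreal_mult_less_top)
  finally show ?thesis
    using assms by (auto simp: bergman_space_def intro: holomorphic_on_diff)
qed

lemma bergman_integral_le_of_norm:
  assumes f: "f \<in> bergman_space p \<alpha>" and B: "bergman_norm p \<alpha> f \<le> B" and p: "p > 0" and \<alpha>: "\<alpha> > -1"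
  shows "bergman_integral p \<alpha> f \<le> ennreal (pi / (\<alpha> + 1) * B powr p)"
proof -
  define I where "I = enn2real (bergman_integral p \<alpha> f)"
  have I: "bergman_integral p \<alpha> f = ennreal I" "I \<ge> 0"
    using f by (auto simp: I_def bergman_space_def)
  have "((\<alpha> + 1) / pi * I) powr (1 / p) \<le> B" using B by (simp add: bergman_norm_def I_def)
  then have "(((\<alpha> + 1) / pi * I) powr (1 / p)) powr p \<le> B powr p"
    using p by (intro powr_mono2) auto
  then have "(\<alpha> + 1) / pi * I \<le> B powr p"
    using p \<alpha> I(2) by (simp add: powr_powr)
  then have "I \<le> pi / (\<alpha> + 1) * B powr p"
    using \<alpha> by (simp add: field_simps)
  then show ?thesis unfolding I by (rule ennreal_leI)
qed

lemma bergman_norm_tendsto_0: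
  assumes "\<And>e. e > 0 \<Longrightarrow> eventually (\<lambda>j. bergman_integral q \<alpha> (G j) \<le> ennreal e) sequentially" and q: "q > 0" and \<alpha>: "\<alpha> > -1"
  shows "(\<lambda>j. bergman_norm q \<alpha> (G j)) \<longlonglongrightarrow> 0"
proof -
  have "(\<lambda>j. enn2real (bergman_integral q \<alpha> (G j))) \<longlonglongrightarrow> 0"
  proof (rule tendstoI)
    fix e :: real assume "e > 0"
    then have "eventually (\<lambda>j. bergman_integral q \<alpha> (G j) \<le> ennreal (e / 2)) sequentially"
      by (intro assms(1)) simp
    then show "eventually (\<lambda>j. dist (enn2real (bergman_integral q \<alpha> (G j))) 0 < e) sequentially"
    proof (rule eventually_mono)
      fix j assume "bergman_integral q \<alpha> (G j) \<le> ennreal (e / 2)"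
      then have "enn2real (bergman_integral q \<alpha> (G j)) \<le> e / 2"
        using \<open>e > 0\<close> by (intro enn2real_leI) auto
      then show "dist (enn2real (bergman_integral q \<alpha> (G j))) 0 < e" using \<open>e > 0\<close> by simp
    qed
  qed
  then have "(\<lambda>j. (\<alpha> + 1) / pi * enn2real (bergman_integral q \<alpha> (G j))) \<longlonglongrightarrow> 0"
    by (rule tendsto_mult_right_zero)
  then have "(\<lambda>j. ((\<alpha> + 1) / pi * enn2real (bergman_integral q \<alpha> (G j))) powr (1 / q)) \<longlonglongrightarrow> 0 powr (1 / q)"
    using q \<alpha> by (intro tendsto_powr' tendsto_const) (auto intro!: always_eventually)
  then show ?thesis by (simp add: bergman_norm_def)
qed

lemma bergman_integral_cong:
  assumes "\<And>z. norm z < 1 \<Longrightarrow> f z = g z"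
  shows "bergman_integral p \<alpha> f = bergman_integral p \<alpha> g"
  unfolding bergman_integral_def using assms by (intro nn_integral_cong) (auto simp: indicator_def)

text \<open>The growth estimate bounds the sequence uniformly on each compact subset, so it has a
  locally uniformly convergent subsequence. The limit obeys the same bound B, hence may be
  subtracted from the sequence within the space.\<close>

lemma bergman_Montel:
  assumes F: "\<And>j. F j \<in> bergman_space p \<alpha>" and B: "\<And>j. bergman_integral p \<alpha> (F j) \<le> ennreal B"
    and p: "p > 0"
  shows "\<exists>f r. f \<in> bergman_space p \<alpha> \<and> bergman_integral p \<alpha> f \<le> ennreal B \<and> strict_mono (r :: nat \<Rightarrow> nat) \<and>
    (\<forall>K. compact K \<longrightarrow> K \<subseteq> ball 0 1 \<longrightarrow> uniform_limit K (F \<circ> r) f sequentially)"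
proof -
  have hol: "F j holomorphic_on ball 0 1" for j using F by (simp add: bergman_space_def)
  obtain C where C: "C > 0" "\<And>f z. f holomorphic_on ball 0 1 \<Longrightarrow> norm z < 1 \<Longrightarrow>
     ennreal (norm (f z) powr p * (1 - norm z) powr (\<alpha> + 2)) \<le> ennreal C * bergman_integral p \<alpha> f"
    using bergman_pointwise[OF p] by blast
  have pt: "norm (F j z) powr p * (1 - norm z) powr (\<alpha> + 2) \<le> C * max B 0" if "norm z < 1" for j z
  proof -
    have "ennreal (norm (F j z) powr p * (1 - norm z) powr (\<alpha> + 2)) \<le> ennreal C * bergman_integral p \<alpha> (F j)"
      by (rule C(2)[OF hol that])
    also have "\<dots> \<le> ennreal C * ennreal (max B 0)"
      by (intro mult_left_mono order_trans[OF B] ennreal_leI) auto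
    also have "\<dots> = ennreal (C * max B 0)" using C(1) by (simp add: ennreal_mult')
    finally show ?thesis using C(1) by (subst (asm) ennreal_le_iff) auto
  qed
  obtain f r where f: "f holomorphic_on ball 0 1" and r: "strict_mono (r :: nat \<Rightarrow> nat)"
    and lim: "\<And>x. x \<in> ball 0 1 \<Longrightarrow> ((\<lambda>n. F (r n) x) \<longlongrightarrow> f x) sequentially"
    and unif: "\<And>K. compact K \<Longrightarrow> K \<subseteq> ball 0 1 \<Longrightarrow> uniform_limit K (F \<circ> r) f sequentially"
  proof (rule Montel[of "ball 0 1" "range F" F])
    fix K :: "complex set" assume K: "compact K" "K \<subseteq> ball 0 1"
    show "\<exists>B. \<forall>h\<in>range F. \<forall>z\<in>K. norm (h z) \<le> B"
    proof (cases "K = {}")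
      case False
      have "continuous_on K (\<lambda>z. (1 - norm z) powr (\<alpha> + 2))"
        using K(2) by (intro continuous_intros) auto
      then obtain z0 where z0: "z0 \<in> K" "\<And>z. z \<in> K \<Longrightarrow> (1 - norm z0) powr (\<alpha> + 2) \<le> (1 - norm z) powr (\<alpha> + 2)"
        using continuous_attains_inf[OF K(1) False] by blast
      define c where "c = (1 - norm z0) powr (\<alpha> + 2)"
      have c: "c > 0" using z0(1) K(2) by (auto simp: c_def)
      have "norm (F j z) \<le> (C * max B 0 / c) powr (1 / p)" if "z \<in> K" for j z
      proof -
        have "norm (F j z) powr p * c \<le> norm (F j z) powr p * (1 - norm z) powr (\<alpha> + 2)"
          using z0(2)[OF that] by (intro mult_left_mono) (auto simp: c_def)
        also have "\<dots> \<le> C * max B 0" using that K(2) by (intro pt) auto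
        finally have "norm (F j z) powr p \<le> C * max B 0 / c" using c by (simp add: pos_le_divide_eq)
        then have "(norm (F j z) powr p) powr (1 / p) \<le> (C * max B 0 / c) powr (1 / p)"
          using p by (intro powr_mono2) auto
        then show ?thesis using p by (simp add: powr_powr)
      qed
      then show ?thesis by blast
    qed auto
  qed (use hol in auto)
  \<comment> \<open>Fatou's lemma transfers the bound to the pointwise limit.\<close>
  have "bergman_integral p \<alpha> f \<le> ennreal B"
  proof -
    define w where "w = (\<lambda>(f :: complex \<Rightarrow> complex) z. ennreal (norm (f z) powr p * wt \<alpha> z) * indicator (ball 0 1) z)"
    have "liminf (\<lambda>n. w (F (r n)) z) = w f z" for z
    proof (cases "z \<in> ball 0 1")
      case True
      have "(\<lambda>n. ennreal (norm (F (r n) z) powr p * wt \<alpha> z)) \<longlonglongrightarrow> ennreal (norm (f z) powr p * wt \<alpha> z)"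
        using p by (intro tendsto_ennrealI tendsto_mult tendsto_powr' tendsto_norm lim True tendsto_const) auto
      then have "liminf (\<lambda>n. ennreal (norm (F (r n) z) powr p * wt \<alpha> z)) = ennreal (norm (f z) powr p * wt \<alpha> z)"
        by (intro lim_imp_Liminf) auto
      then show ?thesis using True by (simp add: w_def)
    qed (simp add: w_def Liminf_const)
    then have "bergman_integral p \<alpha> f = (\<integral>\<^sup>+z. liminf (\<lambda>n. w (F (r n)) z) \<partial>lborel)"
      by (simp add: bergman_integral_def w_def)
    also have "\<dots> \<le> liminf (\<lambda>n. \<integral>\<^sup>+z. w (F (r n)) z \<partial>lborel)"
      unfolding w_def using bergman_density_measurable[OF hol p] by (intro nn_integral_liminf) auto
    also have "\<dots> \<le> liminf (\<lambda>n. ennreal B)"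
      using B by (intro Liminf_mono always_eventually) (auto simp: w_def bergman_integral_def)
    also have "\<dots> = ennreal B" by (simp add: Liminf_const)
    finally show ?thesis .
  qed
  moreover from this have "f \<in> bergman_space p \<alpha>"
    using f by (auto simp: bergman_space_def intro: le_less_trans)
  ultimately show ?thesis using r unif by blast
qed

text \<open>The embedding of l^p in l^q: x^q = x^(q-p) x^p, and the first factor is bounded through
  the p-norm. The bound \<open>W R\<close> depends on R only, so it is uniform over bounded subsets
  of the source space.\<close>

lemma dyadic_sup_powr_sum:
  assumes p: "0 < p" and q: "p \<le> q"
  obtains W where "\<And>R. 0 \<le> W R" "\<And>R f. f holomorphic_on ball 0 1 \<Longrightarrow> bergman_integral p \<alpha> f \<le> ennreal R \<Longrightarrow>
     (\<Sum>n. ennreal (dyadic_sup p \<alpha> f n powr q)) \<le> ennreal (W R)"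
proof -
  obtain C where C: "C > 0" "\<And>f. f holomorphic_on ball 0 1 \<Longrightarrow>
     (\<Sum>n. ennreal (dyadic_sup p \<alpha> f n powr p)) \<le> ennreal C * bergman_integral p \<alpha> f"
    using dyadic_sup_sum[OF p] by blast
  define W where "W = (\<lambda>R. (C * max R 0) powr ((q - p) / p) * (C * max R 0))"
  show ?thesis
  proof (rule that)
    show "0 \<le> W R" for R using C(1) by (simp add: W_def)
    fix R f assume f: "f holomorphic_on ball 0 1" and R: "bergman_integral p \<alpha> f \<le> ennreal R"
    define x where "x = dyadic_sup p \<alpha> f"
    have x: "x n \<ge> 0" for n unfolding x_def by (rule dyadic_sup_nonneg[OF f])
    define S where "S = C * max R 0"
    have S0: "S \<ge> 0" using C(1) by (simp add: S_def)
    have "ennreal C * bergman_integral p \<alpha> f \<le> ennreal C * ennreal (max R 0)"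
      by (intro mult_left_mono order_trans[OF R] ennreal_leI) auto
    then have S: "(\<Sum>n. ennreal (x n powr p)) \<le> ennreal S"
      using C(1) order_trans[OF C(2)[OF f]] by (simp add: x_def S_def ennreal_mult')
    have xS: "x n powr p \<le> S" for n
    proof -
      have "ennreal (x n powr p) = (\<Sum>n\<in>{n}. ennreal (x n powr p))" by simp
      also have "\<dots> \<le> (\<Sum>n. ennreal (x n powr p))" by (intro sum_le_suminf) auto
      also have "\<dots> \<le> ennreal S" by (rule S)
      finally show ?thesis using S0 by (simp only: ennreal_le_iff)
    qed
    have "x n powr q \<le> S powr ((q - p) / p) * x n powr p" for n
    proof -
      have "x n powr q = (x n powr p) powr ((q - p) / p) * x n powr p"
      proof -
        have "p * ((q - p) / p) = q - p" using p by simp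
        then show ?thesis unfolding powr_powr by (subst powr_add[symmetric]) simp
      qed
      also have "\<dots> \<le> S powr ((q - p) / p) * x n powr p"
        using xS p q by (intro mult_right_mono powr_mono2) auto
      finally show ?thesis .
    qed
    then have "(\<Sum>n. ennreal (x n powr q)) \<le> (\<Sum>n. ennreal (S powr ((q - p) / p)) * ennreal (x n powr p))"
      by (intro suminf_le) (auto simp: ennreal_mult'[symmetric] intro!: ennreal_leI)
    also have "\<dots> = ennreal (S powr ((q - p) / p)) * (\<Sum>n. ennreal (x n powr p))" by simp
    also have "\<dots> \<le> ennreal (S powr ((q - p) / p)) * ennreal S"
      by (intro mult_left_mono S) auto
    also have "\<dots> = ennreal (W R)" using S0 by (simp add: W_def S_def ennreal_mult')
    finally show "(\<Sum>n. ennreal (dyadic_sup p \<alpha> f n powr q)) \<le> ennreal (W R)" by (simp add: x_def)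
  qed
qed

section \<open>Compactness from weights tending to zero\<close>

lemma dyadic_sup_tendsto_0:
  assumes hol: "\<And>j. h j holomorphic_on ball 0 1"
    and unif: "uniform_limit (complex_of_real ` dyadic_interval n) h (\<lambda>_. 0) sequentially"
  shows "(\<lambda>j. dyadic_sup p \<alpha> (h j) n) \<longlonglongrightarrow> 0"
proof -
  have "(\<lambda>j. SUP t\<in>dyadic_interval n. norm (h j (of_real t))) \<longlonglongrightarrow> 0"
  proof (rule tendstoI)
    fix e :: real assume "e > 0"
    then have "\<forall>\<^sub>F j in sequentially. \<forall>x\<in>complex_of_real ` dyadic_interval n. dist (h j x) 0 < e"
      using unif by (auto simp: uniform_limit_iff)
    then show "\<forall>\<^sub>F j in sequentially. dist (SUP t\<in>dyadic_interval n. norm (h j (of_real t))) 0 < e"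
    proof (rule eventually_mono)
      fix j assume *: "\<forall>x\<in>complex_of_real ` dyadic_interval n. dist (h j x) 0 < e"
      obtain t where "t \<in> dyadic_interval n" "(SUP t\<in>dyadic_interval n. norm (h j (of_real t))) = norm (h j (of_real t))"
        using dyadic_sup_attained[OF hol] by metis
      then show "dist (SUP t\<in>dyadic_interval n. norm (h j (of_real t))) 0 < e" using * by auto
    qed
  qed
  then show ?thesis unfolding dyadic_sup_def by (rule tendsto_mult_right_zero)
qed

text \<open>Subtract the Montel limit from a bounded sequence; the differences h_j stay bounded and
  tend to 0 locally uniformly. In the weighted sum for the image of h_j, the first N terms vanish in
  the limit because each interval is compact, and the remaining ones are small because v n is small
  there while the l^q sums stay bounded. The case distinction between q > 1 and q = 1 enters only
  through the weights.\<close>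

lemma (in interval_measure) H_compact_of_weights:
  assumes p: "0 < p" and \<alpha>: "\<alpha> > -1" and q: "1 \<le> q" "p \<le> q"
    and cs: "\<And>f. f \<in> bergman_space p \<alpha> \<Longrightarrow> coeff_summable f"
    and v: "\<And>n. 0 \<le> v n" "v \<longlonglongrightarrow> 0"
    and C: "C > 0" "\<And>f. f \<in> bergman_space p \<alpha> \<Longrightarrow>
       bergman_integral q \<alpha> (H_op \<mu> (\<alpha> + 2) f) \<le> ennreal C * (\<Sum>n. ennreal (v n * dyadic_sup p \<alpha> f n powr q))"
  shows "H_compact \<mu> (\<alpha> + 2) p \<alpha> q"
proof -
  have b: "\<alpha> + 2 > 0" using \<alpha> by simp
  obtain W where W: "\<And>R. 0 \<le> W R" "\<And>R f. f holomorphic_on ball 0 1 \<Longrightarrow> bergman_integral p \<alpha> f \<le> ennreal R \<Longrightarrow>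
     (\<Sum>n. ennreal (dyadic_sup p \<alpha> f n powr q)) \<le> ennreal (W R)"
    using dyadic_sup_powr_sum[OF p q(2)] by blast
  obtain V where V: "\<And>n. v n \<le> V"
    using convergent_imp_Bseq[OF convergentI[OF v(2)]] by (auto simp: Bseq_def abs_le_iff)
  have V0: "V \<ge> 0" using V[of 0] v(1)[of 0] by linarith
  have maps: "H_op \<mu> (\<alpha> + 2) f \<in> bergman_space q \<alpha>" if f: "f \<in> bergman_space p \<alpha>" for f
  proof -
    have hol: "f holomorphic_on ball 0 1" using f by (simp add: bergman_space_def)
    define R where "R = enn2real (bergman_integral p \<alpha> f)"
    have R: "bergman_integral p \<alpha> f \<le> ennreal R" using f by (auto simp: R_def bergman_space_def)
    have "(\<Sum>n. ennreal (v n * dyadic_sup p \<alpha> f n powr q)) \<le> (\<Sum>n. ennreal V * ennreal (dyadic_sup p \<alpha> f n powr q))"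
      using V V0 by (intro suminf_le) (auto simp: ennreal_mult'[symmetric] intro!: ennreal_leI mult_right_mono)
    also have "\<dots> \<le> ennreal V * ennreal (W R)"
      using W(2)[OF hol R] by (simp add: mult_left_mono)
    also have "\<dots> < \<infinity>" by (simp add: ennreal_mult_less_top)
    finally have "ennreal C * (\<Sum>n. ennreal (v n * dyadic_sup p \<alpha> f n powr q)) < \<infinity>"
      by (simp add: ennreal_mult_less_top)
    with C(2)[OF f] have "bergman_integral q \<alpha> (H_op \<mu> (\<alpha> + 2) f) < \<infinity>" by (rule le_less_trans)
    then show ?thesis using H_op_holomorphic[OF cs[OF f] b] by (simp add: bergman_space_def)
  qed
  have comp: "\<exists>r g. strict_mono r \<and> g \<in> bergman_space q \<alpha> \<and>
           (\<lambda>j. bergman_norm q \<alpha> (\<lambda>z. H_op \<mu> (\<alpha> + 2) (F (r j)) z - g z)) \<longlonglongrightarrow> 0"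
    if F: "\<And>j. F j \<in> bergman_space p \<alpha>" and B: "\<And>j. bergman_norm p \<alpha> (F j) \<le> B" for F :: "nat \<Rightarrow> complex \<Rightarrow> complex" and B
  proof -
    define B' where "B' = pi / (\<alpha> + 1) * B powr p"
    have B': "bergman_integral p \<alpha> (F j) \<le> ennreal B'" for j
      unfolding B'_def by (intro bergman_integral_le_of_norm F B p \<alpha>)
    obtain f r where f: "f \<in> bergman_space p \<alpha>" "bergman_integral p \<alpha> f \<le> ennreal B'" and r: "strict_mono (r :: nat \<Rightarrow> nat)"
      and unif': "\<forall>K. compact K \<longrightarrow> K \<subseteq> ball 0 1 \<longrightarrow> uniform_limit K (F \<circ> r) f sequentially"
      using bergman_Montel[of F p \<alpha> B', OF F B' p] by (elim exE conjE)
    have unif: "uniform_limit K (F \<circ> r) f sequentially" if "compact K" "K \<subseteq> ball 0 1" for K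
      using unif' that by blast
    have B0: "B' \<ge> 0" using \<alpha> by (simp add: B'_def)
    define h where "h = (\<lambda>j z. F (r j) z - f z)"
    have h: "h j \<in> bergman_space p \<alpha>" for j unfolding h_def by (intro bergman_space_diff F f p)
    have holh: "h j holomorphic_on ball 0 1" for j using h by (simp add: bergman_space_def)
    define R where "R = 2 powr p * (B' + B')"
    have hR: "bergman_integral p \<alpha> (h j) \<le> ennreal R" for j
    proof -
      have "bergman_integral p \<alpha> (h j) \<le> ennreal (2 powr p) * (bergman_integral p \<alpha> (F (r j)) + bergman_integral p \<alpha> f)"
        unfolding h_def using F f by (intro bergman_integral_diff p) (auto simp: bergman_space_def)
      also have "\<dots> \<le> ennreal (2 powr p) * (ennreal B' + ennreal B')"
        by (intro mult_left_mono add_mono B' f) auto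
      also have "\<dots> = ennreal R" 
        unfolding R_def ennreal_plus[OF B0 B0, symmetric] by (rule ennreal_mult'[symmetric]) simp
      finally show ?thesis .
    qed
    define x where "x = (\<lambda>j. dyadic_sup p \<alpha> (h j))"
    have x0: "0 \<le> x j n" for j n unfolding x_def by (rule dyadic_sup_nonneg[OF holh])
    have xlim: "(\<lambda>j. x j n) \<longlonglongrightarrow> 0" for n
      unfolding x_def
    proof (rule dyadic_sup_tendsto_0[OF holh])
      have "complex_of_real ` dyadic_interval n \<subseteq> ball 0 1"
        using dyadic_interval_props(1,2) by fastforce
      from unif[OF dyadic_interval_compact(1) this] show "uniform_limit (complex_of_real ` dyadic_interval n) h (\<lambda>_. 0) sequentially"
        by (simp add: uniform_limit_iff h_def dist_norm)
    qed
    have xsum: "(\<Sum>n. ennreal (x j n powr q)) \<le> ennreal (W R)" for j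
      unfolding x_def by (intro W(2) holh hR)
    have ev: "eventually (\<lambda>j. bergman_integral q \<alpha> (\<lambda>z. H_op \<mu> (\<alpha> + 2) (F (r j)) z - H_op \<mu> (\<alpha> + 2) f z) \<le> ennreal e) sequentially"
      if e: "e > 0" for e
    proof -
      \<comment> \<open>Chosen so that the terms beyond N contribute at most e/2; adding 1 keeps the
        denominator positive should \<open>W R\<close> vanish.\<close>
      define \<eta> where "\<eta> = e / (2 * C * (W R + 1))"
      have \<eta>: "\<eta> > 0" using e C(1) W(1)[of R] by (simp add: \<eta>_def add_nonneg_pos)
      have \<eta>e: "C * (\<eta> * W R) \<le> e / 2"
      proof -
        have "C * (\<eta> * W R) \<le> C * (\<eta> * (W R + 1))" using C(1) \<eta> by (intro mult_left_mono) auto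
        also have "\<dots> = e / 2" 
        proof -
          have "W R + 1 \<noteq> 0" using W(1)[of R] by linarith
          then show ?thesis using C(1) by (simp add: \<eta>_def)
        qed
        finally show ?thesis .
      qed
      obtain N where N: "\<And>n. n \<ge> N \<Longrightarrow> v n \<le> \<eta>"
        using order_tendstoD(2)[OF v(2) \<eta>] by (auto simp: eventually_sequentially intro: less_imp_le)
      have "(\<lambda>j. \<Sum>n<N. v n * x j n powr q) \<longlonglongrightarrow> (\<Sum>n<N. v n * 0 powr q)"
        using q x0 by (intro tendsto_sum tendsto_mult tendsto_const tendsto_powr' xlim) (auto intro!: always_eventually)
      then have lim0: "(\<lambda>j. \<Sum>n<N. v n * x j n powr q) \<longlonglongrightarrow> 0" by simp
      have "eventually (\<lambda>j. (\<Sum>n<N. v n * x j n powr q) < e / (2 * C)) sequentially"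
        using e C(1) by (intro order_tendstoD(2)[OF lim0]) auto
      then show ?thesis
      proof (rule eventually_mono)
        fix j assume j: "(\<Sum>n<N. v n * x j n powr q) < e / (2 * C)"
        have "bergman_integral q \<alpha> (\<lambda>z. H_op \<mu> (\<alpha> + 2) (F (r j)) z - H_op \<mu> (\<alpha> + 2) f z)
            = bergman_integral q \<alpha> (H_op \<mu> (\<alpha> + 2) (h j))"
          unfolding h_def using h[of j]
          by (intro bergman_integral_cong H_op_diff cs F f b) (auto simp: h_def)
        also have "\<dots> \<le> ennreal C * (\<Sum>n. ennreal (v n * x j n powr q))"
          unfolding x_def by (rule C(2)[OF h])
        finally have 1: "bergman_integral q \<alpha> (\<lambda>z. H_op \<mu> (\<alpha> + 2) (F (r j)) z - H_op \<mu> (\<alpha> + 2) f z)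
          \<le> ennreal C * (\<Sum>n. ennreal (v n * x j n powr q))" .
        have "(\<Sum>n. ennreal (v n * x j n powr q)) \<le> (\<Sum>n. ennreal (if n < N then v n * x j n powr q else 0) + ennreal \<eta> * ennreal (x j n powr q))"
        proof (intro suminf_le)
          fix n
          show "ennreal (v n * x j n powr q) \<le> ennreal (if n < N then v n * x j n powr q else 0) + ennreal \<eta> * ennreal (x j n powr q)"
          proof (cases "n < N")
            case False
            then show ?thesis using N[of n] \<eta>
              by (auto simp: ennreal_mult'[symmetric] intro!: ennreal_leI mult_right_mono)
          qed simp
        qed auto
        also have "\<dots> = (\<Sum>n. ennreal (if n < N then v n * x j n powr q else 0)) + ennreal \<eta> * (\<Sum>n. ennreal (x j n powr q))"
          by (simp add: suminf_add[symmetric])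
        also have "(\<Sum>n. ennreal (if n < N then v n * x j n powr q else 0)) = (\<Sum>n<N. ennreal (v n * x j n powr q))"
          by (subst suminf_finite[of "{..<N}"]) auto
        also have "\<dots> = ennreal (\<Sum>n<N. v n * x j n powr q)"
          using v(1) by (intro sum_ennreal) auto
        finally have "ennreal C * (\<Sum>n. ennreal (v n * x j n powr q))
          \<le> ennreal C * (ennreal (\<Sum>n<N. v n * x j n powr q) + ennreal \<eta> * (\<Sum>n. ennreal (x j n powr q)))"
          by (rule mult_left_mono) simp
        with 1 have "bergman_integral q \<alpha> (\<lambda>z. H_op \<mu> (\<alpha> + 2) (F (r j)) z - H_op \<mu> (\<alpha> + 2) f z)
          \<le> ennreal C * (ennreal (\<Sum>n<N. v n * x j n powr q) + ennreal \<eta> * (\<Sum>n. ennreal (x j n powr q)))"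
          by (rule order_trans)
        also have "\<dots> \<le> ennreal C * (ennreal (e / (2 * C)) + ennreal \<eta> * ennreal (W R))"
          using j by (intro mult_left_mono add_mono ennreal_leI xsum) auto
        also have "\<dots> = ennreal (C * (e / (2 * C) + \<eta> * W R))"
        proof -
          have "ennreal \<eta> * ennreal (W R) = ennreal (\<eta> * W R)" using \<eta> by (simp add: ennreal_mult')
          moreover have "ennreal (e / (2 * C)) + ennreal (\<eta> * W R) = ennreal (e / (2 * C) + \<eta> * W R)"
            using C(1) e \<eta> W(1)[of R] by (intro ennreal_plus[symmetric]) auto
          ultimately show ?thesis using C(1) by (simp only: ennreal_mult'[symmetric, OF less_imp_le])
        qed
        also have "\<dots> \<le> ennreal e"
          using \<eta>e C(1) by (intro ennreal_leI) (simp add: distrib_left)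
        finally show "bergman_integral q \<alpha> (\<lambda>z. H_op \<mu> (\<alpha> + 2) (F (r j)) z - H_op \<mu> (\<alpha> + 2) f z) \<le> ennreal e" .
      qed
    qed
    have "(\<lambda>j. bergman_norm q \<alpha> (\<lambda>z. H_op \<mu> (\<alpha> + 2) (F (r j)) z - H_op \<mu> (\<alpha> + 2) f z)) \<longlonglongrightarrow> 0"
      by (rule bergman_norm_tendsto_0[OF ev]) (use q \<alpha> in auto)
    then show ?thesis using r maps[OF f(1)] by blast
  qed
  show ?thesis
    unfolding H_compact_def using H_defined[OF cs b] maps comp by blast
qed

text \<open>With s = (\<alpha>+2)/p + (\<alpha>+2)/q', the growth 2^(n(\<alpha>+2)/p) of f on the
  n-th interval equals 2^(ns) times the factor 2^(-n(\<alpha>+2)/q') that the convolution bound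
  expects. The masses therefore enter through 2^(ns) \<open>mass n\<close>, and the weights are the
  q-th powers of these numbers.\<close>

lemma (in interval_measure) H_compact_gt_1:
  assumes p: "0 < p" and \<alpha>: "\<alpha> > -1" and q: "1 < q" "p \<le> q"
    and lim: "(\<lambda>n. mass n * 2 powr (real n * ((\<alpha> + 2) / p + (\<alpha> + 2) * (1 - 1/q)))) \<longlonglongrightarrow> 0"
  shows "H_compact \<mu> (\<alpha> + 2) p \<alpha> q"
proof -
  define b where "b = \<alpha> + 2"
  have b: "b > 1" using \<alpha> by (simp add: b_def)
  define s where "s = b / p + b * (1 - 1/q)"
  define m where "m = (\<lambda>n. mass n)"
  have lim': "(\<lambda>n. m n * 2 powr (real n * s)) \<longlonglongrightarrow> 0" using lim by (simp add: m_def s_def b_def)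
  obtain C where C: "C > 0" "\<And>u G. (\<And>n. 0 \<le> u n) \<Longrightarrow>
    (\<And>m z. z \<in> shell m \<Longrightarrow> ennreal (norm (G z)) \<le>
       (\<Sum>n. ennreal (2 powr (\<alpha> + 2) * u n * 2 powr ((\<alpha> + 2) * real (min n m) - real n * ((\<alpha> + 2) * (1 - 1/q)))))) \<Longrightarrow>
    bergman_integral q \<alpha> G \<le> ennreal C * (\<Sum>n. ennreal (u n powr q))"
    using dyadic_bound_gt_1[OF \<alpha> q(1)] by blast
  have adm: "admissible p \<alpha> s"
  proof (cases "p \<le> 1")
    case True
    then show ?thesis using b q by (simp add: admissible_def s_def b_def)
  next
    case False
    \<comment> \<open>For p > 1 admissibility reduces to 1 - 1/p < b (1 - 1/q). This follows from p
      \<le> q together with b > 1 and q > 1, the latter two giving strictness.\<close>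
    have "1/q \<le> 1/p" using q p by (intro divide_left_mono) auto
    then have "1 - 1/p \<le> 1 - 1/q" by simp
    also have "\<dots> < b * (1 - 1/q)" using b q by simp
    finally have "1 - 1/p < b * (1 - 1/q)" .
    moreover have "b / p = (\<alpha> + 1) / p + 1/p" by (simp add: b_def add_divide_distrib)
    ultimately show ?thesis using False by (simp add: admissible_def s_def)
  qed
  obtain K where K: "\<And>n. m n * 2 powr (real n * s) \<le> K"
    using convergent_imp_Bseq[OF convergentI[OF lim']] by (auto simp: Bseq_def abs_le_iff)
  have K': "m n \<le> K * 2 powr (- (real n * s))" for n
    using K[of n] by (simp add: powr_minus field_simps)
  have cs: "coeff_summable f" if "f \<in> bergman_space p \<alpha>" for f
    using K' by (intro coeff_summable_bergman[OF p \<alpha> adm that]) (simp add: m_def)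
  show ?thesis
  proof (rule H_compact_of_weights[OF p \<alpha> _ q(2) cs])
    show "1 \<le> q" using q by simp
    show "0 \<le> (m n * 2 powr (real n * s)) powr q" for n by simp
    have "(\<lambda>n. (m n * 2 powr (real n * s)) powr q) \<longlonglongrightarrow> 0 powr q"
      using q by (intro tendsto_powr' lim' tendsto_const) (auto simp: m_def intro!: always_eventually)
    then show "(\<lambda>n. (m n * 2 powr (real n * s)) powr q) \<longlonglongrightarrow> 0" by simp
    show "C > 0" by (rule C(1))
    fix f assume f: "f \<in> bergman_space p \<alpha>"
    then have hol: "f holomorphic_on ball 0 1" by (simp add: bergman_space_def)
    define x where "x = dyadic_sup p \<alpha> f"
    have x: "x n \<ge> 0" for n unfolding x_def by (rule dyadic_sup_nonneg[OF hol])
    define u where "u = (\<lambda>n. m n * 2 powr (real n * s) * x n)"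
    have "bergman_integral q \<alpha> (H_op \<mu> (\<alpha> + 2) f) \<le> ennreal C * (\<Sum>n. ennreal (u n powr q))"
    proof (rule C(2))
      show "0 \<le> u n" for n using x by (simp add: u_def m_def)
      fix k z assume z: "z \<in> shell k"
      have "ennreal (norm (H_op \<mu> (\<alpha> + 2) f z)) \<le> (\<Sum>n. ennreal (2 powr (\<alpha> + 2) * (2 powr (real n * (\<alpha> + 2) / p) * x n * mass n) * 2 powr ((\<alpha> + 2) * real (min n k))))"
        unfolding x_def using b
        by (intro norm_H_op_shell[OF cs[OF f] _ z] norm_le_dyadic_sup hol) (auto simp: b_def)
      also have "(\<lambda>n. 2 powr (\<alpha> + 2) * (2 powr (real n * (\<alpha> + 2) / p) * x n * mass n) * 2 powr ((\<alpha> + 2) * real (min n k)))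
        = (\<lambda>n. 2 powr (\<alpha> + 2) * u n * 2 powr ((\<alpha> + 2) * real (min n k) - real n * ((\<alpha> + 2) * (1 - 1/q))))"
      proof
        fix n
        have 1: "2 powr ((\<alpha> + 2) * real (min n k) - real n * (b * (1 - 1/q)))
           = 2 powr ((\<alpha> + 2) * real (min n k)) * 2 powr (- (real n * (b * (1 - 1/q))))"
          by (subst powr_add[symmetric]) simp
        have 2: "2 powr (real n * (\<alpha> + 2) / p) = 2 powr (real n * s) * 2 powr (- (real n * (b * (1 - 1/q))))"
          by (subst powr_add[symmetric]) (simp add: s_def b_def algebra_simps)
        show "2 powr (\<alpha> + 2) * (2 powr (real n * (\<alpha> + 2) / p) * x n * mass n) * 2 powr ((\<alpha> + 2) * real (min n k))
          = 2 powr (\<alpha> + 2) * u n * 2 powr ((\<alpha> + 2) * real (min n k) - real n * ((\<alpha> + 2) * (1 - 1/q)))"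
          unfolding 1[unfolded b_def] 2 by (simp only: u_def m_def b_def mult_ac)
      qed
      finally show "ennreal (norm (H_op \<mu> (\<alpha> + 2) f z)) \<le> (\<Sum>n. ennreal (2 powr (\<alpha> + 2) * u n * 2 powr ((\<alpha> + 2) * real (min n k) - real n * ((\<alpha> + 2) * (1 - 1/q)))))" .
    qed
    also have "(\<lambda>n. u n powr q) = (\<lambda>n. (m n * 2 powr (real n * s)) powr q * dyadic_sup p \<alpha> f n powr q)"
      by (simp add: u_def x_def powr_mult)
    finally show "bergman_integral q \<alpha> (H_op \<mu> (\<alpha> + 2) f) \<le> ennreal C * (\<Sum>n. ennreal ((m n * 2 powr (real n * s)) powr q * dyadic_sup p \<alpha> f n powr q))" .
  qed
qed

text \<open>Since p \<le> 1, the exponent (\<alpha>+2)/p is itself admissible. The weights are now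
  (n+1) 2^(ns) \<open>mass n\<close>, with the factor n+1 coming from the non-decaying side of the
  kernel.\<close>

lemma (in interval_measure) H_compact_1:
  assumes p: "0 < p" "p \<le> 1" and \<alpha>: "\<alpha> > -1"
    and lim: "(\<lambda>n. (real n + 1) * (mass n * 2 powr (real n * ((\<alpha> + 2) / p)))) \<longlonglongrightarrow> 0"
  shows "H_compact \<mu> (\<alpha> + 2) p \<alpha> 1"
proof -
  define s where "s = (\<alpha> + 2) / p"
  define m where "m = (\<lambda>n. mass n)"
  have m0: "0 \<le> m n" for n by (simp add: m_def)
  have lim': "(\<lambda>n. (real n + 1) * (m n * 2 powr (real n * s))) \<longlonglongrightarrow> 0" using lim by (simp add: m_def s_def)
  obtain C where C: "C > 0" "\<And>u G. (\<And>n. 0 \<le> u n) \<Longrightarrow>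
    (\<And>m z. z \<in> shell m \<Longrightarrow> ennreal (norm (G z)) \<le>
       (\<Sum>n. ennreal (2 powr (\<alpha> + 2) * u n * 2 powr ((\<alpha> + 2) * real (min n m))))) \<Longrightarrow>
    bergman_integral 1 \<alpha> G \<le> ennreal C * (\<Sum>n. ennreal ((real n + 1) * u n))"
    using dyadic_bound_1[OF \<alpha>] by blast
  have adm: "admissible p \<alpha> s" using p by (simp add: admissible_def s_def)
  obtain K where K: "\<And>n. (real n + 1) * (m n * 2 powr (real n * s)) \<le> K"
    using convergent_imp_Bseq[OF convergentI[OF lim']] by (auto simp: Bseq_def abs_le_iff)
  have K': "m n \<le> K * 2 powr (- (real n * s))" for n
  proof -
    have "1 * (m n * 2 powr (real n * s)) \<le> (real n + 1) * (m n * 2 powr (real n * s))"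
      using m0 by (intro mult_right_mono) auto
    then have "m n * 2 powr (real n * s) \<le> K" using K[of n] by linarith
    then show ?thesis by (simp add: powr_minus field_simps)
  qed
  have cs: "coeff_summable f" if "f \<in> bergman_space p \<alpha>" for f
    using K' by (intro coeff_summable_bergman[OF p(1) \<alpha> adm that]) (simp add: m_def)
  show ?thesis
  proof (rule H_compact_of_weights[OF p(1) \<alpha> order_refl p(2) cs])
    show "0 \<le> (real n + 1) * (m n * 2 powr (real n * s))" for n using m0 by simp
    show "(\<lambda>n. (real n + 1) * (m n * 2 powr (real n * s))) \<longlonglongrightarrow> 0" by (rule lim')
    show "C > 0" by (rule C(1))
    fix f assume f: "f \<in> bergman_space p \<alpha>"
    then have hol: "f holomorphic_on ball 0 1" by (simp add: bergman_space_def)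
    define x where "x = dyadic_sup p \<alpha> f"
    have x: "x n \<ge> 0" for n unfolding x_def by (rule dyadic_sup_nonneg[OF hol])
    have "bergman_integral 1 \<alpha> (H_op \<mu> (\<alpha> + 2) f) \<le> ennreal C * (\<Sum>n. ennreal ((real n + 1) * (2 powr (real n * (\<alpha> + 2) / p) * x n * m n)))"
    proof (rule C(2))
      show "0 \<le> 2 powr (real n * (\<alpha> + 2) / p) * x n * m n" for n using x m0 by simp
      fix k z assume z: "z \<in> shell k"
      show "ennreal (norm (H_op \<mu> (\<alpha> + 2) f z)) \<le> (\<Sum>n. ennreal (2 powr (\<alpha> + 2) * (2 powr (real n * (\<alpha> + 2) / p) * x n * m n) * 2 powr ((\<alpha> + 2) * real (min n k))))"
        unfolding x_def m_def using \<alpha>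
        by (intro norm_H_op_shell[OF cs[OF f] _ z] norm_le_dyadic_sup hol) auto
    qed
    also have "(\<lambda>n. (real n + 1) * (2 powr (real n * (\<alpha> + 2) / p) * x n * m n))
       = (\<lambda>n. (real n + 1) * (m n * 2 powr (real n * s)) * dyadic_sup p \<alpha> f n powr 1)"
      using x by (simp add: x_def s_def mult_ac)
    finally show "bergman_integral 1 \<alpha> (H_op \<mu> (\<alpha> + 2) f) \<le> ennreal C * (\<Sum>n. ennreal ((real n + 1) * (m n * 2 powr (real n * s)) * dyadic_sup p \<alpha> f n powr 1))" .
  qed
qed

section \<open>Necessity\<close>

text \<open>The exponent c is a natural number, so no branch of a power has to be chosen; later it
  is taken with c p > \<alpha> + 2. With the normalising factor the function has size about
  2^(n(\<alpha>+2)/p) on [1-2^-n, 1), the largest order that the pointwise growth estimate allows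
  there.\<close>

definition test_fun :: "real \<Rightarrow> real \<Rightarrow> nat \<Rightarrow> nat \<Rightarrow> complex \<Rightarrow> complex" where
  "test_fun p \<alpha> c n z = of_real (2 powr (- (real n * (real c - (\<alpha> + 2) / p)))) / (1 - of_real (1 - (1/2) ^ n) * z) ^ c"

text \<open>With h = 2^-n a zero of the denominator would need (1-h)|z| = 1, but (1-h)(1+h) < 1.
  Holomorphy beyond the closed unit disc makes the Taylor coefficients absolutely summable.\<close>

lemma test_fun_holomorphic: "test_fun p \<alpha> c n holomorphic_on ball 0 (1 + (1/2) ^ n)"
proof -
  have "1 - of_real (1 - (1/2) ^ n) * z \<noteq> 0" if "z \<in> ball 0 (1 + (1/2) ^ n)" for z :: complex
  proof
    define h :: real where "h = (1/2) ^ n"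
    have h: "0 < h" "h \<le> 1" by (auto simp: h_def power_le_one)
    assume "1 - of_real (1 - (1/2) ^ n) * z = 0"
    then have "norm (complex_of_real (1 - h) * z) = 1" by (simp add: h_def)
    then have "(1 - h) * norm z = 1" using h by (simp add: norm_mult del: of_real_diff)
    moreover have "(1 - h) * norm z \<le> (1 - h) * (1 + h)"
      using that h by (intro mult_left_mono) (auto simp: h_def)
    ultimately have "h * h \<le> 0" by (simp add: algebra_simps)
    then show False using h by (simp add: mult_le_0_iff)
  qed
  then show ?thesis unfolding test_fun_def by (intro holomorphic_intros) auto
qed

lemma left_endpoint_in_dyadic: "1 - (1/2) ^ n \<in> dyadic_interval n"
  using half_power_antimono[of n "Suc n"] by (simp add: dyadic_interval_def)

lemma norm_test_fun_powr:
  assumes p: "p > 0" and c: "c > 0"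
  shows "norm (test_fun p \<alpha> c n z) powr p
     = 2 powr (- (real n * (real c * p - (\<alpha> + 2)))) * norm (1 - of_real (1 - (1/2) ^ n) * z) powr (- (real c * p))"
proof -
  define w where "w = norm (1 - of_real (1 - (1/2) ^ n) * z)"
  have "norm (test_fun p \<alpha> c n z) powr p = (2 powr (- (real n * (real c - (\<alpha> + 2) / p))) / w ^ c) powr p"
    by (simp add: test_fun_def norm_divide norm_power w_def)
  also have "\<dots> = (2 powr (- (real n * (real c - (\<alpha> + 2) / p)))) powr p / (w ^ c) powr p"
    by (simp add: powr_divide)
  also have "(2 powr (- (real n * (real c - (\<alpha> + 2) / p)))) powr p = 2 powr (- (real n * (real c * p - (\<alpha> + 2))))"
  proof -
    have "- (real n * (real c - (\<alpha> + 2) / p)) * p = - (real n * (real c * p - (\<alpha> + 2)))"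
      using p by (simp add: field_simps)
    then show ?thesis by (simp only: powr_powr)
  qed
  also have "(w ^ c) powr p = w powr (real c * p)"
  proof (cases "w = 0")
    case True
    then show ?thesis using p c by simp
  next
    case False
    then have "w > 0" by (simp add: w_def)
    then show ?thesis by (simp add: powr_realpow[symmetric] powr_powr)
  qed
  finally show ?thesis by (simp only: w_def powr_minus divide_inverse)
qed

text \<open>On shell m the p-th power of the modulus, multiplied by the weighted area of the shell,
  decays geometrically in |n-m|: at rate \<alpha>+2 for m > n and at rate c p - (\<alpha>+2) for m <
  n. The lower bound on c makes the second rate positive, so the sum over shells is bounded
  uniformly in n.\<close>

lemma test_fun_bounded:
  assumes p: "0 < p" and \<alpha>: "\<alpha> > -1" and c: "real c * p > \<alpha> + 2"
  obtains B where "\<And>n. test_fun p \<alpha> c n \<in> bergman_space p \<alpha>" "\<And>n. bergman_norm p \<alpha> (test_fun p \<alpha> c n) \<le> B"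
proof -
  obtain C where C: "C > 0" "\<And>q G c. (\<And>m z. z \<in> shell m \<Longrightarrow> ennreal (norm (G z) powr q) \<le> c m) \<Longrightarrow>
    bergman_integral q \<alpha> G \<le> ennreal C * (\<Sum>m. c m * ennreal (2 powr (- (real m * (\<alpha> + 2)))))"
    using bergman_integral_shell_bound[OF \<alpha>] by blast
  define b where "b = \<alpha> + 2"
  define e where "e = real c * p"
  have be: "b > 1" "e > b" using \<alpha> c by (auto simp: b_def e_def)
  have c0: "c > 0" using be p by (cases c) (auto simp: e_def)
  define \<epsilon> where "\<epsilon> = min b (e - b)"
  have \<epsilon>: "\<epsilon> > 0" "\<epsilon> \<le> b" "\<epsilon> \<le> e - b" using be by (auto simp: \<epsilon>_def)
  define S where "S = 2 / (1 - 2 powr (- \<epsilon>))"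
  have S: "S > 0" using \<epsilon> by (simp add: S_def powr_less_one)
  define B where "B = C * (2 powr e * S)"
  have B0: "B \<ge> 0" using C(1) S by (simp add: B_def)
  have expo: "- (real n * (e - b)) + e * real (min n m) - real m * b \<le> - (\<epsilon> * real ((n - m) + (m - n)))" for n m
  proof (cases "n \<le> m")
    case True
    then have "\<epsilon> * (real m - real n) \<le> b * (real m - real n)" using \<epsilon> by (intro mult_right_mono) auto
    then show ?thesis using True by (simp add: of_nat_diff algebra_simps)
  next
    case False
    then have "\<epsilon> * (real n - real m) \<le> (e - b) * (real n - real m)" using \<epsilon> by (intro mult_right_mono) auto
    then show ?thesis using False by (simp add: of_nat_diff algebra_simps)
  qed
  have I: "bergman_integral p \<alpha> (test_fun p \<alpha> c n) \<le> ennreal B" for n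
  proof -
    have "bergman_integral p \<alpha> (test_fun p \<alpha> c n) \<le> ennreal C * (\<Sum>m. ennreal (2 powr (- (real n * (e - b))) * (2 powr e * 2 powr (e * real (min n m)))) * ennreal (2 powr (- (real m * (\<alpha> + 2)))))"
    proof (rule C(2))
      fix m z assume z: "z \<in> shell m"
      have "norm (test_fun p \<alpha> c n z) powr p = 2 powr (- (real n * (e - b))) * norm (1 - of_real (1 - (1/2) ^ n) * z) powr (- e)"
        unfolding norm_test_fun_powr[OF p c0] e_def b_def ..
      also have "\<dots> \<le> 2 powr (- (real n * (e - b))) * (2 powr e * 2 powr (e * real (min n m)))"
        using be by (intro mult_left_mono kernel_powr_bound left_endpoint_in_dyadic z) auto
      finally show "ennreal (norm (test_fun p \<alpha> c n z) powr p) \<le> ennreal (2 powr (- (real n * (e - b))) * (2 powr e * 2 powr (e * real (min n m))))"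
        by (rule ennreal_leI)
    qed
    also have "\<dots> \<le> ennreal C * (\<Sum>m. ennreal (2 powr e) * ennreal (kernel \<epsilon> n m))"
    proof (intro mult_left_mono suminf_le)
      fix m
      have "2 powr (- (real n * (e - b))) * (2 powr e * 2 powr (e * real (min n m))) * 2 powr (- (real m * b))
         = 2 powr e * 2 powr (- (real n * (e - b)) + e * real (min n m) - real m * b)"
        by (simp add: powr_add powr_diff powr_minus divide_inverse)
      also have "\<dots> \<le> 2 powr e * kernel \<epsilon> n m"
        unfolding kernel_def using expo[of n m] by (intro mult_left_mono powr_mono) auto
      finally show "ennreal (2 powr (- (real n * (e - b))) * (2 powr e * 2 powr (e * real (min n m)))) * ennreal (2 powr (- (real m * (\<alpha> + 2))))
         \<le> ennreal (2 powr e) * ennreal (kernel \<epsilon> n m)"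
        unfolding b_def[symmetric] by (subst (1 2) ennreal_mult''[symmetric]) (auto intro!: ennreal_leI)
    qed auto
    also have "\<dots> = ennreal C * (ennreal (2 powr e) * (\<Sum>m. ennreal (kernel \<epsilon> n m)))" by simp
    also have "\<dots> \<le> ennreal C * (ennreal (2 powr e) * ennreal S)"
      unfolding S_def using \<epsilon> by (intro mult_left_mono kernel_sum) auto
    also have "\<dots> = ennreal B" using C(1) S by (simp add: B_def ennreal_mult')
    finally show ?thesis .
  qed
  show ?thesis
  proof (rule that)
    fix n
    have "test_fun p \<alpha> c n holomorphic_on ball 0 1"
      by (rule holomorphic_on_subset[OF test_fun_holomorphic], rule subset_ball) simp
    moreover have "bergman_integral p \<alpha> (test_fun p \<alpha> c n) < \<infinity>" using I[of n] by (rule le_less_trans) simp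
    ultimately show "test_fun p \<alpha> c n \<in> bergman_space p \<alpha>" by (simp add: bergman_space_def)
    have "enn2real (bergman_integral p \<alpha> (test_fun p \<alpha> c n)) \<le> B"
      using I[of n] B0 by (intro enn2real_leI)
    then show "bergman_norm p \<alpha> (test_fun p \<alpha> c n) \<le> ((\<alpha> + 1) / pi * B) powr (1 / p)"
      unfolding bergman_norm_def using \<alpha> p by (intro powr_mono2 mult_left_mono) auto
  qed
qed

section \<open>Disjoint discs around the points 1 - 2^-m, and a subsequence criterion\<close>

abbreviation dyadic_ball :: "nat \<Rightarrow> complex set" where
  "dyadic_ball m \<equiv> ball (complex_of_real (1 - (1/2) ^ m)) ((1/2) ^ m / 4)"

text \<open>For m < n the centres are at least 2^-m / 2 apart, whereas the radii add up to at most
  (3/8) 2^-m. These are the discs of \<open>local_growth\<close> at the points 1 - 2^-m.\<close>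

lemma disjoint_dyadic_balls:
  "disjoint_family dyadic_ball"
  unfolding disjoint_family_on_def
proof (intro ballI impI)
  have *: "dyadic_ball m \<inter> dyadic_ball n = {}"
    if "m < n" for m n :: nat
  proof -
    have 1: "(1/2::real) ^ n \<le> (1/2) ^ m / 2" using half_power_antimono[of "Suc m" n] that by simp
    have 2: "(0::real) < (1/2) ^ m" by simp
    have "dist (complex_of_real (1 - (1/2) ^ m)) (complex_of_real (1 - (1/2) ^ n)) = \<bar>(1/2) ^ n - (1/2) ^ m\<bar>"
      unfolding dist_of_real dist_real_def by simp
    then have "(1/2) ^ m / 4 + (1/2) ^ n / 4 \<le> dist (complex_of_real (1 - (1/2) ^ m)) (complex_of_real (1 - (1/2) ^ n))"
      using 1 2 by linarith
    then show ?thesis by (rule disjoint_ballI)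
  qed
  fix m n :: nat assume "m \<noteq> n"
  then show "dyadic_ball m \<inter> dyadic_ball n = {}"
    using *[of m n] *[of n m] by (cases "m < n") auto
qed

lemma dyadic_ball_sum_le:
  assumes "f holomorphic_on ball 0 1" "q > 0"
  shows "(\<Sum>m. emeasure (bergman_measure q \<alpha> f) (dyadic_ball m)) \<le> bergman_integral q \<alpha> f"
  by (subst suminf_emeasure) (use disjoint_dyadic_balls emeasure_bergman_measure_le[OF assms] in auto)

text \<open>Compactness yields convergence only along subsequences, and this passes from there to
  the full sequence. If convergence failed, some subsequence would stay away from 0, and so would
  every further subsequence of it.\<close>

lemma tendsto_0_of_subseq:
  fixes x :: "nat \<Rightarrow> real"
  assumes "\<And>\<phi> :: nat \<Rightarrow> nat. strict_mono \<phi> \<Longrightarrow> \<exists>r :: nat \<Rightarrow> nat. strict_mono r \<and> (\<lambda>j. x (\<phi> (r j))) \<longlonglongrightarrow> 0"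
  shows "x \<longlonglongrightarrow> 0"
proof (rule tendstoI, rule ccontr)
  fix e :: real assume e: "e > 0" and "\<not> (\<forall>\<^sub>F n in sequentially. dist (x n) 0 < e)"
  then have "infinite {n. e \<le> \<bar>x n\<bar>}"
    by (simp add: cofinite_eq_sequentially[symmetric] eventually_cofinite not_less)
  then obtain \<phi> :: "nat \<Rightarrow> nat" where \<phi>: "strict_mono \<phi>" "\<And>n. e \<le> \<bar>x (\<phi> n)\<bar>"
    using infinite_enumerate[of "{n. e \<le> \<bar>x n\<bar>}"] by auto
  obtain r :: "nat \<Rightarrow> nat" where r: "(\<lambda>j. x (\<phi> (r j))) \<longlonglongrightarrow> 0" using assms[OF \<phi>(1)] by blast
  from tendstoD[OF r e] have "\<forall>\<^sub>F j in sequentially. False"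
    by (rule eventually_mono) (use \<phi>(2) in \<open>auto simp: not_less[symmetric]\<close>)
  then show False by simp
qed

section \<open>Images of the test functions and the consequences of compactness\<close>

context interval_measure
begin

text \<open>The Taylor coefficients are absolutely summable at radius 1, so the series is bounded on
  [0,1), and a finite measure integrates it.\<close>

lemma coeff_summable_larger_disc:
  assumes hol: "f holomorphic_on ball 0 r" and r: "r > 1"
  shows "coeff_summable f"
proof -
  have s: "summable (\<lambda>k. norm (taylor_coeff f k))"
    using taylor_abs_summable[OF hol, of 1] r by simp
  have "(\<integral>\<^sup>+t\<in>{0..<1}. (\<Sum>k. ennreal (norm (taylor_coeff f k) * t ^ k)) \<partial>\<mu>) \<le> (\<integral>\<^sup>+t. (\<Sum>k. ennreal (norm (taylor_coeff f k))) \<partial>\<mu>)"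
  proof (rule nn_integral_mono, goal_cases)
    case (1 t)
    have "norm (taylor_coeff f k) * t ^ k \<le> norm (taylor_coeff f k)" if "t \<in> {0..<1}" for k
      using that by (intro mult_left_le) (auto simp: power_le_one)
    then show ?case by (auto simp: indicator_def intro!: suminf_le ennreal_leI)
  qed
  also have "\<dots> = ennreal (\<Sum>k. norm (taylor_coeff f k)) * emeasure \<mu> (space \<mu>)"
    using s by (simp add: suminf_ennreal2)
  also have "\<dots> < \<infinity>" by (simp add: ennreal_mult_less_top emeasure_eq_measure)
  finally show ?thesis
    using holomorphic_on_subset[OF hol, of "ball 0 1"] r by (simp add: coeff_summable_def subset_ball)
qed

lemma coeff_summable_test_fun: "coeff_summable (test_fun p \<alpha> c n)"
  by (rule coeff_summable_larger_disc[OF test_fun_holomorphic]) simp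

text \<open>At a real point the integrand is nonnegative, so the integral may be restricted to
  [1-2^-n, 1). There the base of the test function is at most 2 * 2^-n, and because m \<le> n the
  base of the kernel is at most 2^-n + 2^-m \<le> 2 * 2^-m.\<close>

lemma test_fun_lower_bound:
  assumes p: "0 < p" and \<alpha>: "\<alpha> > -1" and mn: "m \<le> n"
  shows "2 powr (- (real c + \<alpha> + 2)) * 2 powr (real n * ((\<alpha> + 2) / p)) * 2 powr (real m * (\<alpha> + 2)) * tail n
    \<le> norm (H_op \<mu> (\<alpha> + 2) (test_fun p \<alpha> c n) (of_real (1 - (1/2) ^ m)))"
proof -
  define b where "b = \<alpha> + 2"
  have b: "b > 1" using \<alpha> by (simp add: b_def)
  define hn hm :: real where "hn = (1/2) ^ n" and "hm = (1/2) ^ m"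
  have h: "0 < hn" "hn \<le> 1" "0 < hm" "hm \<le> 1" "hn \<le> hm"
    using half_power_antimono[OF mn] by (auto simp: hn_def hm_def power_le_one)
  define A where "A = 2 powr (- (real n * (real c - b / p)))"
  define g where "g = (\<lambda>t. A / (1 - (1 - hn) * t) ^ c * (1 - t * (1 - hm)) powr (- b))"
  have pos: "0 < 1 - (1 - hn) * t" "0 < 1 - t * (1 - hm)" if "0 \<le> t" "t < 1" for t
  proof -
    have "(1 - hn) * t \<le> t" "t * (1 - hm) \<le> t" using that h by (auto simp: mult_left_le_one_le mult_left_le)
    then show "0 < 1 - (1 - hn) * t" "0 < 1 - t * (1 - hm)" using that by linarith+
  qed
  have g0: "0 \<le> g t" if "0 \<le> t" "t < 1" for t using pos[OF that] by (simp add: g_def A_def)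
  have nz: "norm (complex_of_real (1 - hm)) < 1" unfolding norm_of_real using h by auto
  have eq: "test_fun p \<alpha> c n (of_real t) * (1 - of_real t * of_real (1 - hm)) powr (- of_real (\<alpha> + 2)) = of_real (g t)"
    if "0 \<le> t" "t < 1" for t
  proof -
    have "(1 - complex_of_real t * of_real (1 - hm)) powr (- of_real (\<alpha> + 2)) = of_real ((1 - t * (1 - hm)) powr (- b))"
      using pos(2)[OF that] by (simp add: powr_of_real[symmetric] b_def)
    then show ?thesis by (simp add: test_fun_def g_def A_def b_def hn_def)
  qed
  have int: "set_integrable \<mu> {0..<1} (\<lambda>t. test_fun p \<alpha> c n (of_real t) * (1 - of_real t * of_real (1 - hm)) powr (- of_real (\<alpha> + 2)))"
    using b by (intro H_op_sums(2)[OF coeff_summable_test_fun _ nz]) (simp add: b_def)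
  have eqI: "indicator {0..<1} t *\<^sub>R (test_fun p \<alpha> c n (of_real t) * (1 - of_real t * of_real (1 - hm)) powr (- of_real (\<alpha> + 2)))
      = complex_of_real (indicator {0..<1} t * g t)" for t
    using eq[of t] by (cases "t \<in> {0..<1}") simp_all
  have "integrable \<mu> (\<lambda>t. complex_of_real (indicator {0..<1} t * g t))"
    using int unfolding set_integrable_def eqI .
  from integrable_Re[OF this] have intg: "integrable \<mu> (\<lambda>t. indicator {0..<1} t * g t)"
    by (simp only: Re_complex_of_real)
  have "H_op \<mu> (\<alpha> + 2) (test_fun p \<alpha> c n) (of_real (1 - hm))
     = (LINT t:{0..<1}|\<mu>. test_fun p \<alpha> c n (of_real t) * (1 - of_real t * of_real (1 - hm)) powr (- of_real (\<alpha> + 2)))"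
    using b by (intro H_op_eq[OF coeff_summable_test_fun _ nz]) (simp add: b_def)
  also have "\<dots> = (\<integral>t. complex_of_real (indicator {0..<1} t * g t) \<partial>\<mu>)"
    unfolding set_lebesgue_integral_def eqI ..
  also have "\<dots> = of_real (\<integral>t. indicator {0..<1} t * g t \<partial>\<mu>)" by (rule integral_complex_of_real)
  finally have H: "norm (H_op \<mu> (\<alpha> + 2) (test_fun p \<alpha> c n) (of_real (1 - hm))) = \<bar>\<integral>t. indicator {0..<1} t * g t \<partial>\<mu>\<bar>"
    by simp
  define L where "L = 2 powr (- (real c + b)) * 2 powr (real n * (b / p)) * 2 powr (real m * b)"
  have gL: "L \<le> g t" if t: "1 - hn \<le> t" "t < 1" for t
  proof -
    have t0: "0 \<le> t" using t h by linarith
    note pos = pos[OF t0 t(2)]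
    have "(1 - hn) * (1 - hn) \<le> (1 - hn) * t" using t h by (intro mult_left_mono) auto
    then have "1 - (1 - hn) * t \<le> 1 - (1 - hn) * (1 - hn)" by simp
    also have "\<dots> = 2 * hn - hn * hn" by (simp add: algebra_simps)
    finally have 1: "1 - (1 - hn) * t \<le> 2 * hn" by (rule order_trans) simp
    have "(1 - hn) * (1 - hm) \<le> t * (1 - hm)" using t h by (intro mult_right_mono) auto
    then have "1 - t * (1 - hm) \<le> 1 - (1 - hn) * (1 - hm)" by simp
    also have "\<dots> = hn + hm - hn * hm" by (simp add: algebra_simps)
    also have "\<dots> \<le> hn + hm" using h by simp
    finally have 2: "1 - t * (1 - hm) \<le> 2 * hm" using h by linarith
    have "(2 * hn) powr (- real c) \<le> (1 - (1 - hn) * t) powr (- real c)"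
      using pos 1 by (intro powr_mono2') auto
    also have "\<dots> = 1 / (1 - (1 - hn) * t) ^ c"
      using pos by (simp add: powr_minus powr_realpow divide_inverse)
    also have "(2 * hn) powr (- real c) = 2 powr (- real c) * 2 powr (real n * real c)"
      unfolding hn_def half_power_powr by (simp add: powr_mult powr_powr)
    finally have 3: "A * (2 powr (- real c) * 2 powr (real n * real c)) \<le> A / (1 - (1 - hn) * t) ^ c"
      unfolding divide_inverse by (intro mult_left_mono) (auto simp: A_def divide_inverse)
    have "(2 * hm) powr (- b) \<le> (1 - t * (1 - hm)) powr (- b)"
      using pos 2 b by (intro powr_mono2') auto
    also have "(2 * hm) powr (- b) = 2 powr (- b) * 2 powr (real m * b)"
      unfolding hm_def half_power_powr by (simp add: powr_mult powr_powr)
    finally have 4: "2 powr (- b) * 2 powr (real m * b) \<le> (1 - t * (1 - hm)) powr (- b)" .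
    have "A * 2 powr (real n * real c) = 2 powr (real n * (b / p))"
      unfolding A_def by (subst powr_add[symmetric]) (simp add: algebra_simps)
    moreover have "2 powr (- (real c + b)) = 2 powr (- real c) * 2 powr (- b)"
      by (subst powr_add[symmetric]) simp
    ultimately have "L = (A * (2 powr (- real c) * 2 powr (real n * real c))) * (2 powr (- b) * 2 powr (real m * b))"
      unfolding L_def by simp
    also have "\<dots> \<le> g t" unfolding g_def
      using 3 4 pos by (intro mult_mono) (auto simp: A_def)
    finally show ?thesis .
  qed
  have "L * measure \<mu> {1 - hn..<1} = (\<integral>t. L * indicator {1 - hn..<1} t \<partial>\<mu>)" by simp
  also have "\<dots> \<le> (\<integral>t. indicator {0..<1} t * g t \<partial>\<mu>)"
  proof (rule integral_mono[OF _ intg])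
    show "integrable \<mu> (\<lambda>t. L * indicator {1 - hn..<1} t)"
      by (intro integrable_mult_right integrable_real_indicator) (auto simp: emeasure_eq_measure)
    show "L * indicator {1 - hn..<1} t \<le> indicator {0..<1} t * g t" for t
      using gL[of t] g0[of t] h by (auto simp: indicator_def)
  qed
  finally have "L * measure \<mu> {1 - hn..<1} \<le> norm (H_op \<mu> (\<alpha> + 2) (test_fun p \<alpha> c n) (of_real (1 - hm)))"
    unfolding H by linarith
  then show ?thesis by (simp add: L_def hn_def hm_def b_def add.assoc)
qed

text \<open>Write the image as the difference to g plus g and apply the local growth estimate to
  both at the points 1 - 2^-m. The discs are disjoint, so the difference contributes at most its
  full integral, whatever M is. The contribution of g is left as a sum over M, because the index
  sets used later push it into the end of a convergent series. A general set M covers the single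
  index and the block of indices needed later.\<close>

lemma test_fun_sum_bound:
  assumes p: "0 < p" and \<alpha>: "\<alpha> > -1" and q: "q > 0"
  obtains K where "K > 0" "\<And>n M g. finite M \<Longrightarrow> M \<subseteq> {..n} \<Longrightarrow> g \<in> bergman_space q \<alpha> \<Longrightarrow>
    H_op \<mu> (\<alpha> + 2) (test_fun p \<alpha> c n) \<in> bergman_space q \<alpha> \<Longrightarrow>
    (\<Sum>m\<in>M. test_term p \<alpha> q n m)
     \<le> K * (enn2real (bergman_integral q \<alpha> (\<lambda>z. H_op \<mu> (\<alpha> + 2) (test_fun p \<alpha> c n) z - g z))
         + (\<Sum>m\<in>M. enn2real (emeasure (bergman_measure q \<alpha> g) (dyadic_ball m))))"
proof -
  obtain C where C: "C > 0" "\<And>f z. f holomorphic_on ball 0 1 \<Longrightarrow> norm z < 1 \<Longrightarrow>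
     ennreal (norm (f z) powr q * (1 - norm z) powr (\<alpha> + 2))
       \<le> ennreal C * emeasure (bergman_measure q \<alpha> f) (ball z ((1 - norm z) / 4))"
    using local_growth[OF q] by blast
  define k where "k = (2 powr (- (real c + \<alpha> + 2))) powr q"
  have k: "k > 0" by (simp add: k_def)
  define D where "D = dyadic_ball"
  show ?thesis
  proof (rule that)
    show "2 powr q * C / k > 0" using C(1) k by simp
    fix n M g
    assume M: "finite M" "M \<subseteq> {..n}" and g: "g \<in> bergman_space q \<alpha>"
      and Hf: "H_op \<mu> (\<alpha> + 2) (test_fun p \<alpha> c n) \<in> bergman_space q \<alpha>"
    define H where "H = H_op \<mu> (\<alpha> + 2) (test_fun p \<alpha> c n)"
    define d where "d = (\<lambda>z. H z - g z)"
    have d: "d \<in> bergman_space q \<alpha>" unfolding d_def H_def by (intro bergman_space_diff Hf g q)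
    have hol: "d holomorphic_on ball 0 1" "g holomorphic_on ball 0 1" using d g by (auto simp: bergman_space_def)
    define E where "E = (\<lambda>f m. enn2real (emeasure (bergman_measure q \<alpha> f) (D m)))"
    have E: "emeasure (bergman_measure q \<alpha> f) (D m) = ennreal (E f m)" if "f \<in> bergman_space q \<alpha>" for f m
    proof -
      have "emeasure (bergman_measure q \<alpha> f) (D m) \<le> bergman_integral q \<alpha> f"
        using that q by (intro emeasure_bergman_measure_le) (auto simp: bergman_space_def)
      also have "\<dots> < \<infinity>" using that by (simp add: bergman_space_def)
      finally show ?thesis by (simp add: E_def)
    qed
    have E0: "E f m \<ge> 0" for f m by (simp add: E_def)
    have pt: "norm (f (of_real (1 - (1/2) ^ m))) powr q * 2 powr (- (real m * (\<alpha> + 2))) \<le> C * E f m"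
      if f: "f \<in> bergman_space q \<alpha>" for f m
    proof -
      have x: "0 \<le> 1 - (1/2::real) ^ m" "1 - (1/2::real) ^ m < 1" by (auto simp: power_le_one)
      then have nx: "norm (complex_of_real (1 - (1/2) ^ m)) = 1 - (1/2) ^ m" unfolding norm_of_real by simp
      have "ennreal (norm (f (of_real (1 - (1/2) ^ m))) powr q * (1 - (1 - (1/2) ^ m)) powr (\<alpha> + 2))
        \<le> ennreal C * emeasure (bergman_measure q \<alpha> f) (ball (of_real (1 - (1/2) ^ m)) ((1 - (1 - (1/2) ^ m)) / 4))"
        using C(2)[of f "of_real (1 - (1/2) ^ m)"] f x(2) unfolding nx by (simp add: bergman_space_def)
      also have "1 - (1 - (1/2::real) ^ m) = (1/2) ^ m" by simp
      also have "((1/2::real) ^ m) powr (\<alpha> + 2) = 2 powr (- (real m * (\<alpha> + 2)))"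
        unfolding half_power_powr by (simp add: powr_powr)
      finally have "ennreal (norm (f (of_real (1 - (1/2) ^ m))) powr q * 2 powr (- (real m * (\<alpha> + 2)))) \<le> ennreal (C * E f m)"
        using C(1) E[OF f, of m] by (simp add: D_def ennreal_mult')
      then show ?thesis using C(1) E0[of f m] by (subst (asm) ennreal_le_iff) auto
    qed
    have summand: "test_term p \<alpha> q n m
       \<le> 2 powr q * C / k * (E d m + E g m)" if "m \<in> M" for m
    proof -
      define x where "x = complex_of_real (1 - (1/2) ^ m)"
      define X where "X = 2 powr (real n * ((\<alpha> + 2) / p)) * 2 powr (real m * (\<alpha> + 2)) * tail n"
      have X0: "X \<ge> 0" by (simp add: X_def)
      have "2 powr (- (real c + \<alpha> + 2)) * X \<le> norm (H x)"
        using test_fun_lower_bound[OF p \<alpha>, of m n c] that M(2) by (auto simp: X_def H_def x_def mult.assoc)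
      then have "(2 powr (- (real c + \<alpha> + 2)) * X) powr q \<le> norm (H x) powr q"
        using X0 q by (intro powr_mono2) auto
      then have "k * X powr q \<le> norm (H x) powr q" by (simp add: powr_mult k_def)
      also have "norm (H x) powr q = norm (d x - (- g x)) powr q" by (simp add: d_def)
      also have "\<dots> \<le> 2 powr q * (norm (d x) powr q + norm (- g x) powr q)"
        by (rule powr_diff_norm_le[OF q])
      finally have "k * X powr q * 2 powr (- (real m * (\<alpha> + 2)))
        \<le> 2 powr q * (norm (d x) powr q + norm (g x) powr q) * 2 powr (- (real m * (\<alpha> + 2)))"
        by (intro mult_right_mono) auto
      also have "\<dots> = 2 powr q * (norm (d x) powr q * 2 powr (- (real m * (\<alpha> + 2))) + norm (g x) powr q * 2 powr (- (real m * (\<alpha> + 2))))"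
        by (simp add: algebra_simps)
      also have "\<dots> \<le> 2 powr q * (C * E d m + C * E g m)"
        unfolding x_def by (intro mult_left_mono add_mono pt d g) auto
      finally have "k * (2 powr (- (real m * (\<alpha> + 2))) * X powr q) \<le> 2 powr q * C * (E d m + E g m)"
        by (simp add: algebra_simps)
      then show ?thesis using k by (simp add: X_def pos_le_divide_eq mult.commute)
    qed
    have "(\<Sum>m\<in>M. E d m) \<le> enn2real (bergman_integral q \<alpha> d)"
    proof -
      have "ennreal (\<Sum>m\<in>M. E d m) = (\<Sum>m\<in>M. emeasure (bergman_measure q \<alpha> d) (D m))"
        by (simp add: E[OF d] sum_ennreal E0)
      also have "\<dots> \<le> (\<Sum>m. emeasure (bergman_measure q \<alpha> d) (D m))"
        using M(1) by (intro sum_le_suminf) auto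
      also have "\<dots> \<le> bergman_integral q \<alpha> d"
        unfolding D_def by (rule dyadic_ball_sum_le[OF hol(1) q])
      also have "\<dots> = ennreal (enn2real (bergman_integral q \<alpha> d))" using d by (simp add: bergman_space_def)
      finally show ?thesis by (subst (asm) ennreal_le_iff) auto
    qed
    then have sd: "(\<Sum>m\<in>M. E d m) + (\<Sum>m\<in>M. E g m) \<le> enn2real (bergman_integral q \<alpha> d) + (\<Sum>m\<in>M. E g m)" by simp
    have "(\<Sum>m\<in>M. test_term p \<alpha> q n m)
       \<le> (\<Sum>m\<in>M. 2 powr q * C / k * (E d m + E g m))"
      by (intro sum_mono summand)
    also have "\<dots> = 2 powr q * C / k * ((\<Sum>m\<in>M. E d m) + (\<Sum>m\<in>M. E g m))"
      by (simp only: sum_distrib_left[symmetric] sum.distrib)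
    also have "\<dots> \<le> 2 powr q * C / k * (enn2real (bergman_integral q \<alpha> d) + (\<Sum>m\<in>M. E g m))"
      using C(1) k by (intro mult_left_mono sd) auto
    finally show "(\<Sum>m\<in>M. test_term p \<alpha> q n m)
     \<le> 2 powr q * C / k * (enn2real (bergman_integral q \<alpha> (\<lambda>z. H_op \<mu> (\<alpha> + 2) (test_fun p \<alpha> c n) z - g z))
         + (\<Sum>m\<in>M. enn2real (emeasure (bergman_measure q \<alpha> g) (dyadic_ball m))))"
      by (simp add: E_def D_def d_def H_def)
  qed
qed

text \<open>This isolates what compactness provides: along a further subsequence the image converges
  in the target space, so its distance J to the limit tends to 0, and the masses G of the limit on
  the dyadic discs are summable. The constant K is chosen before the subsequence.\<close>

lemma H_compact_imp_subseq:
  assumes p: "0 < p" and \<alpha>: "\<alpha> > -1" and q: "q > 0"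
    and comp: "H_compact \<mu> (\<alpha> + 2) p \<alpha> q"
  shows "\<exists>K>0. \<forall>\<phi> :: nat \<Rightarrow> nat. strict_mono \<phi> \<longrightarrow>
    (\<exists>r J G. strict_mono r \<and> J \<longlonglongrightarrow> 0 \<and> summable G \<and> (\<forall>m. 0 \<le> G m) \<and>
     (\<forall>j M. finite M \<longrightarrow> M \<subseteq> {..\<phi> (r j)} \<longrightarrow>
       (\<Sum>m\<in>M. test_term p \<alpha> q (\<phi> (r j)) m)
       \<le> K * (J j + (\<Sum>m\<in>M. G m))))"
proof -
  \<comment> \<open>A large c keeps the normalised test functions bounded in the source space for
    the given p.\<close>
  obtain c :: nat where "(\<alpha> + 2) / p < real c" using reals_Archimedean2 by blast
  then have c: "real c * p > \<alpha> + 2" using p by (simp add: pos_divide_less_eq)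
  obtain B where B: "\<And>n. test_fun p \<alpha> c n \<in> bergman_space p \<alpha>" "\<And>n. bergman_norm p \<alpha> (test_fun p \<alpha> c n) \<le> B"
    using test_fun_bounded[OF p \<alpha> c] by blast
  obtain K where K: "K > 0" "\<And>n M g. finite M \<Longrightarrow> M \<subseteq> {..n} \<Longrightarrow> g \<in> bergman_space q \<alpha> \<Longrightarrow>
    H_op \<mu> (\<alpha> + 2) (test_fun p \<alpha> c n) \<in> bergman_space q \<alpha> \<Longrightarrow>
    (\<Sum>m\<in>M. test_term p \<alpha> q n m)
     \<le> K * (enn2real (bergman_integral q \<alpha> (\<lambda>z. H_op \<mu> (\<alpha> + 2) (test_fun p \<alpha> c n) z - g z))
         + (\<Sum>m\<in>M. enn2real (emeasure (bergman_measure q \<alpha> g) (dyadic_ball m))))"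
    using test_fun_sum_bound[OF p \<alpha> q] by blast
  have Hin: "H_op \<mu> (\<alpha> + 2) (test_fun p \<alpha> c n) \<in> bergman_space q \<alpha>" for n
    using comp B(1) by (simp add: H_compact_def)
  show ?thesis
  proof (intro exI[of _ K] conjI allI impI K(1))
    fix \<phi> :: "nat \<Rightarrow> nat" assume \<phi>: "strict_mono \<phi>"
    have "(\<forall>j. test_fun p \<alpha> c (\<phi> j) \<in> bergman_space p \<alpha>) \<and> (\<exists>B. \<forall>j. bergman_norm p \<alpha> (test_fun p \<alpha> c (\<phi> j)) \<le> B)"
      using B by blast
    then obtain r g where r: "strict_mono r" and g: "g \<in> bergman_space q \<alpha>"
      and lim: "(\<lambda>j. bergman_norm q \<alpha> (\<lambda>z. H_op \<mu> (\<alpha> + 2) (test_fun p \<alpha> c (\<phi> (r j))) z - g z)) \<longlonglongrightarrow> 0"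
      using comp unfolding H_compact_def by (elim conjE allE[of _ "\<lambda>j. test_fun p \<alpha> c (\<phi> j)"]) blast
    define J where "J = (\<lambda>j. enn2real (bergman_integral q \<alpha> (\<lambda>z. H_op \<mu> (\<alpha> + 2) (test_fun p \<alpha> c (\<phi> (r j))) z - g z)))"
    have "(\<lambda>j. pi / (\<alpha> + 1) * bergman_norm q \<alpha> (\<lambda>z. H_op \<mu> (\<alpha> + 2) (test_fun p \<alpha> c (\<phi> (r j))) z - g z) powr q) \<longlonglongrightarrow> pi / (\<alpha> + 1) * 0 powr q"
      using q by (intro tendsto_mult tendsto_const tendsto_powr' lim) (auto intro!: always_eventually simp: bergman_norm_def)
    moreover have "pi / (\<alpha> + 1) * bergman_norm q \<alpha> (\<lambda>z. H_op \<mu> (\<alpha> + 2) (test_fun p \<alpha> c (\<phi> (r j))) z - g z) powr q = J j" for j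
      using \<alpha> q by (simp add: bergman_norm_def powr_powr J_def)
    ultimately have J: "J \<longlonglongrightarrow> 0" by simp
    define G where "G = (\<lambda>m. enn2real (emeasure (bergman_measure q \<alpha> g) (dyadic_ball m)))"
    have ghol: "g holomorphic_on ball 0 1" and gfin: "bergman_integral q \<alpha> g < \<infinity>" using g by (auto simp: bergman_space_def)
    have "(\<Sum>m. ennreal (G m)) = (\<Sum>m. emeasure (bergman_measure q \<alpha> g) (dyadic_ball m))"
      unfolding G_def
      using le_less_trans[OF emeasure_bergman_measure_le[OF ghol q] gfin] by (intro suminf_cong) simp
    also have "\<dots> \<le> bergman_integral q \<alpha> g" by (rule dyadic_ball_sum_le[OF ghol q])
    finally have "(\<Sum>m. ennreal (G m)) \<noteq> top" using gfin by (auto simp: top_unique)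
    then have G: "summable G" by (rule summable_suminf_not_top[rotated]) (simp add: G_def)
    show "\<exists>r J G. strict_mono r \<and> J \<longlonglongrightarrow> 0 \<and> summable G \<and> (\<forall>m. 0 \<le> G m) \<and>
     (\<forall>j M. finite M \<longrightarrow> M \<subseteq> {..\<phi> (r j)} \<longrightarrow>
       (\<Sum>m\<in>M. test_term p \<alpha> q (\<phi> (r j)) m)
       \<le> K * (J j + (\<Sum>m\<in>M. G m)))"
    proof (intro exI conjI allI impI)
      show "strict_mono r" "J \<longlonglongrightarrow> 0" "summable G" by fact+
      show "0 \<le> G m" for m by (simp add: G_def)
      fix j M assume "finite M" "M \<subseteq> {..\<phi> (r j)}"
      from K(2)[OF this g Hin]
      show "(\<Sum>m\<in>M. test_term p \<alpha> q (\<phi> (r j)) m)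
       \<le> K * (J j + (\<Sum>m\<in>M. G m))" unfolding J_def G_def .
    qed
  qed
qed

text \<open>A single disc, m = n, suffices here: its mass under the limit is a term of a convergent
  series and tends to 0 along the subsequence. Collecting the powers of 2 in the one remaining term
  gives the exponent (\<alpha>+2)/p + (\<alpha>+2)(1-1/q).\<close>

lemma H_compact_imp_tendsto:
  assumes p: "0 < p" and \<alpha>: "\<alpha> > -1" and q: "q > 0"
    and comp: "H_compact \<mu> (\<alpha> + 2) p \<alpha> q"
  shows "(\<lambda>n. 2 powr (real n * ((\<alpha> + 2) / p + (\<alpha> + 2) * (1 - 1/q))) * tail n) \<longlonglongrightarrow> 0"
proof (rule tendsto_0_of_subseq)
  define b where "b = \<alpha> + 2"
  define \<kappa> where "\<kappa> = (\<lambda>n. 2 powr (real n * (b / p + b * (1 - 1/q))) * tail n)"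
  fix \<phi> :: "nat \<Rightarrow> nat" assume \<phi>: "strict_mono \<phi>"
  obtain K where K: "K > 0" "\<forall>\<phi> :: nat \<Rightarrow> nat. strict_mono \<phi> \<longrightarrow>
    (\<exists>r J G. strict_mono r \<and> J \<longlonglongrightarrow> 0 \<and> summable G \<and> (\<forall>m. 0 \<le> G m) \<and>
     (\<forall>j M. finite M \<longrightarrow> M \<subseteq> {..\<phi> (r j)} \<longrightarrow>
       (\<Sum>m\<in>M. test_term p \<alpha> q (\<phi> (r j)) m)
       \<le> K * (J j + (\<Sum>m\<in>M. G m))))"
    using H_compact_imp_subseq[OF p \<alpha> q comp] by (elim exE conjE)
  obtain r J G where r: "strict_mono r" and J: "J \<longlonglongrightarrow> 0" and G: "summable G"
    and bd: "\<forall>j M. finite M \<longrightarrow> M \<subseteq> {..\<phi> (r j)} \<longrightarrow>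
       (\<Sum>m\<in>M. 2 powr (- (real m * b)) * (2 powr (real (\<phi> (r j)) * (b / p)) * 2 powr (real m * b) * tail (\<phi> (r j))) powr q)
       \<le> K * (J j + (\<Sum>m\<in>M. G m))"
    using K(2)[THEN spec, THEN mp, OF \<phi>] unfolding b_def by (elim exE conjE)
  have \<phi>r: "filterlim (\<lambda>j. \<phi> (r j)) sequentially sequentially"
    using filterlim_subseq[OF strict_mono_o[OF \<phi> r]] by (simp add: o_def)
  have le: "\<kappa> (\<phi> (r j)) powr q \<le> K * (J j + G (\<phi> (r j)))" for j
  proof -
    define n where "n = \<phi> (r j)"
    define X where "X = tail n"
    have "2 powr (- (real n * b)) * (2 powr (real n * (b / p)) * 2 powr (real n * b) * X) powr q
      = (2 powr (- (real n * b / q)) * (2 powr (real n * (b / p)) * 2 powr (real n * b) * X)) powr q"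
      using q by (simp add: powr_mult powr_powr)
    also have "2 powr (- (real n * b / q)) * (2 powr (real n * (b / p)) * 2 powr (real n * b) * X) = \<kappa> n"
    proof -
      have "2 powr (- (real n * b / q)) * (2 powr (real n * (b / p)) * 2 powr (real n * b)) = 2 powr (real n * (b / p + b * (1 - 1/q)))"
        unfolding powr_add[symmetric] by (simp add: algebra_simps)
      then show ?thesis by (simp add: \<kappa>_def X_def flip: mult.assoc)
    qed
    finally show ?thesis
      using bd[rule_format, of "{n}" j] by (simp add: n_def X_def)
  qed
  have "(\<lambda>j. G (\<phi> (r j))) \<longlonglongrightarrow> 0"
    using filterlim_compose[OF summable_LIMSEQ_zero[OF G] \<phi>r] .
  then have lim: "(\<lambda>j. K * (J j + G (\<phi> (r j)))) \<longlonglongrightarrow> K * (0 + 0)"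
    by (intro tendsto_mult tendsto_add tendsto_const J)
  have "(\<lambda>j. \<kappa> (\<phi> (r j)) powr q) \<longlonglongrightarrow> 0"
    by (rule tendsto_sandwich[OF _ _ tendsto_const]) (use lim le in \<open>auto intro!: always_eventually\<close>)
  then have "(\<lambda>j. (\<kappa> (\<phi> (r j)) powr q) powr (1/q)) \<longlonglongrightarrow> 0 powr (1/q)"
    using q by (intro tendsto_powr' tendsto_const) (auto intro!: always_eventually)
  then have "(\<lambda>j. \<kappa> (\<phi> (r j))) \<longlonglongrightarrow> 0"
    using q by (simp add: powr_powr \<kappa>_def)
  with r show "\<exists>r. strict_mono r \<and> (\<lambda>j. 2 powr (real (\<phi> (r j)) * ((\<alpha> + 2) / p + (\<alpha> + 2) * (1 - 1/q))) * tail (\<phi> (r j))) \<longlonglongrightarrow> 0"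
    unfolding \<kappa>_def b_def by blast
qed

text \<open>For \<open>q = 1\<close> every dyadic ball with \<open>n/2 \<le> m \<le> n\<close> carries the same mass; their number produces
  the logarithm.\<close>
lemma H_compact_imp_tendsto_log:
  assumes p: "0 < p" and \<alpha>: "\<alpha> > -1"
    and comp: "H_compact \<mu> (\<alpha> + 2) p \<alpha> 1"
  shows "(\<lambda>n. (real n + 1) * (2 powr (real n * ((\<alpha> + 2) / p)) * tail n)) \<longlonglongrightarrow> 0"
proof (rule tendsto_0_of_subseq)
  define b where "b = \<alpha> + 2"
  define \<kappa> where "\<kappa> = (\<lambda>n. 2 powr (real n * (b / p)) * tail n)"
  have \<kappa>0: "\<kappa> n \<ge> 0" for n by (simp add: \<kappa>_def)
  fix \<phi> :: "nat \<Rightarrow> nat" assume \<phi>: "strict_mono \<phi>"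
  obtain K where K: "K > 0" "\<forall>\<phi> :: nat \<Rightarrow> nat. strict_mono \<phi> \<longrightarrow>
    (\<exists>r J G. strict_mono r \<and> J \<longlonglongrightarrow> 0 \<and> summable G \<and> (\<forall>m. 0 \<le> G m) \<and>
     (\<forall>j M. finite M \<longrightarrow> M \<subseteq> {..\<phi> (r j)} \<longrightarrow>
       (\<Sum>m\<in>M. test_term p \<alpha> 1 (\<phi> (r j)) m)
       \<le> K * (J j + (\<Sum>m\<in>M. G m))))"
    using H_compact_imp_subseq[OF p \<alpha> zero_less_one comp] by (elim exE conjE)
  obtain r J G where r: "strict_mono r" and J: "J \<longlonglongrightarrow> 0" and G: "summable G" "\<forall>m. 0 \<le> G m"
    and bd: "\<forall>j M. finite M \<longrightarrow> M \<subseteq> {..\<phi> (r j)} \<longrightarrow>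
       (\<Sum>m\<in>M. 2 powr (- (real m * b)) * (2 powr (real (\<phi> (r j)) * (b / p)) * 2 powr (real m * b) * tail (\<phi> (r j))) powr 1)
       \<le> K * (J j + (\<Sum>m\<in>M. G m))"
    using K(2)[THEN spec, THEN mp, OF \<phi>] unfolding b_def by (elim exE conjE)
  have \<phi>r: "filterlim (\<lambda>j. \<phi> (r j)) sequentially sequentially"
    using filterlim_subseq[OF strict_mono_o[OF \<phi> r]] by (simp add: o_def)
  have half: "filterlim (\<lambda>n::nat. n div 2) sequentially sequentially"
    unfolding filterlim_sequentially_iff_filterlim_real by real_asymp
  define T where "T = (\<lambda>n. \<Sum>m. G (m + n))"
  have T: "T \<longlonglongrightarrow> 0" unfolding T_def by (rule suminf_exist_split2[OF G(1)])
  have le: "(real (\<phi> (r j)) + 1) * \<kappa> (\<phi> (r j)) \<le> 2 * K * (J j + T (\<phi> (r j) div 2))" for j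
  proof -
    define n where "n = \<phi> (r j)"
    \<comment> \<open>Starting at n/2 reconciles two demands: the sum of G over the block is at most
      a tail of a convergent series, yet the block still has at least (n+1)/2 elements.\<close>
    define M where "M = {n div 2..n}"
    have summand: "2 powr (- (real m * b)) * (2 powr (real n * (b / p)) * 2 powr (real m * b) * tail n) powr 1 = \<kappa> n" for m
    proof -
      have "2 powr (- (real m * b)) * 2 powr (real m * b) = (1::real)" by (simp flip: powr_add)
      then show ?thesis by (simp add: \<kappa>_def)
    qed
    have "(\<Sum>m\<in>M. \<kappa> n) \<le> K * (J j + (\<Sum>m\<in>M. G m))"
      using bd[rule_format, of M j] unfolding n_def[symmetric] summand by (auto simp: M_def)
    moreover have "(\<Sum>m\<in>M. G m) \<le> T (n div 2)"
    proof -
      have "(\<Sum>m\<in>M. G m) = (\<Sum>m\<in>{0..n - n div 2}. G (m + n div 2))"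
        unfolding M_def using sum.shift_bounds_cl_nat_ivl[of G 0 "n div 2" "n - n div 2"] by simp
      also have "\<dots> \<le> T (n div 2)"
        unfolding T_def using G by (intro sum_le_suminf summable_ignore_initial_segment) auto
      finally show ?thesis .
    qed
    moreover have "(real n + 1) / 2 * \<kappa> n \<le> (\<Sum>m\<in>M. \<kappa> n)"
    proof -
      have "n + 1 \<le> 2 * card M" by (simp add: M_def)
      then have "real (n + 1) \<le> real (2 * card M)" by (rule of_nat_mono)
      then have "(real n + 1) / 2 * \<kappa> n \<le> real (card M) * \<kappa> n" using \<kappa>0 by (intro mult_right_mono) auto
      then show ?thesis by simp
    qed
    ultimately have "(real n + 1) / 2 * \<kappa> n \<le> K * (J j + T (n div 2))"
      using K(1) by (smt (verit) mult_left_mono)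
    then show ?thesis by (simp add: n_def)
  qed
  have "(\<lambda>j. T (\<phi> (r j) div 2)) \<longlonglongrightarrow> 0"
    using filterlim_compose[OF filterlim_compose[OF T half] \<phi>r] .
  then have lim: "(\<lambda>j. 2 * K * (J j + T (\<phi> (r j) div 2))) \<longlonglongrightarrow> 2 * K * (0 + 0)"
    by (intro tendsto_mult tendsto_add tendsto_const J)
  have "(\<lambda>j. (real (\<phi> (r j)) + 1) * \<kappa> (\<phi> (r j))) \<longlonglongrightarrow> 0"
    by (rule tendsto_sandwich[OF _ _ tendsto_const]) (use lim le \<kappa>0 in \<open>auto intro!: always_eventually\<close>)
  with r show "\<exists>r. strict_mono r \<and> (\<lambda>j. (real (\<phi> (r j)) + 1) * (2 powr (real (\<phi> (r j)) * ((\<alpha> + 2) / p)) * tail (\<phi> (r j)))) \<longlonglongrightarrow> 0"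
    unfolding \<kappa>_def b_def by blast
qed

end

section \<open>Carleson boxes on the real axis and dyadic tails\<close>

lemma carleson_box_real_subset:
  assumes "0 < L" "L < 2 * pi"
  shows "{t. 0 \<le> t \<and> t < 1 \<and> complex_of_real t \<in> carleson_box a L} \<subseteq> {1 - L / (2 * pi)..<1}"
proof
  fix t assume "t \<in> {t. 0 \<le> t \<and> t < 1 \<and> complex_of_real t \<in> carleson_box a L}"
  then obtain r w where t: "0 \<le> t" "t < 1" "complex_of_real t = of_real r * w" "w \<in> arc a L" "1 - L / (2 * pi) \<le> r"
    by (auto simp: carleson_box_def)
  \<comment> \<open>Positivity of r excludes a representation of t with negative r and w = -1, so
    equality of the moduli yields t = r.\<close>
  have "0 < 1 - L / (2 * pi)" using assms by simp
  then have r: "r > 0" using t by linarith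
  have "norm w = 1" using t(4) by (auto simp: arc_def)
  then have "\<bar>t\<bar> = \<bar>r\<bar>" using arg_cong[OF t(3), of norm] by (simp add: norm_mult)
  then show "t \<in> {1 - L / (2 * pi)..<1}" using t r by auto
qed

lemma box_measure_le:
  assumes "sets \<mu> = sets borel" "0 < L" "L < 2 * pi"
  shows "box_measure \<mu> a L \<le> emeasure \<mu> {1 - L / (2 * pi)..<1}"
  unfolding box_measure_def using assms by (intro emeasure_mono carleson_box_real_subset) auto

text \<open>An arc starting at angle 0 contains the point 1, so its box contains the whole segment
  [1 - L/(2 pi), 1). Together with the upper bound this makes it the extremal position of the
  arc.\<close>

lemma box_measure_0:
  assumes "0 < L" "L < 2 * pi"
  shows "box_measure \<mu> 0 L = emeasure \<mu> {1 - L / (2 * pi)..<1}"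
proof -
  have "{1 - L / (2 * pi)..<1} \<subseteq> {t. 0 \<le> t \<and> t < 1 \<and> complex_of_real t \<in> carleson_box 0 L}"
  proof
    fix t assume t: "t \<in> {1 - L / (2 * pi)..<1}"
    have "0 < 1 - L / (2 * pi)" using assms by simp
    then have "0 \<le> t" using t unfolding atLeastLessThan_iff by linarith
    have "1 \<in> arc 0 L" using assms by (auto simp: arc_def intro!: exI[of _ 0])
    then have "complex_of_real t \<in> carleson_box 0 L"
      unfolding carleson_box_def mem_Collect_eq using t by (intro exI[of _ t] exI[of _ 1]) auto
    then show "t \<in> {t. 0 \<le> t \<and> t < 1 \<and> complex_of_real t \<in> carleson_box 0 L}" using t \<open>0 \<le> t\<close> by simp
  qed
  then show ?thesis
    unfolding box_measure_def using carleson_box_real_subset[OF assms, of 0] by (metis subset_antisym)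
qed

text \<open>The plain and the logarithmic condition are handled together: \<open>\<l>\<close> is the
  weight as a function of the arc length and \<open>w\<close> its dyadic counterpart. The bound of
  \<open>w\<close> by \<open>\<l>\<close> is asked only for n \<ge> 1, since n = 0 corresponds to
  the full circle, where the logarithm vanishes.\<close>

lemma (in interval_measure) weighted_vanishing_iff:
  assumes s: "s > 0" and c: "c > 0" and w: "\<And>n. 0 \<le> w n"
    and wl: "\<And>n. 1 \<le> n \<Longrightarrow> w n \<le> c * \<l> (2 * pi * (1/2) ^ n)"
    and lw: "\<And>n L. (1/2) ^ Suc n < L / (2 * pi) \<Longrightarrow> L / (2 * pi) \<le> (1/2) ^ n \<Longrightarrow> \<l> L \<le> c * w n"
    and l0: "\<And>L. 0 < L \<Longrightarrow> L < 2 * pi \<Longrightarrow> 0 \<le> \<l> L"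
  shows "(\<forall>\<epsilon>>0. \<exists>\<delta>>0. \<forall>a L. 0 < L \<and> L < 2 * pi \<and> L < \<delta> \<longrightarrow> box_measure \<mu> a L * ennreal (\<l> L) \<le> ennreal (\<epsilon> * L powr s))
     \<longleftrightarrow> (\<lambda>n. w n * (2 powr (real n * s) * tail n)) \<longlonglongrightarrow> 0"
    (is "?V \<longleftrightarrow> ?T")
proof
  assume V: ?V
  show ?T
  proof (rule tendstoI)
    fix e :: real assume e: "e > 0"
    \<comment> \<open>At L = 2 pi 2^-n one has L^s = (2 pi)^s 2^(-ns), so the constants cancel; the
      factor 2 provides the strict inequality.\<close>
    define \<epsilon> where "\<epsilon> = e / (2 * c * (2 * pi) powr s)"
    have \<epsilon>: "\<epsilon> > 0" using e c by (simp add: \<epsilon>_def)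
    obtain \<delta> where \<delta>: "\<delta> > 0" "\<And>a L. 0 < L \<Longrightarrow> L < 2 * pi \<Longrightarrow> L < \<delta> \<Longrightarrow> box_measure \<mu> a L * ennreal (\<l> L) \<le> ennreal (\<epsilon> * L powr s)"
      using V \<epsilon> by meson
    have "(\<lambda>n. 2 * pi * (1/2) ^ n :: real) \<longlonglongrightarrow> 2 * pi * 0"
      by (intro tendsto_mult tendsto_const LIMSEQ_power_zero) auto
    then have "\<forall>\<^sub>F n in sequentially. 2 * pi * (1/2) ^ n < \<delta>"
      using \<delta>(1) by (intro order_tendstoD(2)) auto
    then show "\<forall>\<^sub>F n in sequentially. dist (w n * (2 powr (real n * s) * tail n)) 0 < e"
      using eventually_ge_at_top[of 1]
    proof eventually_elim
      case (elim n)
      define L :: real where "L = 2 * pi * (1/2) ^ n"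
      have "(1/2::real) ^ n \<le> (1/2) ^ 1" using elim by (intro half_power_antimono) auto
      then have L: "0 < L" "L < 2 * pi" "L < \<delta>" using elim by (auto simp: L_def)
      have Lpi: "1 - L / (2 * pi) = 1 - (1/2) ^ n" by (simp add: L_def)
      have "ennreal (tail n * \<l> L) = box_measure \<mu> 0 L * ennreal (\<l> L)"
        using l0[OF L(1,2)] unfolding box_measure_0[OF L(1,2)] Lpi
        by (simp add: emeasure_eq_measure ennreal_mult')
      also have "\<dots> \<le> ennreal (\<epsilon> * L powr s)" by (rule \<delta>(2)[OF L])
      finally have 1: "tail n * \<l> L \<le> \<epsilon> * L powr s"
        using \<epsilon> by (subst (asm) ennreal_le_iff) auto
      have Ls: "L powr s = (2 * pi) powr s * 2 powr (- (real n * s))"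
        unfolding L_def half_power_powr by (simp add: powr_mult powr_powr)
      have "w n * (2 powr (real n * s) * tail n)
        \<le> (c * \<l> L) * (2 powr (real n * s) * tail n)"
        unfolding L_def using elim by (intro mult_right_mono wl) auto
      also have "\<dots> = c * 2 powr (real n * s) * (tail n * \<l> L)" by simp
      also have "\<dots> \<le> c * 2 powr (real n * s) * (\<epsilon> * L powr s)"
        using c by (intro mult_left_mono 1) auto
      also have "\<dots> = c * \<epsilon> * (2 * pi) powr s * (2 powr (real n * s) * 2 powr (- (real n * s)))"
        unfolding Ls by simp
      also have "2 powr (real n * s) * 2 powr (- (real n * s)) = (1::real)" by (simp flip: powr_add)
      also have "c * \<epsilon> * (2 * pi) powr s * 1 = e / 2" using c by (simp add: \<epsilon>_def)
      also have "\<dots> < e" using e by simp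
      finally show ?case using w[of n] by simp
    qed
  qed
next
  assume T: ?T
  show ?V
  proof (intro allI impI)
    fix \<epsilon> :: real assume \<epsilon>: "\<epsilon> > 0"
    \<comment> \<open>For L with 2^-(n+1) < L/(2 pi) one has 2^-n < L/pi, which is the source of the
      power of pi.\<close>
    define \<eta> where "\<eta> = \<epsilon> * pi powr s / c"
    have \<eta>: "\<eta> > 0" using \<epsilon> c by (simp add: \<eta>_def)
    obtain N where N: "\<And>n. n \<ge> N \<Longrightarrow> w n * (2 powr (real n * s) * tail n) < \<eta>"
      using order_tendstoD(2)[OF T \<eta>] by (auto simp: eventually_sequentially)
    show "\<exists>\<delta>>0. \<forall>a L. 0 < L \<and> L < 2 * pi \<and> L < \<delta> \<longrightarrow> box_measure \<mu> a L * ennreal (\<l> L) \<le> ennreal (\<epsilon> * L powr s)"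
    proof (intro exI[of _ "2 * pi * (1/2) ^ N"] conjI allI impI)
      fix a L :: real assume L: "0 < L \<and> L < 2 * pi \<and> L < 2 * pi * (1/2) ^ N"
      then have "0 \<le> 1 - L / (2 * pi)" "1 - L / (2 * pi) < 1" by auto
      then obtain n where "1 - L / (2 * pi) \<in> half_open_dyadic n" by (rule half_open_dyadic_exists)
      then have n: "(1/2) ^ Suc n < L / (2 * pi)" "L / (2 * pi) \<le> (1/2) ^ n" by (auto simp: half_open_dyadic_def)
      have "L / (2 * pi) < (1/2) ^ N" using L by (simp add: pos_divide_less_eq mult.commute)
      then have nN: "n \<ge> N" using n(1) half_power_antimono[of "Suc n" N] by (meson not_le not_less_eq_eq order.strict_trans order_less_irrefl less_le_trans)
      have "box_measure \<mu> a L * ennreal (\<l> L) \<le> emeasure \<mu> {1 - L / (2 * pi)..<1} * ennreal (\<l> L)"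
        using L by (intro mult_right_mono box_measure_le) auto
      also have "\<dots> \<le> emeasure \<mu> {1 - (1/2) ^ n..<1} * ennreal (c * w n)"
        using n by (intro mult_mono emeasure_mono ennreal_leI lw) auto
      also have "\<dots> = ennreal (tail n * (c * w n))"
        using c w[of n] by (simp add: emeasure_eq_measure ennreal_mult')
      also have "\<dots> \<le> ennreal (\<epsilon> * L powr s)"
      proof (rule ennreal_leI)
        have "((1/2) ^ n) powr s \<le> (L / pi) powr s"
          using n s L by (intro powr_mono2) (auto simp: field_simps)
        then have Ls: "2 powr (- (real n * s)) \<le> L powr s / pi powr s"
          unfolding half_power_powr using L by (simp add: powr_powr powr_divide)
        have e1: "2 powr (- (real n * s)) * 2 powr (real n * s) = (1::real)" by (simp flip: powr_add)
        have "tail n * (c * w n)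
          = c * (w n * (2 powr (real n * s) * tail n)) * 2 powr (- (real n * s))"
          using e1 by (simp add: mult_ac)
        also have "\<dots> \<le> c * \<eta> * (L powr s / pi powr s)"
          using N[OF nN] c \<eta> w[of n] by (intro mult_mono Ls) auto
        also have "\<dots> = \<epsilon> * L powr s" using c by (simp add: \<eta>_def)
        finally show "tail n * (c * w n) \<le> \<epsilon> * L powr s" .
      qed
      finally show "box_measure \<mu> a L * ennreal (\<l> L) \<le> ennreal (\<epsilon> * L powr s)" .
    qed simp
  qed
qed

lemma (in interval_measure) vanishing_carleson_iff:
  assumes "s > 0"
  shows "vanishing_carleson \<mu> s \<longleftrightarrow> (\<lambda>n. 2 powr (real n * s) * tail n) \<longlonglongrightarrow> 0"
proof -
  have "(\<forall>\<epsilon>>0. \<exists>\<delta>>0. \<forall>a L. 0 < L \<and> L < 2 * pi \<and> L < \<delta> \<longrightarrow> box_measure \<mu> a L * ennreal 1 \<le> ennreal (\<epsilon> * L powr s))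
     \<longleftrightarrow> (\<lambda>n. 1 * (2 powr (real n * s) * tail n)) \<longlonglongrightarrow> 0"
    by (rule weighted_vanishing_iff[OF assms, of 1]) auto
  then show ?thesis by (simp only: vanishing_carleson_def ennreal_1 mult_1 mult_1_right)
qed

text \<open>At L = 2 pi 2^-n the logarithm is n ln 2. The constant 2/ln 2 serves both comparisons: n
  + 1 \<le> 2n for n \<ge> 1, and (n+1) ln 2 \<le> (n+1) 2/ln 2 because ln 2 \<le> 1.\<close>

lemma (in interval_measure) vanishing_log_carleson_iff:
  assumes "s > 0"
  shows "vanishing_log_carleson \<mu> 1 s \<longleftrightarrow> (\<lambda>n. (real n + 1) * (2 powr (real n * s) * tail n)) \<longlonglongrightarrow> 0"
  unfolding vanishing_log_carleson_def
proof (rule weighted_vanishing_iff[OF assms, of "2 / ln 2"])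
  fix n :: nat assume n: "1 \<le> n"
  have "2 * pi / (2 * pi * (1/2) ^ n) = (2::real) ^ n" by (simp add: power_one_over)
  then have "ln (2 * pi / (2 * pi * (1/2) ^ n)) powr 1 = real n * ln 2"
    by (simp add: ln_realpow)
  then show "real n + 1 \<le> 2 / ln 2 * ln (2 * pi / (2 * pi * (1/2) ^ n)) powr 1"
    using n by simp
next
  fix n :: nat and L :: real assume L: "(1/2) ^ Suc n < L / (2 * pi)" "L / (2 * pi) \<le> (1/2) ^ n"
  have L0: "L / (2 * pi) > 0" using L(1) by (rule less_trans[rotated]) simp
  then have L0': "L > 0" by (simp add: zero_less_divide_iff)
  have eq: "2 * pi / L = 1 / (L / (2 * pi))" using L0' by simp
  have "1 / (L / (2 * pi)) \<le> 1 / (1/2) ^ Suc n"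
    using L L0 by (intro divide_left_mono mult_pos_pos) auto
  then have "2 * pi / L \<le> 2 ^ Suc n" unfolding eq by (simp add: power_one_over)
  then have "ln (2 * pi / L) \<le> ln (2 ^ Suc n)" using L0' by (subst ln_le_cancel_iff) auto
  also have "\<dots> = real (Suc n) * ln 2" by (rule ln_realpow)
  also have "\<dots> \<le> (real n + 1) * (2 / ln 2)"
  proof -
    have "ln 2 * ln 2 \<le> 1 * (1::real)" using ln_le_minus_one[of 2] by (intro mult_mono) auto
    then have "ln 2 \<le> 2 / ln (2::real)" by (simp add: pos_le_divide_eq)
    then have "(real n + 1) * ln 2 \<le> (real n + 1) * (2 / ln 2)" by (rule mult_left_mono) simp
    then show ?thesis by (simp only: of_nat_Suc add.commute[of 1])
  qed
  finally have "ln (2 * pi / L) \<le> 2 / ln 2 * (real n + 1)" by (simp only: mult.commute)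
  moreover have "0 \<le> ln (2 * pi / L)"
  proof (rule ln_ge_zero)
    have "(1/2::real) ^ n \<le> 1" by (simp add: power_le_one)
    then have "L / (2 * pi) \<le> 1" using L(2) by linarith
    then show "1 \<le> 2 * pi / L" using L0' by (simp add: field_simps)
  qed
  ultimately show "ln (2 * pi / L) powr 1 \<le> 2 / ln 2 * (real n + 1)" by simp
qed auto

text \<open>The three ranges of p cover all cases, so some Carleson condition holds, and at t = 0 it
  bounds the mass of [0,1); the complement is a null set by assumption.\<close>

lemma W_cond_imp_finite_measure:
  assumes "0 < p" "sets \<mu> = sets borel" "emeasure \<mu> (- {0..<1}) = 0" "W_cond \<mu> p \<alpha>"
  shows "interval_measure \<mu>"
proof -
  have "\<exists>s. carleson \<mu> s" using assms(4) unfolding W_cond_def by (metis linear)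
  then obtain s C where "\<And>t. 0 \<le> t \<Longrightarrow> t < 1 \<Longrightarrow> emeasure \<mu> {t..<1} \<le> ennreal (C * (1 - t) powr s)"
    unfolding carleson_def by auto
  from this[of 0] have "emeasure \<mu> {0..<1} < \<infinity>" by (auto intro: le_less_trans)
  moreover have "emeasure \<mu> (space \<mu>) \<le> emeasure \<mu> {0..<1} + emeasure \<mu> (- {0..<1})"
    using emeasure_subadditive[of "{0..<1}" \<mu> "- {0..<1}"] sets_eq_imp_space_eq[OF assms(2)] assms(2) by simp
  ultimately have "emeasure \<mu> (space \<mu>) \<noteq> \<infinity>" using assms(3) by auto
  then show ?thesis
    using assms(2) by (simp add: interval_measure_def interval_measure_axioms_def finite_measureI)
qed

section \<open>The two equivalences\<close>

lemma (in interval_measure) half_open_dyadic_le: "mass n \<le> tail n"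
proof (rule finite_measure_mono)
  have "(0::real) < (1/2) ^ Suc n" by simp
  then show "half_open_dyadic n \<subseteq> {1 - (1/2) ^ n..<1}"
    unfolding half_open_dyadic_def by (intro subsetI, unfold atLeastLessThan_iff) linarith
qed simp

text \<open>Here 1/q' = 1 - 1/q. Necessity controls the tails, which are equivalent to the vanishing
  condition; sufficiency asks only for the masses of the dyadic intervals, which the tails
  dominate.\<close>

lemma (in interval_measure) H_compact_iff_gt_1:
  assumes p: "0 < p" and \<alpha>: "\<alpha> > -1" and q: "1 < q" "p \<le> q"
  shows "H_compact \<mu> (\<alpha> + 2) p \<alpha> q \<longleftrightarrow> vanishing_carleson \<mu> ((\<alpha> + 2) / p + (\<alpha> + 2) / conj_exp q)"
proof -
  define s where "s = (\<alpha> + 2) / p + (\<alpha> + 2) * (1 - 1/q)"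
  have "(\<alpha> + 2) / conj_exp q = (\<alpha> + 2) * (1 - 1/q)"
    using q by (simp add: conj_exp_def field_simps)
  then have s: "(\<alpha> + 2) / p + (\<alpha> + 2) / conj_exp q = s" by (simp add: s_def)
  have "s > 0" using p \<alpha> q by (simp add: s_def add_pos_nonneg)
  note iff = vanishing_carleson_iff[OF this]
  show ?thesis unfolding s iff
  proof
    assume "H_compact \<mu> (\<alpha> + 2) p \<alpha> q"
    then show "(\<lambda>n. 2 powr (real n * s) * tail n) \<longlonglongrightarrow> 0"
      unfolding s_def using q by (intro H_compact_imp_tendsto p \<alpha>) auto
  next
    assume lim: "(\<lambda>n. 2 powr (real n * s) * tail n) \<longlonglongrightarrow> 0"
    have "(\<lambda>n. mass n * 2 powr (real n * s)) \<longlonglongrightarrow> 0"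
    proof (rule tendsto_sandwich[OF _ _ tendsto_const lim])
      show "\<forall>\<^sub>F n in sequentially. mass n * 2 powr (real n * s) \<le> 2 powr (real n * s) * tail n"
        by (intro always_eventually allI, subst mult.commute) (intro mult_left_mono half_open_dyadic_le, simp)
    qed simp
    then show "H_compact \<mu> (\<alpha> + 2) p \<alpha> q"
      unfolding s_def by (rule H_compact_gt_1[OF p \<alpha> q])
  qed
qed

lemma (in interval_measure) H_compact_iff_1:
  assumes p: "0 < p" "p \<le> 1" and \<alpha>: "\<alpha> > -1"
  shows "H_compact \<mu> (\<alpha> + 2) p \<alpha> 1 \<longleftrightarrow> vanishing_log_carleson \<mu> 1 ((\<alpha> + 2) / p)"
proof -
  have "(\<alpha> + 2) / p > 0" using p(1) \<alpha> by (intro divide_pos_pos) auto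
  note iff = vanishing_log_carleson_iff[OF this]
  show ?thesis unfolding iff
  proof
    assume "H_compact \<mu> (\<alpha> + 2) p \<alpha> 1"
    then show "(\<lambda>n. (real n + 1) * (2 powr (real n * ((\<alpha> + 2) / p)) * tail n)) \<longlonglongrightarrow> 0"
      by (rule H_compact_imp_tendsto_log[OF p(1) \<alpha>])
  next
    assume lim: "(\<lambda>n. (real n + 1) * (2 powr (real n * ((\<alpha> + 2) / p)) * tail n)) \<longlonglongrightarrow> 0"
    have "(\<lambda>n. (real n + 1) * (mass n * 2 powr (real n * ((\<alpha> + 2) / p)))) \<longlonglongrightarrow> 0"
    proof (rule tendsto_sandwich[OF _ _ tendsto_const lim])
      show "\<forall>\<^sub>F n in sequentially. (real n + 1) * (mass n * 2 powr (real n * ((\<alpha> + 2) / p)))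
          \<le> (real n + 1) * (2 powr (real n * ((\<alpha> + 2) / p)) * tail n)"
      proof (intro always_eventually allI mult_left_mono)
        show "mass n * 2 powr (real n * ((\<alpha> + 2) / p)) \<le> 2 powr (real n * ((\<alpha> + 2) / p)) * tail n" for n
          by (subst mult.commute) (intro mult_left_mono half_open_dyadic_le, simp)
      qed simp
    qed simp
    then show "H_compact \<mu> (\<alpha> + 2) p \<alpha> 1" by (rule H_compact_1[OF p \<alpha>])
  qed
qed

theorem theorem5p01:
  fixes p \<alpha> q :: real and \<mu> :: "real measure"
  assumes "0 < p" and "\<alpha> > -1"
    and "sets \<mu> = sets borel" and "emeasure \<mu> (- {0..<1}) = 0"
    and "W_cond \<mu> p \<alpha>"
  shows "(q \<ge> p \<and> q > 1 \<longrightarrow>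
           (H_compact \<mu> (\<alpha> + 2) p \<alpha> q \<longleftrightarrow>
            vanishing_carleson \<mu> ((\<alpha> + 2) / p + (\<alpha> + 2) / conj_exp q)))
       \<and> (q \<ge> p \<and> q = 1 \<longrightarrow>
           (H_compact \<mu> (\<alpha> + 2) p \<alpha> 1 \<longleftrightarrow>
            vanishing_log_carleson \<mu> 1 ((\<alpha> + 2) / p)))"
proof -
  interpret interval_measure \<mu>
    by (rule W_cond_imp_finite_measure[OF assms(1,3-5)])
  show ?thesis
  proof (intro conjI impI)
    assume "q \<ge> p \<and> q > 1"
    then show "H_compact \<mu> (\<alpha> + 2) p \<alpha> q \<longleftrightarrow> vanishing_carleson \<mu> ((\<alpha> + 2) / p + (\<alpha> + 2) / conj_exp q)"
      using H_compact_iff_gt_1[OF assms(1,2)] by simp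
  next
    assume "q \<ge> p \<and> q = 1"
    then show "H_compact \<mu> (\<alpha> + 2) p \<alpha> 1 \<longleftrightarrow> vanishing_log_carleson \<mu> 1 ((\<alpha> + 2) / p)"
      using H_compact_iff_1[OF assms(1) _ assms(2)] by simp
  qed
qed

end
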